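(* Let $p$ be a prime number, let $R$ be a $p$-adically complete Noetherian integral domain of finite Krull dimension whose field of fractions has characteristic zero, and let $G$ be a finite group. If $n$ is a positive integer with $p^n>2$, then $\mathrm{SK}_1(R[G])$ maps isomorphically onto $\mathrm{SK}_1(R[G])_n$ under the natural map $\mathrm{K}_1(R[G])\to \mathrm{K}_1(R_n[G])$, where $R_n=R/p^nR$.
   Context: $R$ is $p$-adically complete means that the natural map $R\to\varprojlim_n R/p^nR$ is an isomorphism. Let $N$ be the field of fractions of $R$ and $N^c$ an algebraic closure of $N$. The map $\mathrm{Det}:\mathrm{K}_1(R[G])\to \mathrm{K}_1(N^c[G])=\bigoplus_\chi N^{c\times}$ (sum over the irreducible $N^c$-valued characters $\chi$ of $G$) is induced by $R[G]\subset N^c[G]$, and $\mathrm{SK}_1(R[G])=\ker(\mathrm{Det})$. The group $\mathrm{SK}_1(R[G])_n$ is by definition the image of $\mathrm{SK}_1(R[G])$ in $\mathrm{K}_1(R_n[G])$. *)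

theory Defs
  imports "HOL-Algebra.Algebra" "HOL-Algebra.Algebraic_Closure" "HOL-Library.Extended_Nat"
begin

section \<open>Hypotheses on the coefficient ring\<close>

definition krull_dim :: "('r, 'm) ring_scheme \<Rightarrow> enat" where
  "krull_dim R = Sup {enat n | n. \<exists>P. (\<forall>i\<le>n. primeideal (P i) R) \<and> (\<forall>i<n. P i \<subset> P (Suc i))}"

definition pow_ideal :: "('r, 'm) ring_scheme \<Rightarrow> nat \<Rightarrow> nat \<Rightarrow> 'r set" where
  "pow_ideal R p n = PIdl\<^bsub>R\<^esub> (add_pow R (p ^ n) \<one>\<^bsub>R\<^esub>)"

text \<open>The inverse limit of the rings \<open>R/p^nR\<close>, as a ring of compatible sequences. The
  transition map \<open>R/p^(n+1)R \<rightarrow> R/p^nR\<close> takes a coset \<open>X\<close> to \<open>p^nR + X\<close>. The index \<open>n\<close> starts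
  at 0, which only contributes the zero ring.\<close>

definition padic_limit :: "('r, 'm) ring_scheme \<Rightarrow> nat \<Rightarrow> (nat \<Rightarrow> 'r set) ring" where
  "padic_limit R p =
     \<lparr>carrier = {s. (\<forall>n. s n \<in> carrier (R Quot pow_ideal R p n)) \<and>
                    (\<forall>n. pow_ideal R p n <+>\<^bsub>R\<^esub> s (Suc n) = s n)},
      monoid.mult = (\<lambda>s t n. s n \<otimes>\<^bsub>R Quot pow_ideal R p n\<^esub> t n),
      monoid.one = (\<lambda>n. \<one>\<^bsub>R Quot pow_ideal R p n\<^esub>),
      ring.zero = (\<lambda>n. \<zero>\<^bsub>R Quot pow_ideal R p n\<^esub>),
      ring.add = (\<lambda>s t n. s n \<oplus>\<^bsub>R Quot pow_ideal R p n\<^esub> t n)\<rparr>"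

definition padically_complete :: "('r, 'm) ring_scheme \<Rightarrow> nat \<Rightarrow> bool" where
  "padically_complete R p \<longleftrightarrow>
     (\<lambda>x n. pow_ideal R p n +>\<^bsub>R\<^esub> x) \<in> ring_iso R (padic_limit R p)"

definition is_fraction_field ::
    "('r, 'm) ring_scheme \<Rightarrow> ('f, 'k) ring_scheme \<Rightarrow> ('r \<Rightarrow> 'f) \<Rightarrow> bool" where
  "is_fraction_field R N \<iota> \<longleftrightarrow>
     field N \<and> \<iota> \<in> ring_hom R N \<and> inj_on \<iota> (carrier R) \<and>
     (\<forall>x\<in>carrier N. \<exists>a\<in>carrier R. \<exists>b\<in>carrier R - {\<zero>\<^bsub>R\<^esub>}. x = \<iota> a \<otimes>\<^bsub>N\<^esub> inv\<^bsub>N\<^esub> (\<iota> b))"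


section \<open>Group rings\<close>

text \<open>The group ring of a finite group: all functions on \<open>G\<close> with the convolution product.\<close>

definition group_ring ::
    "('r, 'm) ring_scheme \<Rightarrow> ('g, 'k) monoid_scheme \<Rightarrow> ('g \<Rightarrow> 'r) ring" where
  "group_ring R G =
     \<lparr>carrier = carrier G \<rightarrow>\<^sub>E carrier R,
      monoid.mult = (\<lambda>a b. \<lambda>g\<in>carrier G.
                \<Oplus>\<^bsub>R\<^esub>h\<in>carrier G. a h \<otimes>\<^bsub>R\<^esub> b (inv\<^bsub>G\<^esub> h \<otimes>\<^bsub>G\<^esub> g)),
      monoid.one = (\<lambda>g\<in>carrier G. if g = \<one>\<^bsub>G\<^esub> then \<one>\<^bsub>R\<^esub> else \<zero>\<^bsub>R\<^esub>),
      ring.zero = (\<lambda>g\<in>carrier G. \<zero>\<^bsub>R\<^esub>),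
      ring.add = (\<lambda>a b. \<lambda>g\<in>carrier G. a g \<oplus>\<^bsub>R\<^esub> b g)\<rparr>"

definition group_ring_map ::
    "('g, 'k) monoid_scheme \<Rightarrow> ('r \<Rightarrow> 's) \<Rightarrow> ('g \<Rightarrow> 'r) \<Rightarrow> ('g \<Rightarrow> 's)" where
  "group_ring_map G f a = (\<lambda>g\<in>carrier G. f (a g))"


section \<open>The functor \<open>K\<^sub>1\<close>\<close>

text \<open>The union of the monoids of \<open>n \<times> n\<close> matrices along \<open>M \<mapsto> diag(M, 1)\<close>, as infinite
  matrices that agree with the identity matrix outside a finite block; its unit group is
  \<open>GL(A)\<close>. Sums run over the support of the summand because \<^const>\<open>finsum\<close>
  is meaningless over an infinite index set.\<close>

definition stable_mat :: "('a, 'm) ring_scheme \<Rightarrow> (nat \<Rightarrow> nat \<Rightarrow> 'a) monoid" where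
  "stable_mat A =
     \<lparr>carrier = {M. (\<forall>i j. M i j \<in> carrier A) \<and>
                    (\<exists>n. \<forall>i j. n \<le> i \<or> n \<le> j \<longrightarrow> M i j = (if i = j then \<one>\<^bsub>A\<^esub> else \<zero>\<^bsub>A\<^esub>))},
      monoid.mult = (\<lambda>M N i k. \<Oplus>\<^bsub>A\<^esub>j\<in>{j. M i j \<otimes>\<^bsub>A\<^esub> N j k \<noteq> \<zero>\<^bsub>A\<^esub>}. M i j \<otimes>\<^bsub>A\<^esub> N j k),
      monoid.one = (\<lambda>i j. if i = j then \<one>\<^bsub>A\<^esub> else \<zero>\<^bsub>A\<^esub>)\<rparr>"

definition GL :: "('a, 'm) ring_scheme \<Rightarrow> (nat \<Rightarrow> nat \<Rightarrow> 'a) monoid" where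
  "GL A = units_of (stable_mat A)"

definition K1 :: "('a, 'm) ring_scheme \<Rightarrow> (nat \<Rightarrow> nat \<Rightarrow> 'a) set monoid" where
  "K1 A = GL A Mod derived (GL A) (carrier (GL A))"

text \<open>The map on \<open>K\<^sub>1\<close> induced by a ring homomorphism \<open>h : A \<rightarrow> B\<close>; the source \<open>A\<close> is not an
  argument, since the map is applied to cosets of matrices over \<open>A\<close>.\<close>

definition K1_map ::
    "('b, 'm) ring_scheme \<Rightarrow> ('a \<Rightarrow> 'b) \<Rightarrow> (nat \<Rightarrow> nat \<Rightarrow> 'a) set \<Rightarrow> (nat \<Rightarrow> nat \<Rightarrow> 'b) set" where
  "K1_map B h C =
     the_elem ((\<lambda>M. derived (GL B) (carrier (GL B)) #>\<^bsub>GL B\<^esub> (\<lambda>i j. h (M i j))) ` C)"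


section \<open>\<open>SK\<^sub>1\<close> of a group ring and its image modulo \<open>p^n\<close>\<close>

text \<open>Here \<open>L\<close> is an algebraic closure of the field of fractions of \<open>R\<close>, with embedding
  \<open>\<epsilon> : R \<rightarrow> L\<close>. The target of \<open>Det\<close> is kept as \<open>K\<^sub>1(L[G])\<close>, without the identification of this
  group with a direct sum of copies of \<open>L\<^sup>\<times>\<close>, which does not affect the kernel.\<close>

definition Det ::
    "('g, 'k) monoid_scheme \<Rightarrow> ('l, 'n) ring_scheme \<Rightarrow> ('r \<Rightarrow> 'l) \<Rightarrow>
     (nat \<Rightarrow> nat \<Rightarrow> 'g \<Rightarrow> 'r) set \<Rightarrow> (nat \<Rightarrow> nat \<Rightarrow> 'g \<Rightarrow> 'l) set" where
  "Det G L \<epsilon> = K1_map (group_ring L G) (group_ring_map G \<epsilon>)"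

definition SK1 ::
    "('r, 'm) ring_scheme \<Rightarrow> ('g, 'k) monoid_scheme \<Rightarrow> ('l, 'n) ring_scheme \<Rightarrow> ('r \<Rightarrow> 'l) \<Rightarrow>
     (nat \<Rightarrow> nat \<Rightarrow> 'g \<Rightarrow> 'r) set set" where
  "SK1 R G L \<epsilon> = kernel (K1 (group_ring R G)) (K1 (group_ring L G)) (Det G L \<epsilon>)"

definition residue_ring_pow :: "('r, 'm) ring_scheme \<Rightarrow> nat \<Rightarrow> nat \<Rightarrow> 'r set ring" where
  "residue_ring_pow R p n = R Quot pow_ideal R p n"

definition K1_reduction ::
    "('r, 'm) ring_scheme \<Rightarrow> ('g, 'k) monoid_scheme \<Rightarrow> nat \<Rightarrow> nat \<Rightarrow>
     (nat \<Rightarrow> nat \<Rightarrow> 'g \<Rightarrow> 'r) set \<Rightarrow> (nat \<Rightarrow> nat \<Rightarrow> 'g \<Rightarrow> 'r set) set" where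
  "K1_reduction R G p n =
     K1_map (group_ring (residue_ring_pow R p n) G)
       (group_ring_map G (\<lambda>x. pow_ideal R p n +>\<^bsub>R\<^esub> x))"

definition SK1_mod ::
    "('r, 'm) ring_scheme \<Rightarrow> ('g, 'k) monoid_scheme \<Rightarrow> ('l, 'n) ring_scheme \<Rightarrow> ('r \<Rightarrow> 'l) \<Rightarrow>
     nat \<Rightarrow> nat \<Rightarrow> (nat \<Rightarrow> nat \<Rightarrow> 'g \<Rightarrow> 'r set) set set" where
  "SK1_mod R G L \<epsilon> p n = K1_reduction R G p n ` SK1 R G L \<epsilon>"

end

theory Submission
  imports Defs
begin

text \<open>Let \<open>x\<close> be in the kernel. As \<open>p\<close> lies in the Jacobson radical of every matrix ring over
  \<open>R[G]\<close>, the map \<open>GL(R[G]) \<rightarrow> GL(R\<^sub>n[G])\<close> is onto, hence so is the map of commutator subgroups, and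
  \<open>x\<close> is represented by some \<open>u = 1 + p\<^sup>n b\<close> in a finite block. By successive approximation \<open>u\<close> is a
  finite product of commutators \<open>[v\<^sub>k, e\<^sub>k]\<close>, where the \<open>e\<^sub>k\<close> are the fixed elementary matrices
  \<open>1 + g E\<^bsub>ij\<^esub>\<close> and \<open>v\<^sub>k \<equiv> 1\<close> modulo \<open>p\<close>: the approximation proceeds from \<open>p\<^sup>N\<close> to \<open>p\<^bsup>N+1\<^esup>\<close> as
  soon as every \<open>1 + p\<^sup>N c\<close> that occurs has \<open>c\<close> in the span of additive commutators modulo \<open>p\<close>, that is,
  as soon as the trace of \<open>c\<close> has all its sums over conjugacy classes divisible by \<open>p\<close>.

  This divisibility comes from determinants. For a cyclic subgroup \<open>C\<close>, restriction of scalars makes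
  \<open>1 + p\<^sup>N c\<close> a matrix over the commutative ring \<open>R[C]\<close>, whose determinant is 1 because it is so after
  the injective extension to \<open>L[C]\<close>. If \<open>p\<^sup>N > 2\<close>, the \<open>p\<^sup>M\<close>-th power of \<open>1 + p\<^sup>N c\<close> has the form
  \<open>1 + p\<^bsup>N+M\<^esup> c'\<close> with \<open>c' \<equiv> c\<close> modulo \<open>p\<close>, and comparing first-order terms in
  \<open>det (1 + p\<^bsup>N+M\<^esup> c') = 1\<close> shows that the trace of \<open>c'\<close> over \<open>R[C]\<close> is divisible by \<open>p\<^bsup>N+M\<^esup>\<close>. Its
  coefficient at a generator \<open>g\<close> of \<open>C\<close> is the sum over the class of \<open>g\<close>, up to the factor
  \<open>[C\<^sub>G(g) : C]\<close>, whose \<open>p\<close>-part is harmless for large \<open>M\<close>.\<close>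

text \<open>A convergent infinite product of commutators need not lie in the commutator subgroup.
  Hence the number of factors and the entries \<open>e k\<close> are frozen, and only the entries
  \<open>v k\<close> are corrected from one precision to the next; they converge one by one, and the
  limit is a product of the same finite number of commutators. This forces the search for one finite
  family of units whose additive commutators fill the kernel of the trace modulo p. The quotient of
  u by its current approximation must satisfy the determinant condition again. It does, because the
  approximations are products of commutators and determinants over commutative rings kill these.
  Testing on commutative subgroups C instead of on characters of G keeps everything integral: det (1
  + p^N B) is expanded over R[C] itself, without logarithms or denominators. The price is a factor
  |C_G(g)| in the trace, which the p-th powers pay for. The bound on p^n excludes p^N = 2, where (1
  + 2b)^2 = 1 + 4(b + b^2) and b + b^2 need not be congruent to b modulo 2. Surjectivity is part of
  the definition of the target as an image, so only injectivity has content.\<close>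

lemma (in abelian_monoid) finsum_swap:
  assumes "finite A" "finite B" "\<And>a b. a \<in> A \<Longrightarrow> b \<in> B \<Longrightarrow> f a b \<in> carrier G"
  shows "(\<Oplus>a\<in>A. \<Oplus>b\<in>B. f a b) = (\<Oplus>b\<in>B. \<Oplus>a\<in>A. f a b)"
  using assms(1,3)
proof (induction A)
  case empty
  then show ?case by (simp add: finsum_zero)
next
  case (insert x A)
  then have "(\<Oplus>a\<in>insert x A. \<Oplus>b\<in>B. f a b) = (\<Oplus>b\<in>B. f x b) \<oplus> (\<Oplus>b\<in>B. \<Oplus>a\<in>A. f a b)"
    by (subst finsum_insert) (auto simp: Pi_def intro!: finsum_closed)
  also have "\<dots> = (\<Oplus>b\<in>B. f x b \<oplus> (\<Oplus>a\<in>A. f a b))"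
    using insert.prems by (subst finsum_addf) (auto simp: Pi_def intro!: finsum_closed)
  also have "\<dots> = (\<Oplus>b\<in>B. \<Oplus>a\<in>insert x A. f a b)"
    using insert by (intro finsum_cong') (auto simp: Pi_def intro!: finsum_closed)
  finally show ?case .
qed

lemma (in abelian_monoid) finsum_cartesian:
  assumes "finite A" "finite B" "\<And>a b. a \<in> A \<Longrightarrow> b \<in> B \<Longrightarrow> f a b \<in> carrier G"
  shows "(\<Oplus>a\<in>A. \<Oplus>b\<in>B. f a b) = finsum G (\<lambda>(a, b). f a b) (A \<times> B)"
  using assms(1,3)
proof (induction A)
  case empty
  then show ?case by simp
next
  case (insert x A)
  have eq: "insert x A \<times> B = Pair x ` B \<union> A \<times> B" by auto
  have "finsum G (\<lambda>(a, b). f a b) (insert x A \<times> B) = finsum G (\<lambda>(a, b). f a b) (Pair x ` B) \<oplus> finsum G (\<lambda>(a, b). f a b) (A \<times> B)"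
    unfolding eq using insert assms(2) by (subst finsum_Un_disjoint) (auto simp: Pi_def)
  also have "finsum G (\<lambda>(a, b). f a b) (Pair x ` B) = (\<Oplus>b\<in>B. f x b)"
    using insert by (subst finsum_reindex) (auto simp: Pi_def inj_on_def)
  finally show ?case
    using insert by (subst finsum_insert) (auto simp: Pi_def intro!: finsum_closed)
qed

lemma (in abelian_monoid) finsum_delta:
  assumes "finite A" "\<And>a. a \<in> A \<Longrightarrow> f a \<in> carrier G"
  shows "(\<Oplus>a\<in>A. if a = k then f a else \<zero>) = (if k \<in> A then f k else \<zero>)"
proof (cases "k \<in> A")
  case True
  then have "(\<Oplus>a\<in>A. if a = k then f a else \<zero>) = (\<Oplus>a\<in>A. if k = a then f a else \<zero>)"
    using assms by (intro finsum_cong') auto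
  also have "\<dots> = f k"
    using True assms by (intro finsum_singleton) auto
  finally show ?thesis using True by simp
next
  case False
  then have "(\<Oplus>a\<in>A. if a = k then f a else \<zero>) = (\<Oplus>a\<in>A. \<zero>)"
    using assms by (intro finsum_cong') auto
  then show ?thesis using False by (simp add: finsum_zero)
qed

lemma (in abelian_monoid) finsum_bij:
  assumes "bij_betw \<phi> A B" "\<And>b. b \<in> B \<Longrightarrow> f b \<in> carrier G"
  shows "(\<Oplus>b\<in>B. f b) = (\<Oplus>a\<in>A. f (\<phi> a))"
proof -
  have "B = \<phi> ` A" "inj_on \<phi> A" using assms(1) by (auto simp: bij_betw_def)
  then show ?thesis using assms(2) by (simp add: finsum_reindex Pi_def)
qed

lemma (in abelian_monoid) finsum_add_pow:
  fixes k :: nat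
  assumes "finite A" "\<And>a. a \<in> A \<Longrightarrow> f a \<in> carrier G"
  shows "(\<Oplus>a\<in>A. [k] \<cdot> f a) = [k] \<cdot> (\<Oplus>a\<in>A. f a)"
  using assms by (induction rule: finite_induct) (auto simp: Pi_def add.nat_pow_distrib)

text \<open>Intended for the conjugation map y -> y g y^-1 on G, all of whose fibres have |C_G(g)|
  elements. Writing each summand as a sum over the image with an indicator and swapping the two sums
  gives the claim.\<close>

lemma (in abelian_monoid) finsum_fibres:
  assumes "finite A" "\<And>x. x \<in> \<phi> ` A \<Longrightarrow> f x \<in> carrier G"
    and "\<And>x. x \<in> \<phi> ` A \<Longrightarrow> card {a \<in> A. \<phi> a = x} = h"
  shows "(\<Oplus>a\<in>A. f (\<phi> a)) = [h] \<cdot> (\<Oplus>x\<in>\<phi> ` A. f x)"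
proof -
  have "(\<Oplus>a\<in>A. f (\<phi> a)) = (\<Oplus>a\<in>A. \<Oplus>x\<in>\<phi> ` A. if x = \<phi> a then f x else \<zero>)"
    using assms by (intro finsum_cong') (auto simp: finsum_delta intro!: finsum_closed)
  also have "\<dots> = (\<Oplus>x\<in>\<phi> ` A. \<Oplus>a\<in>A. if x = \<phi> a then f x else \<zero>)"
    using assms by (intro finsum_swap) auto
  also have "\<dots> = (\<Oplus>x\<in>\<phi> ` A. [h] \<cdot> f x)"
  proof (rule finsum_cong', rule refl)
    fix x assume x: "x \<in> \<phi> ` A"
    then have fx: "f x \<in> carrier G" using assms(2) by blast
    have "(\<Oplus>a\<in>A. if x = \<phi> a then f x else \<zero>) = (\<Oplus>a\<in>{a\<in>A. \<phi> a = x}. f x)"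
      using assms(1) fx by (intro add.finprod_mono_neutral_cong_right) auto
    also have "\<dots> = [h] \<cdot> f x"
      by (simp only: add.finprod_const[OF fx] assms(3)[OF x])
    finally show "(\<Oplus>a\<in>A. if x = \<phi> a then f x else \<zero>) = [h] \<cdot> f x" .
  qed (use assms(2) in auto)
  also have "\<dots> = [h] \<cdot> (\<Oplus>x\<in>\<phi> ` A. f x)"
    using assms by (intro finsum_add_pow) auto
  finally show ?thesis .
qed

lemma (in abelian_group) finsum_minus:
  assumes "finite A" "f \<in> A \<rightarrow> carrier G" "g \<in> A \<rightarrow> carrier G"
  shows "(\<Oplus>a\<in>A. f a \<ominus> g a) = finsum G f A \<ominus> finsum G g A"
proof -
  have "(\<Oplus>a\<in>A. f a) = (\<Oplus>a\<in>A. (f a \<ominus> g a) \<oplus> g a)"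
    using assms by (intro finsum_cong') (auto simp: Pi_def minus_eq a_assoc l_neg)
  also have "\<dots> = (\<Oplus>a\<in>A. f a \<ominus> g a) \<oplus> finsum G g A"
    using assms by (subst finsum_addf) (auto simp: Pi_def)
  finally have eq: "finsum G f A = (\<Oplus>a\<in>A. f a \<ominus> g a) \<oplus> finsum G g A" .
  have "(\<Oplus>a\<in>A. f a \<ominus> g a) \<in> carrier G" "finsum G g A \<in> carrier G"
    using assms by (auto intro!: finsum_closed simp: Pi_def)
  then show ?thesis by (simp add: eq minus_eq a_assoc r_neg)
qed

section \<open>The group ring\<close>

text \<open>The substitution h -> h^-1 g exchanges the two arguments in the convolution sum at g,
  hence the commutativity of the group ring of a commutative group.\<close>

lemma (in group) bij_mult_inv_left:
  assumes g: "g \<in> carrier G"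
  shows "bij_betw (\<lambda>h. inv h \<otimes> g) (carrier G) (carrier G)"
proof (rule bij_betwI)
  show "(\<lambda>h. g \<otimes> inv h) \<in> carrier G \<rightarrow> carrier G" using g by auto
  show "g \<otimes> inv (inv h \<otimes> g) = h" if "h \<in> carrier G" for h
    using g that by (simp add: inv_mult_group m_assoc[symmetric])
  show "inv (g \<otimes> inv h) \<otimes> g = h" if "h \<in> carrier G" for h
    using g that by (simp add: inv_mult_group m_assoc)
qed (use g in auto)

lemma (in group) bij_lmult:
  assumes "a \<in> carrier G"
  shows "bij_betw (\<lambda>h. a \<otimes> h) (carrier G) (carrier G)"
proof (rule bij_betwI)
  show "(\<lambda>h. inv a \<otimes> h) \<in> carrier G \<rightarrow> carrier G" using assms by auto
qed (use assms in \<open>auto simp: m_assoc[symmetric]\<close>)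

locale finite_group_ring = ring R + G: group G
  for R :: "('r, 'm) ring_scheme" (structure) and G :: "('g, 'k) monoid_scheme" (structure) +
  assumes fin [simp, intro]: "finite (carrier G)"
begin

abbreviation "RG \<equiv> group_ring R G"

lemma group_ring_simps:
  "carrier (group_ring R G) = carrier G \<rightarrow>\<^sub>E carrier R"
  "a \<otimes>\<^bsub>group_ring R G\<^esub> b = (\<lambda>g\<in>carrier G. \<Oplus>h\<in>carrier G. a h \<otimes> b (inv\<^bsub>G\<^esub> h \<otimes>\<^bsub>G\<^esub> g))"
  "\<one>\<^bsub>group_ring R G\<^esub> = (\<lambda>g\<in>carrier G. if g = \<one>\<^bsub>G\<^esub> then \<one> else \<zero>)"
  "\<zero>\<^bsub>group_ring R G\<^esub> = (\<lambda>g\<in>carrier G. \<zero>)"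
  "a \<oplus>\<^bsub>group_ring R G\<^esub> b = (\<lambda>g\<in>carrier G. a g \<oplus> b g)"
  by (simp_all add: group_ring_def)

text \<open>The substitution h -> k h in the sum over h moves the inverse of k from the argument of
  b to that of c.\<close>

lemma group_ring_assoc:
  assumes "a \<in> carrier G \<rightarrow> carrier R" "b \<in> carrier G \<rightarrow> carrier R" "c \<in> carrier G \<rightarrow> carrier R"
    and g: "g \<in> carrier G"
  shows "(\<Oplus>h\<in>carrier G. (\<Oplus>k\<in>carrier G. a k \<otimes> b (inv\<^bsub>G\<^esub> k \<otimes>\<^bsub>G\<^esub> h)) \<otimes> c (inv\<^bsub>G\<^esub> h \<otimes>\<^bsub>G\<^esub> g))
       = (\<Oplus>k\<in>carrier G. a k \<otimes> (\<Oplus>h\<in>carrier G. b h \<otimes> c (inv\<^bsub>G\<^esub> h \<otimes>\<^bsub>G\<^esub> (inv\<^bsub>G\<^esub> k \<otimes>\<^bsub>G\<^esub> g))))"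
    (is "?l = ?r")
proof -
  have cl: "\<And>x. x \<in> carrier G \<Longrightarrow> a x \<in> carrier R" "\<And>x. x \<in> carrier G \<Longrightarrow> b x \<in> carrier R"
    "\<And>x. x \<in> carrier G \<Longrightarrow> c x \<in> carrier R" using assms by auto
  have "?l = (\<Oplus>h\<in>carrier G. \<Oplus>k\<in>carrier G. a k \<otimes> (b (inv\<^bsub>G\<^esub> k \<otimes>\<^bsub>G\<^esub> h) \<otimes> c (inv\<^bsub>G\<^esub> h \<otimes>\<^bsub>G\<^esub> g)))"
    using g cl by (intro finsum_cong') (auto simp: finsum_ldistr m_assoc Pi_def intro!: finsum_closed finsum_cong')
  also have "\<dots> = (\<Oplus>k\<in>carrier G. \<Oplus>h\<in>carrier G. a k \<otimes> (b (inv\<^bsub>G\<^esub> k \<otimes>\<^bsub>G\<^esub> h) \<otimes> c (inv\<^bsub>G\<^esub> h \<otimes>\<^bsub>G\<^esub> g)))"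
    using g cl by (intro finsum_swap) auto
  also have "\<dots> = (\<Oplus>k\<in>carrier G. \<Oplus>h\<in>carrier G. a k \<otimes> (b h \<otimes> c (inv\<^bsub>G\<^esub> h \<otimes>\<^bsub>G\<^esub> (inv\<^bsub>G\<^esub> k \<otimes>\<^bsub>G\<^esub> g))))"
  proof (rule finsum_cong', rule refl)
    fix k assume k: "k \<in> carrier G"
    show "(\<Oplus>h\<in>carrier G. a k \<otimes> (b (inv\<^bsub>G\<^esub> k \<otimes>\<^bsub>G\<^esub> h) \<otimes> c (inv\<^bsub>G\<^esub> h \<otimes>\<^bsub>G\<^esub> g)))
      = (\<Oplus>h\<in>carrier G. a k \<otimes> (b h \<otimes> c (inv\<^bsub>G\<^esub> h \<otimes>\<^bsub>G\<^esub> (inv\<^bsub>G\<^esub> k \<otimes>\<^bsub>G\<^esub> g))))"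
      using g k cl
      by (subst finsum_bij[OF G.bij_lmult[OF k]])
         (auto simp: G.inv_mult_group G.m_assoc[symmetric] intro!: finsum_cong')
  qed (use g cl in \<open>auto intro!: finsum_closed\<close>)
  also have "\<dots> = ?r"
    using g cl by (intro finsum_cong') (auto simp: finsum_rdistr Pi_def intro!: finsum_closed)
  finally show ?thesis .
qed

lemma group_ring_ring: "ring (group_ring R G)"
proof (rule ringI)
  show "abelian_group (group_ring R G)"
  proof (rule abelian_groupI)
    fix x assume x: "x \<in> carrier (group_ring R G)"
    then show "\<exists>y\<in>carrier (group_ring R G). y \<oplus>\<^bsub>group_ring R G\<^esub> x = \<zero>\<^bsub>group_ring R G\<^esub>"
      by (intro bexI[of _ "\<lambda>g\<in>carrier G. \<ominus> x g"]) (auto simp: group_ring_simps l_neg fun_eq_iff PiE_iff)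
  qed (auto simp: group_ring_simps fun_eq_iff PiE_iff extensional_def a_ac)
  show "Group.monoid (group_ring R G)"
  proof (rule monoidI)
    fix x y assume "x \<in> carrier (group_ring R G)" "y \<in> carrier (group_ring R G)"
    then show "x \<otimes>\<^bsub>group_ring R G\<^esub> y \<in> carrier (group_ring R G)"
      by (auto simp: group_ring_simps PiE_iff intro!: finsum_closed)
  next
    fix x y z assume "x \<in> carrier (group_ring R G)" "y \<in> carrier (group_ring R G)" "z \<in> carrier (group_ring R G)"
    then show "x \<otimes>\<^bsub>group_ring R G\<^esub> y \<otimes>\<^bsub>group_ring R G\<^esub> z = x \<otimes>\<^bsub>group_ring R G\<^esub> (y \<otimes>\<^bsub>group_ring R G\<^esub> z)"
      using group_ring_assoc[of x y z] by (auto simp: group_ring_simps fun_eq_iff PiE_iff cong: finsum_cong)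
  next
    fix x assume x: "x \<in> carrier (group_ring R G)"
    have "(\<Oplus>h\<in>carrier G. (if h = \<one>\<^bsub>G\<^esub> then \<one> else \<zero>) \<otimes> x (inv\<^bsub>G\<^esub> h \<otimes>\<^bsub>G\<^esub> g)) = x g" if g: "g \<in> carrier G" for g
    proof -
      have "(\<Oplus>h\<in>carrier G. (if h = \<one>\<^bsub>G\<^esub> then \<one> else \<zero>) \<otimes> x (inv\<^bsub>G\<^esub> h \<otimes>\<^bsub>G\<^esub> g))
         = (\<Oplus>h\<in>carrier G. (if h = \<one>\<^bsub>G\<^esub> then x (inv\<^bsub>G\<^esub> h \<otimes>\<^bsub>G\<^esub> g) else \<zero>))"
        using x g by (intro finsum_cong') (auto simp: group_ring_simps PiE_iff)
      also have "\<dots> = x g" using x g by (subst finsum_delta) (auto simp: group_ring_simps PiE_iff)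
      finally show ?thesis .
    qed
    then show "\<one>\<^bsub>group_ring R G\<^esub> \<otimes>\<^bsub>group_ring R G\<^esub> x = x"
      using x by (auto simp: group_ring_simps fun_eq_iff PiE_iff extensional_def cong: finsum_cong)
    have "(\<Oplus>h\<in>carrier G. x h \<otimes> (if inv\<^bsub>G\<^esub> h \<otimes>\<^bsub>G\<^esub> g = \<one>\<^bsub>G\<^esub> then \<one> else \<zero>)) = x g" if g: "g \<in> carrier G" for g
    proof -
      have "(\<Oplus>h\<in>carrier G. x h \<otimes> (if inv\<^bsub>G\<^esub> h \<otimes>\<^bsub>G\<^esub> g = \<one>\<^bsub>G\<^esub> then \<one> else \<zero>))
         = (\<Oplus>h\<in>carrier G. (if h = g then x h else \<zero>))"
      proof (rule finsum_cong', rule refl)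
        fix h assume h: "h \<in> carrier G"
        have "inv\<^bsub>G\<^esub> h \<otimes>\<^bsub>G\<^esub> g = \<one>\<^bsub>G\<^esub> \<longleftrightarrow> h = g"
          using g h by (metis G.inv_closed G.inv_equality G.inv_inv G.l_inv)
        with x g h show "x h \<otimes> (if inv\<^bsub>G\<^esub> h \<otimes>\<^bsub>G\<^esub> g = \<one>\<^bsub>G\<^esub> then \<one> else \<zero>) = (if h = g then x h else \<zero>)"
          by (auto simp: group_ring_simps PiE_iff)
      qed (use x in \<open>auto simp: group_ring_simps PiE_iff\<close>)
      also have "\<dots> = x g" using x g by (subst finsum_delta) (auto simp: group_ring_simps PiE_iff)
      finally show ?thesis .
    qed
    then show "x \<otimes>\<^bsub>group_ring R G\<^esub> \<one>\<^bsub>group_ring R G\<^esub> = x"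
      using x by (auto simp: group_ring_simps fun_eq_iff PiE_iff extensional_def cong: finsum_cong)
  qed (auto simp: group_ring_simps)
next
  fix x y z assume xyz: "x \<in> carrier (group_ring R G)" "y \<in> carrier (group_ring R G)" "z \<in> carrier (group_ring R G)"
  then have cl: "\<And>g. g \<in> carrier G \<Longrightarrow> x g \<in> carrier R" "\<And>g. g \<in> carrier G \<Longrightarrow> y g \<in> carrier R"
     "\<And>g. g \<in> carrier G \<Longrightarrow> z g \<in> carrier R"
    by (auto simp: group_ring_simps PiE_iff)
  have "(\<Oplus>h\<in>carrier G. (x \<oplus>\<^bsub>group_ring R G\<^esub> y) h \<otimes> z (inv\<^bsub>G\<^esub> h \<otimes>\<^bsub>G\<^esub> g))
      = (\<Oplus>h\<in>carrier G. x h \<otimes> z (inv\<^bsub>G\<^esub> h \<otimes>\<^bsub>G\<^esub> g)) \<oplus> (\<Oplus>h\<in>carrier G. y h \<otimes> z (inv\<^bsub>G\<^esub> h \<otimes>\<^bsub>G\<^esub> g))"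
    if g: "g \<in> carrier G" for g
  proof -
    have "(\<Oplus>h\<in>carrier G. (x \<oplus>\<^bsub>group_ring R G\<^esub> y) h \<otimes> z (inv\<^bsub>G\<^esub> h \<otimes>\<^bsub>G\<^esub> g))
      = (\<Oplus>h\<in>carrier G. x h \<otimes> z (inv\<^bsub>G\<^esub> h \<otimes>\<^bsub>G\<^esub> g) \<oplus> y h \<otimes> z (inv\<^bsub>G\<^esub> h \<otimes>\<^bsub>G\<^esub> g))"
      using cl g by (intro finsum_cong') (auto simp: group_ring_simps l_distr)
    also have "\<dots> = (\<Oplus>h\<in>carrier G. x h \<otimes> z (inv\<^bsub>G\<^esub> h \<otimes>\<^bsub>G\<^esub> g)) \<oplus> (\<Oplus>h\<in>carrier G. y h \<otimes> z (inv\<^bsub>G\<^esub> h \<otimes>\<^bsub>G\<^esub> g))"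
      using cl g by (intro finsum_addf) auto
    finally show ?thesis .
  qed
  then show "(x \<oplus>\<^bsub>group_ring R G\<^esub> y) \<otimes>\<^bsub>group_ring R G\<^esub> z = x \<otimes>\<^bsub>group_ring R G\<^esub> z \<oplus>\<^bsub>group_ring R G\<^esub> y \<otimes>\<^bsub>group_ring R G\<^esub> z"
    unfolding group_ring_simps(2) group_ring_simps(5)[of "restrict _ _"] by (auto simp: fun_eq_iff)
  have "(\<Oplus>h\<in>carrier G. z h \<otimes> (x \<oplus>\<^bsub>group_ring R G\<^esub> y) (inv\<^bsub>G\<^esub> h \<otimes>\<^bsub>G\<^esub> g))
      = (\<Oplus>h\<in>carrier G. z h \<otimes> x (inv\<^bsub>G\<^esub> h \<otimes>\<^bsub>G\<^esub> g)) \<oplus> (\<Oplus>h\<in>carrier G. z h \<otimes> y (inv\<^bsub>G\<^esub> h \<otimes>\<^bsub>G\<^esub> g))"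
    if g: "g \<in> carrier G" for g
  proof -
    have "(\<Oplus>h\<in>carrier G. z h \<otimes> (x \<oplus>\<^bsub>group_ring R G\<^esub> y) (inv\<^bsub>G\<^esub> h \<otimes>\<^bsub>G\<^esub> g))
      = (\<Oplus>h\<in>carrier G. z h \<otimes> x (inv\<^bsub>G\<^esub> h \<otimes>\<^bsub>G\<^esub> g) \<oplus> z h \<otimes> y (inv\<^bsub>G\<^esub> h \<otimes>\<^bsub>G\<^esub> g))"
      using cl g by (intro finsum_cong') (auto simp: group_ring_simps r_distr)
    also have "\<dots> = (\<Oplus>h\<in>carrier G. z h \<otimes> x (inv\<^bsub>G\<^esub> h \<otimes>\<^bsub>G\<^esub> g)) \<oplus> (\<Oplus>h\<in>carrier G. z h \<otimes> y (inv\<^bsub>G\<^esub> h \<otimes>\<^bsub>G\<^esub> g))"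
      using cl g by (intro finsum_addf) auto
    finally show ?thesis .
  qed
  then show "z \<otimes>\<^bsub>group_ring R G\<^esub> (x \<oplus>\<^bsub>group_ring R G\<^esub> y) = z \<otimes>\<^bsub>group_ring R G\<^esub> x \<oplus>\<^bsub>group_ring R G\<^esub> z \<otimes>\<^bsub>group_ring R G\<^esub> y"
    unfolding group_ring_simps(2) group_ring_simps(5)[of "restrict _ _"] by (auto simp: fun_eq_iff)
qed

end

lemma (in finite_group_ring) finsum_group_ring:
  assumes "finite A" "f \<in> A \<rightarrow> carrier (group_ring R G)" "g \<in> carrier G"
  shows "finsum (group_ring R G) f A g = (\<Oplus>a\<in>A. f a g)"
proof -
  interpret A: ring "group_ring R G" by (rule group_ring_ring)
  show ?thesis using assms(1,2)
  proof (induction A)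
    case empty
    then show ?case using assms(3) by (simp add: group_ring_simps)
  next
    case (insert x F)
    then have "f a g \<in> carrier R" if "a \<in> insert x F" for a
      using that assms(3) by (auto simp: group_ring_simps PiE_iff Pi_def)
    with insert show ?case using assms(3) by (simp add: group_ring_simps(5) Pi_def)
  qed
qed

lemma (in finite_group_ring) add_pow_group_ring:
  fixes k :: nat
  assumes "f \<in> carrier (group_ring R G)" "g \<in> carrier G"
  shows "add_pow (group_ring R G) k f g = [k] \<cdot> f g"
proof -
  interpret A: ring "group_ring R G" by (rule group_ring_ring)
  have "f g \<in> carrier R" using assms by (auto simp: group_ring_simps PiE_iff)
  then show ?thesis using assms
    by (induction k) (auto simp: group_ring_simps(4,5) A.add.nat_pow_Suc)
qed

lemma group_ring_cring:
  fixes R :: "('r, 'm) ring_scheme" and G :: "('g, 'k) monoid_scheme"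
  assumes "cring R" "comm_group G" "finite (carrier G)"
  shows "cring (group_ring R G)"
proof -
  interpret R: cring R by fact
  interpret G: comm_group G by fact
  interpret finite_group_ring R G by unfold_locales fact
  interpret A: ring "group_ring R G" by (rule group_ring_ring)
  show ?thesis
  proof (intro cring.intro comm_monoid.intro comm_monoid_axioms.intro)
    fix x y assume xy: "x \<in> carrier (group_ring R G)" "y \<in> carrier (group_ring R G)"
    have "(\<Oplus>\<^bsub>R\<^esub>h\<in>carrier G. x h \<otimes>\<^bsub>R\<^esub> y (inv\<^bsub>G\<^esub> h \<otimes>\<^bsub>G\<^esub> g)) = (\<Oplus>\<^bsub>R\<^esub>h\<in>carrier G. y h \<otimes>\<^bsub>R\<^esub> x (inv\<^bsub>G\<^esub> h \<otimes>\<^bsub>G\<^esub> g))"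
      if g: "g \<in> carrier G" for g
    proof -
      have e: "inv\<^bsub>G\<^esub> (inv\<^bsub>G\<^esub> h \<otimes>\<^bsub>G\<^esub> g) \<otimes>\<^bsub>G\<^esub> g = h" if h: "h \<in> carrier G" for h
        using g h by (simp add: G.inv_mult_group G.m_assoc G.m_comm[of h g] G.m_assoc[symmetric])
      show ?thesis
        using xy g
        by (subst R.finsum_bij[OF G.bij_mult_inv_left[OF g]])
           (auto simp: group_ring_simps PiE_iff R.m_comm e intro!: R.finsum_cong')
    qed
    then show "x \<otimes>\<^bsub>group_ring R G\<^esub> y = y \<otimes>\<^bsub>group_ring R G\<^esub> x"
      by (auto simp: group_ring_simps fun_eq_iff)
  qed (unfold_locales)
qed

lemma (in ring_hom_ring) hom_finsum_ring:
  assumes "finite A" "f \<in> A \<rightarrow> carrier R"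
  shows "h (finsum R f A) = finsum S (\<lambda>a. h (f a)) A"
  using assms by (induction rule: finite_induct) (auto simp: Pi_def)

lemma group_ring_map_hom:
  fixes G :: "('g, 'k) monoid_scheme"
  assumes "ring_hom_ring R S h" "group G" "finite (carrier G)"
  shows "group_ring_map G h \<in> ring_hom (group_ring R G) (group_ring S G)"
proof -
  interpret h: ring_hom_ring R S h by fact
  interpret A: finite_group_ring R G
    by (intro finite_group_ring.intro finite_group_ring_axioms.intro assms h.R.ring_axioms)
  interpret B: finite_group_ring S G
    by (intro finite_group_ring.intro finite_group_ring_axioms.intro assms h.S.ring_axioms)
  show ?thesis
    by (rule ring_hom_memI)
       (auto simp: group_ring_map_def A.group_ring_simps B.group_ring_simps fun_eq_iff PiE_iff
         h.hom_finsum_ring Pi_def intro!: h.S.finsum_cong' h.R.finsum_closed)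
qed

section \<open>Matrix rings and the stable general linear group\<close>

text \<open>Padding by zeros is stable under addition, unlike the padding by the identity in
  \<open>stable_mat\<close>. All sizes m share one type with the stable matrices, so a block can be
  enlarged without conversions.\<close>

definition mat_ring :: "('a, 'm) ring_scheme \<Rightarrow> nat \<Rightarrow> (nat \<Rightarrow> nat \<Rightarrow> 'a) ring" where
  "mat_ring A m =
     \<lparr>carrier = {M. (\<forall>i j. M i j \<in> carrier A) \<and> (\<forall>i j. m \<le> i \<or> m \<le> j \<longrightarrow> M i j = \<zero>\<^bsub>A\<^esub>)},
      monoid.mult = (\<lambda>M N i k. \<Oplus>\<^bsub>A\<^esub>j\<in>{..<m}. M i j \<otimes>\<^bsub>A\<^esub> N j k),
      monoid.one = (\<lambda>i j. if i = j \<and> i < m then \<one>\<^bsub>A\<^esub> else \<zero>\<^bsub>A\<^esub>),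
      ring.zero = (\<lambda>i j. \<zero>\<^bsub>A\<^esub>),
      ring.add = (\<lambda>M N i j. M i j \<oplus>\<^bsub>A\<^esub> N i j)\<rparr>"

text \<open>\<open>stab\<close> and \<open>corner\<close> exchange the two paddings of an m by m
  block. Both are multiplicative, so questions about the stable monoid can be settled in the ring
  \<open>mat_ring A m\<close>.\<close>

definition stab :: "('a, 'm) ring_scheme \<Rightarrow> nat \<Rightarrow> (nat \<Rightarrow> nat \<Rightarrow> 'a) \<Rightarrow> nat \<Rightarrow> nat \<Rightarrow> 'a" where
  "stab A m M = (\<lambda>i j. if i < m \<and> j < m then M i j else if i = j then \<one>\<^bsub>A\<^esub> else \<zero>\<^bsub>A\<^esub>)"

definition corner :: "('a, 'm) ring_scheme \<Rightarrow> nat \<Rightarrow> (nat \<Rightarrow> nat \<Rightarrow> 'a) \<Rightarrow> nat \<Rightarrow> nat \<Rightarrow> 'a" where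
  "corner A m M = (\<lambda>i j. if i < m \<and> j < m then M i j else \<zero>\<^bsub>A\<^esub>)"

definition in_block :: "('a, 'm) ring_scheme \<Rightarrow> nat \<Rightarrow> (nat \<Rightarrow> nat \<Rightarrow> 'a) \<Rightarrow> bool" where
  "in_block A m M \<longleftrightarrow> (\<forall>i j. M i j \<in> carrier A) \<and>
     (\<forall>i j. m \<le> i \<or> m \<le> j \<longrightarrow> M i j = (if i = j then \<one>\<^bsub>A\<^esub> else \<zero>\<^bsub>A\<^esub>))"

lemma mat_ring_simps:
  "carrier (mat_ring A m) = {M. (\<forall>i j. M i j \<in> carrier A) \<and> (\<forall>i j. m \<le> i \<or> m \<le> j \<longrightarrow> M i j = \<zero>\<^bsub>A\<^esub>)}"
  "M \<otimes>\<^bsub>mat_ring A m\<^esub> N = (\<lambda>i k. \<Oplus>\<^bsub>A\<^esub>j\<in>{..<m}. M i j \<otimes>\<^bsub>A\<^esub> N j k)"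
  "\<one>\<^bsub>mat_ring A m\<^esub> = (\<lambda>i j. if i = j \<and> i < m then \<one>\<^bsub>A\<^esub> else \<zero>\<^bsub>A\<^esub>)"
  "\<zero>\<^bsub>mat_ring A m\<^esub> = (\<lambda>i j. \<zero>\<^bsub>A\<^esub>)"
  "M \<oplus>\<^bsub>mat_ring A m\<^esub> N = (\<lambda>i j. M i j \<oplus>\<^bsub>A\<^esub> N i j)"
  by (simp_all add: mat_ring_def)

lemma stable_mat_simps:
  "carrier (stable_mat A) = {M. \<exists>m. in_block A m M}"
  "(M \<otimes>\<^bsub>stable_mat A\<^esub> N) i k = (\<Oplus>\<^bsub>A\<^esub>j\<in>{j. M i j \<otimes>\<^bsub>A\<^esub> N j k \<noteq> \<zero>\<^bsub>A\<^esub>}. M i j \<otimes>\<^bsub>A\<^esub> N j k)"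
  "\<one>\<^bsub>stable_mat A\<^esub> = (\<lambda>i j. if i = j then \<one>\<^bsub>A\<^esub> else \<zero>\<^bsub>A\<^esub>)"
  by (auto simp: stable_mat_def in_block_def)

lemma in_block_mono: "in_block A m M \<Longrightarrow> m \<le> m' \<Longrightarrow> in_block A m' M"
  unfolding in_block_def by (meson le_trans)

lemma in_block_stable: "in_block A m M \<Longrightarrow> M \<in> carrier (stable_mat A)"
  by (auto simp: stable_mat_simps)

lemma stab_corner: "in_block A m M \<Longrightarrow> stab A m (corner A m M) = M"
  by (auto simp: in_block_def stab_def corner_def fun_eq_iff)

lemma corner_stab: "M \<in> carrier (mat_ring A m) \<Longrightarrow> corner A m (stab A m M) = M"
  by (auto simp: mat_ring_simps stab_def corner_def fun_eq_iff)

lemma (in ring) in_block_stab: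
  "M \<in> carrier (mat_ring R m) \<Longrightarrow> in_block R m (stab R m M)"
  by (auto simp: mat_ring_simps stab_def in_block_def)

lemma (in ring) corner_closed:
  "in_block R m M \<Longrightarrow> corner R m M \<in> carrier (mat_ring R m)"
  by (auto simp: mat_ring_simps corner_def in_block_def)

lemma (in ring) mat_ring_assoc:
  assumes M: "\<And>i j. M i j \<in> carrier R" and N: "\<And>i j. N i j \<in> carrier R" and P: "\<And>i j. P i j \<in> carrier R"
  shows "(\<Oplus>j\<in>{..<m}. (\<Oplus>k\<in>{..<m}. M i k \<otimes> N k j) \<otimes> P j l)
       = (\<Oplus>k\<in>{..<m::nat}. M i k \<otimes> (\<Oplus>j\<in>{..<m}. N k j \<otimes> P j l))" (is "?a = ?b")
proof -
  have "?a = (\<Oplus>j\<in>{..<m}. \<Oplus>k\<in>{..<m}. M i k \<otimes> (N k j \<otimes> P j l))"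
    using assms by (intro finsum_cong') (auto simp: finsum_ldistr m_assoc Pi_def)
  also have "\<dots> = (\<Oplus>k\<in>{..<m}. \<Oplus>j\<in>{..<m}. M i k \<otimes> (N k j \<otimes> P j l))"
    using assms by (intro finsum_swap) auto
  also have "\<dots> = ?b"
    using assms by (intro finsum_cong') (auto simp: finsum_rdistr Pi_def)
  finally show ?thesis .
qed

lemma (in ring) mat_ring_ring: "ring (mat_ring R m)"
proof (rule ringI)
  show "abelian_group (mat_ring R m)"
  proof (rule abelian_groupI)
    fix x assume x: "x \<in> carrier (mat_ring R m)"
    then show "\<exists>y\<in>carrier (mat_ring R m). y \<oplus>\<^bsub>mat_ring R m\<^esub> x = \<zero>\<^bsub>mat_ring R m\<^esub>"
      by (intro bexI[of _ "\<lambda>i j. \<ominus> x i j"]) (auto simp: mat_ring_simps l_neg fun_eq_iff)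
  qed (auto simp: mat_ring_simps fun_eq_iff a_ac)
  show "Group.monoid (mat_ring R m)"
  proof (rule monoidI)
    fix x y assume "x \<in> carrier (mat_ring R m)" "y \<in> carrier (mat_ring R m)"
    then show "x \<otimes>\<^bsub>mat_ring R m\<^esub> y \<in> carrier (mat_ring R m)"
      by (auto simp: mat_ring_simps intro!: finsum_closed add.finprod_one_eqI)
  next
    fix x y z assume "x \<in> carrier (mat_ring R m)" "y \<in> carrier (mat_ring R m)" "z \<in> carrier (mat_ring R m)"
    then show "x \<otimes>\<^bsub>mat_ring R m\<^esub> y \<otimes>\<^bsub>mat_ring R m\<^esub> z = x \<otimes>\<^bsub>mat_ring R m\<^esub> (y \<otimes>\<^bsub>mat_ring R m\<^esub> z)"
      using mat_ring_assoc[of x y z] by (auto simp: mat_ring_simps fun_eq_iff)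
  next
    fix x assume x: "x \<in> carrier (mat_ring R m)"
    then have xc: "\<And>i j. x i j \<in> carrier R" by (auto simp: mat_ring_simps)
    have "(\<Oplus>j\<in>{..<m}. (if i = j \<and> i < m then \<one> else \<zero>) \<otimes> x j k) = x i k" for i k
    proof -
      have "(\<Oplus>j\<in>{..<m}. (if i = j \<and> i < m then \<one> else \<zero>) \<otimes> x j k) = (\<Oplus>j\<in>{..<m}. if j = i then x j k else \<zero>)"
        using xc by (intro finsum_cong') auto
      then show ?thesis using x by (auto simp: finsum_delta mat_ring_simps)
    qed
    then show "\<one>\<^bsub>mat_ring R m\<^esub> \<otimes>\<^bsub>mat_ring R m\<^esub> x = x"
      by (auto simp: mat_ring_simps fun_eq_iff)
    have "(\<Oplus>j\<in>{..<m}. x i j \<otimes> (if j = k \<and> j < m then \<one> else \<zero>)) = x i k" for i k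
    proof -
      have "(\<Oplus>j\<in>{..<m}. x i j \<otimes> (if j = k \<and> j < m then \<one> else \<zero>)) = (\<Oplus>j\<in>{..<m}. if j = k then x i j else \<zero>)"
        using xc by (intro finsum_cong') auto
      then show ?thesis using x by (auto simp: finsum_delta mat_ring_simps)
    qed
    then show "x \<otimes>\<^bsub>mat_ring R m\<^esub> \<one>\<^bsub>mat_ring R m\<^esub> = x"
      by (auto simp: mat_ring_simps fun_eq_iff)
  qed (auto simp: mat_ring_simps)
next
  fix x y z assume xyz: "x \<in> carrier (mat_ring R m)" "y \<in> carrier (mat_ring R m)" "z \<in> carrier (mat_ring R m)"
  then have cl: "\<And>i j. x i j \<in> carrier R" "\<And>i j. y i j \<in> carrier R" "\<And>i j. z i j \<in> carrier R"
    by (auto simp: mat_ring_simps)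
  have "(\<Oplus>j\<in>{..<m}. (x i j \<oplus> y i j) \<otimes> z j k) = (\<Oplus>j\<in>{..<m}. x i j \<otimes> z j k \<oplus> y i j \<otimes> z j k)" for i k
    using cl by (intro finsum_cong') (auto simp: l_distr)
  then show "(x \<oplus>\<^bsub>mat_ring R m\<^esub> y) \<otimes>\<^bsub>mat_ring R m\<^esub> z = x \<otimes>\<^bsub>mat_ring R m\<^esub> z \<oplus>\<^bsub>mat_ring R m\<^esub> y \<otimes>\<^bsub>mat_ring R m\<^esub> z"
    using cl by (auto simp: mat_ring_simps fun_eq_iff finsum_addf Pi_def)
  have "(\<Oplus>j\<in>{..<m}. z i j \<otimes> (x j k \<oplus> y j k)) = (\<Oplus>j\<in>{..<m}. z i j \<otimes> x j k \<oplus> z i j \<otimes> y j k)" for i k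
    using cl by (intro finsum_cong') (auto simp: r_distr)
  then show "z \<otimes>\<^bsub>mat_ring R m\<^esub> (x \<oplus>\<^bsub>mat_ring R m\<^esub> y) = z \<otimes>\<^bsub>mat_ring R m\<^esub> x \<oplus>\<^bsub>mat_ring R m\<^esub> z \<otimes>\<^bsub>mat_ring R m\<^esub> y"
    using cl by (auto simp: mat_ring_simps fun_eq_iff finsum_addf Pi_def)
qed

text \<open>The sum over the support may be taken over any finite set outside which the summand
  vanishes. Inside the block this set is \<open>{..<m}\<close>; outside it, row i of M or column k
  of N is that of the identity and a single index survives.\<close>

lemma (in ring) stable_mult_block:
  assumes "in_block R m M" "in_block R m N"
  shows "(M \<otimes>\<^bsub>stable_mat R\<^esub> N) i k =
    (if i < m \<and> k < m then \<Oplus>j\<in>{..<m}. M i j \<otimes> N j k else if i = k then \<one> else \<zero>)"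
proof -
  have cl: "\<And>i j. M i j \<in> carrier R" "\<And>i j. N i j \<in> carrier R"
    and M: "\<And>i j. m \<le> i \<or> m \<le> j \<Longrightarrow> M i j = (if i = j then \<one> else \<zero>)"
    and N: "\<And>i j. m \<le> i \<or> m \<le> j \<Longrightarrow> N i j = (if i = j then \<one> else \<zero>)"
    using assms unfolding in_block_def by blast+
  have gen: "(M \<otimes>\<^bsub>stable_mat R\<^esub> N) i k = (\<Oplus>j\<in>B. M i j \<otimes> N j k)"
    if "finite B" "\<And>j. j \<notin> B \<Longrightarrow> M i j \<otimes> N j k = \<zero>" for B
    unfolding stable_mat_simps using that cl
    by (intro add.finprod_mono_neutral_cong_left) auto
  show ?thesis
  proof (cases "i < m \<and> k < m")
    case True
    then show ?thesis using gen[of "{..<m}"] cl by (auto simp: M N)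
  next
    case False
    then consider "m \<le> i" | "m \<le> k" by linarith
    then show ?thesis
    proof cases
      case 1
      then have "(M \<otimes>\<^bsub>stable_mat R\<^esub> N) i k = (\<Oplus>j\<in>{i}. M i j \<otimes> N j k)"
        using cl by (intro gen) (auto simp: M)
      also have "\<dots> = M i i \<otimes> N i k" using cl by simp
      finally show ?thesis using 1 cl False by (simp add: M N)
    next
      case 2
      then have "(M \<otimes>\<^bsub>stable_mat R\<^esub> N) i k = (\<Oplus>j\<in>{k}. M i j \<otimes> N j k)"
        using cl by (intro gen) (auto simp: N)
      also have "\<dots> = M i k \<otimes> N k k" using cl by simp
      finally show ?thesis using 2 cl False by (simp add: M N)
    qed
  qed
qed

lemma (in ring) stab_mult:
  assumes "M \<in> carrier (mat_ring R m)" "N \<in> carrier (mat_ring R m)"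
  shows "stab R m (M \<otimes>\<^bsub>mat_ring R m\<^esub> N) = stab R m M \<otimes>\<^bsub>stable_mat R\<^esub> stab R m N"
proof (intro ext)
  fix i k
  have "M i j \<in> carrier R" "N i j \<in> carrier R" for i j using assms by (auto simp: mat_ring_simps)
  then show "stab R m (M \<otimes>\<^bsub>mat_ring R m\<^esub> N) i k = (stab R m M \<otimes>\<^bsub>stable_mat R\<^esub> stab R m N) i k"
    unfolding stable_mult_block[OF in_block_stab[OF assms(1)] in_block_stab[OF assms(2)]]
    by (auto simp: mat_ring_simps stab_def intro!: finsum_cong')
qed

lemma (in ring) corner_mult:
  assumes "in_block R m M" "in_block R m N"
  shows "corner R m (M \<otimes>\<^bsub>stable_mat R\<^esub> N) = corner R m M \<otimes>\<^bsub>mat_ring R m\<^esub> corner R m N"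
proof -
  interpret B: ring "mat_ring R m" by (rule mat_ring_ring)
  have "M \<otimes>\<^bsub>stable_mat R\<^esub> N = stab R m (corner R m M \<otimes>\<^bsub>mat_ring R m\<^esub> corner R m N)"
    using assms by (simp add: stab_mult corner_closed stab_corner)
  then show ?thesis using assms by (simp add: corner_stab corner_closed)
qed

lemma (in ring) in_block_mult:
  assumes "in_block R m M" "in_block R m N"
  shows "in_block R m (M \<otimes>\<^bsub>stable_mat R\<^esub> N)"
proof -
  interpret B: ring "mat_ring R m" by (rule mat_ring_ring)
  have "M \<otimes>\<^bsub>stable_mat R\<^esub> N = stab R m (corner R m M \<otimes>\<^bsub>mat_ring R m\<^esub> corner R m N)"
    using assms by (simp add: stab_mult corner_closed stab_corner)
  then show ?thesis using assms by (simp add: in_block_stab corner_closed)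
qed

lemma (in ring) in_block_one: "in_block R m \<one>\<^bsub>stable_mat R\<^esub>"
  by (auto simp: in_block_def stable_mat_simps)

lemma corner_one: "corner A m \<one>\<^bsub>stable_mat A\<^esub> = \<one>\<^bsub>mat_ring A m\<^esub>"
  by (auto simp: corner_def stable_mat_simps mat_ring_simps fun_eq_iff)

lemma stab_one: "stab A m \<one>\<^bsub>mat_ring A m\<^esub> = \<one>\<^bsub>stable_mat A\<^esub>"
  by (auto simp: stab_def stable_mat_simps mat_ring_simps fun_eq_iff)

lemma common_block:
  assumes "finite S" "S \<subseteq> carrier (stable_mat A)"
  obtains m0 where "\<And>m M. m0 \<le> m \<Longrightarrow> M \<in> S \<Longrightarrow> in_block A m M"
proof -
  have "\<exists>m0. \<forall>m\<ge>m0. \<forall>M\<in>S. in_block A m M"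
    using assms
  proof (induction S)
    case (insert x S)
    then obtain m0 where "\<forall>m\<ge>m0. \<forall>M\<in>S. in_block A m M" by auto
    moreover obtain m1 where "in_block A m1 x" using insert.prems by (auto simp: stable_mat_simps)
    ultimately show ?case using in_block_mono by (intro exI[of _ "max m0 m1"]) auto
  qed simp
  then show ?thesis using that by blast
qed

text \<open>The laws hold in \<open>mat_ring R m\<close> for a block containing all matrices
  involved, and \<open>corner\<close> is injective on such matrices.\<close>

lemma (in ring) stable_mat_monoid: "Group.monoid (stable_mat R)"
proof (rule monoidI)
  fix x y assume "x \<in> carrier (stable_mat R)" "y \<in> carrier (stable_mat R)"
  then obtain m where "in_block R m x" "in_block R m y" 
    using common_block[of "{x, y}" R] by (metis empty_subsetI finite.intros insert_iff insert_subset order_refl)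
  then show "x \<otimes>\<^bsub>stable_mat R\<^esub> y \<in> carrier (stable_mat R)"
    using in_block_mult in_block_stable by blast
next
  fix x y z assume "x \<in> carrier (stable_mat R)" "y \<in> carrier (stable_mat R)" "z \<in> carrier (stable_mat R)"
  then obtain m where m: "in_block R m x" "in_block R m y" "in_block R m z"
    using common_block[of "{x, y, z}" R] by (metis empty_subsetI finite.intros insert_iff insert_subset order_refl)
  interpret B: ring "mat_ring R m" by (rule mat_ring_ring)
  have "corner R m (x \<otimes>\<^bsub>stable_mat R\<^esub> y \<otimes>\<^bsub>stable_mat R\<^esub> z) = corner R m (x \<otimes>\<^bsub>stable_mat R\<^esub> (y \<otimes>\<^bsub>stable_mat R\<^esub> z))"
    using m by (simp add: corner_mult in_block_mult corner_closed B.m_assoc)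
  then show "x \<otimes>\<^bsub>stable_mat R\<^esub> y \<otimes>\<^bsub>stable_mat R\<^esub> z = x \<otimes>\<^bsub>stable_mat R\<^esub> (y \<otimes>\<^bsub>stable_mat R\<^esub> z)"
    using m in_block_mult stab_corner by metis
next
  fix x assume "x \<in> carrier (stable_mat R)"
  then obtain m where m: "in_block R m x" by (auto simp: stable_mat_simps)
  interpret B: ring "mat_ring R m" by (rule mat_ring_ring)
  have "corner R m (\<one>\<^bsub>stable_mat R\<^esub> \<otimes>\<^bsub>stable_mat R\<^esub> x) = corner R m x"
       "corner R m (x \<otimes>\<^bsub>stable_mat R\<^esub> \<one>\<^bsub>stable_mat R\<^esub>) = corner R m x"
    using m by (simp_all add: corner_mult in_block_one corner_closed corner_one)
  then show "\<one>\<^bsub>stable_mat R\<^esub> \<otimes>\<^bsub>stable_mat R\<^esub> x = x" "x \<otimes>\<^bsub>stable_mat R\<^esub> \<one>\<^bsub>stable_mat R\<^esub> = x"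
    using m in_block_mult in_block_one stab_corner by metis+
qed (use in_block_one in_block_stable in blast)

lemma (in ring) GL_group: "group (GL R)"
  unfolding GL_def using stable_mat_monoid monoid.units_group by blast

lemma (in ring) GL_simps:
  "carrier (GL R) = Units (stable_mat R)" "x \<otimes>\<^bsub>GL R\<^esub> y = x \<otimes>\<^bsub>stable_mat R\<^esub> y" "\<one>\<^bsub>GL R\<^esub> = \<one>\<^bsub>stable_mat R\<^esub>"
  by (simp_all add: GL_def units_of_def)

lemma (in ring) stab_Units:
  assumes "M \<in> Units (mat_ring R m)"
  shows "stab R m M \<in> carrier (GL R)"
proof -
  interpret B: ring "mat_ring R m" by (rule mat_ring_ring)
  have M: "M \<in> carrier (mat_ring R m)" "inv\<^bsub>mat_ring R m\<^esub> M \<in> carrier (mat_ring R m)" using assms by auto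
  have "stab R m M \<otimes>\<^bsub>stable_mat R\<^esub> stab R m (inv\<^bsub>mat_ring R m\<^esub> M) = \<one>\<^bsub>stable_mat R\<^esub>"
       "stab R m (inv\<^bsub>mat_ring R m\<^esub> M) \<otimes>\<^bsub>stable_mat R\<^esub> stab R m M = \<one>\<^bsub>stable_mat R\<^esub>"
    using assms M by (simp_all add: stab_mult[symmetric] stab_one)
  then show ?thesis
    using M[THEN in_block_stab, THEN in_block_stable] by (auto simp: GL_simps Units_def)
qed

lemma (in ring) stab_hom: "stab R m \<in> hom (units_of (mat_ring R m)) (GL R)"
proof -
  interpret B: ring "mat_ring R m" by (rule mat_ring_ring)
  show ?thesis by (rule homI) (auto simp: units_of_def GL_simps stab_mult[OF B.Units_closed B.Units_closed] stab_Units[unfolded GL_simps])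
qed

section \<open>Matrices under ring homomorphisms\<close>

definition mat_map :: "('a \<Rightarrow> 'b) \<Rightarrow> (nat \<Rightarrow> nat \<Rightarrow> 'a) \<Rightarrow> nat \<Rightarrow> nat \<Rightarrow> 'b" where
  "mat_map h M = (\<lambda>i j. h (M i j))"

lemma (in ring_hom_ring) in_block_mat_map:
  "in_block R m M \<Longrightarrow> in_block S m (mat_map h M)"
  by (auto simp: in_block_def mat_map_def)

lemma (in ring_hom_ring) mat_map_mult:
  assumes "M \<in> carrier (stable_mat R)" "N \<in> carrier (stable_mat R)"
  shows "mat_map h (M \<otimes>\<^bsub>stable_mat R\<^esub> N) = mat_map h M \<otimes>\<^bsub>stable_mat S\<^esub> mat_map h N"
proof -
  obtain m where m: "in_block R m M" "in_block R m N"
    using common_block[of "{M, N}" R] assms by (metis empty_subsetI finite.intros insert_iff insert_subset order_refl)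
  then have cl: "\<And>i j. M i j \<in> carrier R" "\<And>i j. N i j \<in> carrier R" unfolding in_block_def by blast+
  show ?thesis
    unfolding fun_eq_iff S.stable_mult_block[OF m[THEN in_block_mat_map]]
    using cl by (auto simp: mat_map_def R.stable_mult_block[OF m] hom_finsum_ring intro!: S.finsum_cong')
qed

lemma (in ring_hom_ring) mat_map_one: "mat_map h \<one>\<^bsub>stable_mat R\<^esub> = \<one>\<^bsub>stable_mat S\<^esub>"
  by (auto simp: mat_map_def stable_mat_simps fun_eq_iff)

lemma (in ring_hom_ring) mat_map_GL: "group_hom (GL R) (GL S) (mat_map h)"
proof -
  interpret M: Group.monoid "stable_mat R" by (rule R.stable_mat_monoid)
  have cl: "mat_map h x \<in> carrier (stable_mat S)" if "x \<in> carrier (stable_mat R)" for x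
    using that in_block_mat_map by (auto simp: stable_mat_simps)
  have "mat_map h \<in> hom (GL R) (GL S)"
  proof (rule homI)
    fix x assume x: "x \<in> carrier (GL R)"
    then obtain y where "y \<in> carrier (stable_mat R)" "x \<in> carrier (stable_mat R)"
      "x \<otimes>\<^bsub>stable_mat R\<^esub> y = \<one>\<^bsub>stable_mat R\<^esub>" "y \<otimes>\<^bsub>stable_mat R\<^esub> x = \<one>\<^bsub>stable_mat R\<^esub>"
      by (auto simp: R.GL_simps Units_def)
    then show "mat_map h x \<in> carrier (GL S)"
      unfolding S.GL_simps Units_def
      using cl mat_map_mult[of x y] mat_map_mult[of y x] by (auto simp: mat_map_one)
  qed (auto simp: R.GL_simps S.GL_simps Units_def mat_map_mult)
  then show ?thesis
    by (intro group_hom.intro group_hom_axioms.intro R.GL_group S.GL_group)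
qed

section \<open>Products of commutators in a \<open>p\<close>-adically complete ring\<close>

text \<open>Congruence modulo p^N B, written with integer multiples instead of an ideal so that it
  reads the same in R and in the noncommutative matrix rings over R[G]. Membership in the carrier is
  built in, so that congruences can be chained without side conditions.\<close>

definition pcong :: "('a, 'm) ring_scheme \<Rightarrow> nat \<Rightarrow> nat \<Rightarrow> 'a \<Rightarrow> 'a \<Rightarrow> bool" where
  "pcong B p N a b \<longleftrightarrow> a \<in> carrier B \<and> b \<in> carrier B \<and>
     (\<exists>c\<in>carrier B. a = b \<oplus>\<^bsub>B\<^esub> add_pow B (p ^ N) c)"

context ring begin

lemma pcong_closed: "pcong R p N a b \<Longrightarrow> a \<in> carrier R" "pcong R p N a b \<Longrightarrow> b \<in> carrier R"
  by (auto simp: pcong_def)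

lemma pcong_add_pow [intro]: 
  "b \<in> carrier R \<Longrightarrow> c \<in> carrier R \<Longrightarrow> pcong R p N (b \<oplus> [(p ^ N)] \<cdot> c) b"
  by (auto simp: pcong_def)

lemma pcong_refl [simp, intro]: "a \<in> carrier R \<Longrightarrow> pcong R p N a a"
  unfolding pcong_def by (auto intro!: bexI[of _ \<zero>])

lemma pcong_trans [trans]:
  assumes "pcong R p N a b" "pcong R p N b c"
  shows "pcong R p N a c"
proof -
  obtain x y where xy: "x \<in> carrier R" "y \<in> carrier R" "a = b \<oplus> [(p ^ N)] \<cdot> x" "b = c \<oplus> [(p ^ N)] \<cdot> y"
      and "c \<in> carrier R"
    using assms by (auto simp: pcong_def)
  then have "a = c \<oplus> [(p ^ N)] \<cdot> (y \<oplus> x)"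
    by (auto simp: add.nat_pow_distrib a_assoc)
  then show ?thesis using xy \<open>c \<in> carrier R\<close> by (simp add: pcong_add_pow)
qed

lemma pcong_sym:
  assumes "pcong R p N a b" shows "pcong R p N b a"
proof -
  obtain x where x: "x \<in> carrier R" "b \<in> carrier R" "a = b \<oplus> [(p ^ N)] \<cdot> x" using assms by (auto simp: pcong_def)
  then have "b = a \<oplus> [(p ^ N)] \<cdot> (\<ominus> x)"
    by (simp add: a_assoc add.nat_pow_distrib[symmetric] r_neg)
  then show ?thesis using assms x by (auto simp: pcong_def)
qed

lemma pcong_add:
  assumes "pcong R p N a b" "pcong R p N c d" shows "pcong R p N (a \<oplus> c) (b \<oplus> d)"
proof -
  obtain x y where "x \<in> carrier R" "y \<in> carrier R" "a = b \<oplus> [(p ^ N)] \<cdot> x" "c = d \<oplus> [(p ^ N)] \<cdot> y"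
    using assms by (auto simp: pcong_def)
  moreover from this have "a \<oplus> c = b \<oplus> d \<oplus> [(p ^ N)] \<cdot> (x \<oplus> y)"
    using assms by (auto simp: pcong_def add.nat_pow_distrib a_ac)
  ultimately show ?thesis using assms by (auto simp: pcong_def)
qed

lemma pcong_lmult:
  assumes "pcong R p N a b" "c \<in> carrier R" shows "pcong R p N (c \<otimes> a) (c \<otimes> b)"
proof -
  obtain x where "x \<in> carrier R" "a = b \<oplus> [(p ^ N)] \<cdot> x"
    using assms by (auto simp: pcong_def)
  then show ?thesis using assms by (auto simp: pcong_def r_distr add_pow_rdistr)
qed

lemma pcong_rmult:
  assumes "pcong R p N a b" "c \<in> carrier R" shows "pcong R p N (a \<otimes> c) (b \<otimes> c)"
proof -
  obtain x where "x \<in> carrier R" "a = b \<oplus> [(p ^ N)] \<cdot> x"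
    using assms by (auto simp: pcong_def)
  then show ?thesis using assms by (auto simp: pcong_def l_distr add_pow_ldistr)
qed

lemma pcong_mult:
  assumes "pcong R p N a b" "pcong R p N c d" shows "pcong R p N (a \<otimes> c) (b \<otimes> d)"
  using pcong_trans[OF pcong_rmult[OF assms(1)] pcong_lmult[OF assms(2)]] assms
  by (auto simp: pcong_def)

lemma pcong_neg:
  assumes "pcong R p N a b" shows "pcong R p N (\<ominus> a) (\<ominus> b)"
  using pcong_lmult[OF assms, of "\<ominus> \<one>"] assms pcong_closed[OF assms] by (simp add: l_minus)

lemma pcong_minus:
  assumes "pcong R p N a b" "pcong R p N c d" shows "pcong R p N (a \<ominus> c) (b \<ominus> d)"
  using pcong_add[OF assms(1) pcong_neg[OF assms(2)]] by (simp add: minus_eq)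

lemma pcong_mono:
  assumes "pcong R p N a b" "M \<le> N" shows "pcong R p M a b"
proof -
  obtain x where "x \<in> carrier R" "a = b \<oplus> [(p ^ N)] \<cdot> x"
    using assms by (auto simp: pcong_def)
  moreover have "p ^ N = p ^ (N - M) * p ^ M" using assms(2) by (simp add: power_add[symmetric])
  ultimately show ?thesis using assms(1)
    by (auto simp: pcong_def add.nat_pow_pow intro!: bexI[of _ "[(p ^ (N - M))] \<cdot> x"])
qed

text \<open>Applied with N = 1: modulo p^(M+1), a coefficient of p^M matters only modulo p.\<close>

lemma pcong_scale:
  assumes "pcong R p N a b" shows "pcong R p (M + N) ([(p ^ M)] \<cdot> a) ([(p ^ M)] \<cdot> b)"
proof -
  obtain x where "x \<in> carrier R" "b \<in> carrier R" "a = b \<oplus> [(p ^ N)] \<cdot> x"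
    using assms by (auto simp: pcong_def)
  then show ?thesis
    by (auto simp: pcong_def add.nat_pow_distrib add.nat_pow_pow power_add mult.commute)
qed

lemma pcong_scale_zero:
  assumes "a \<in> carrier R" "M \<le> N" shows "pcong R p M ([(p ^ N)] \<cdot> a) \<zero>"
  using pcong_mono[OF pcong_add_pow[of \<zero> a p N] assms(2)] assms(1) by simp

lemma inv_mult_Units:
  assumes "u \<in> Units R" "v \<in> Units R" shows "inv (u \<otimes> v) = inv v \<otimes> inv u"
proof -
  have "u \<otimes> v \<otimes> (inv v \<otimes> inv u) = u \<otimes> (v \<otimes> inv v) \<otimes> inv u"
    "inv v \<otimes> inv u \<otimes> (u \<otimes> v) = inv v \<otimes> (inv u \<otimes> u) \<otimes> v"
    using assms by (simp_all only: m_assoc Units_closed Units_inv_closed m_closed)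
  then show ?thesis using assms by (intro inv_unique'[symmetric]) (auto simp: Units_closed)
qed

lemma pcong_inv:
  assumes "pcong R p N u v" "u \<in> Units R" "v \<in> Units R" shows "pcong R p N (inv u) (inv v)"
proof -
  have "pcong R p N (inv u \<otimes> v \<otimes> inv v) (inv u \<otimes> u \<otimes> inv v)"
    using assms by (intro pcong_rmult pcong_lmult pcong_sym[OF assms(1)]) auto
  then show ?thesis using assms by (simp add: m_assoc Units_closed)
qed

section \<open>Group commutators and their first-order expansion\<close>

definition gcomm :: "'a \<Rightarrow> 'a \<Rightarrow> 'a" where
  "gcomm v e = v \<otimes> e \<otimes> inv v \<otimes> inv e"

primrec gcomm_prod :: "(nat \<Rightarrow> 'a) \<Rightarrow> (nat \<Rightarrow> 'a) \<Rightarrow> nat \<Rightarrow> 'a" where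
  "gcomm_prod e v 0 = \<one>"
| "gcomm_prod e v (Suc k) = gcomm_prod e v k \<otimes> gcomm (v k) (e k)"

text \<open>The derivative of \<open>gcomm_prod\<close> at v = 1, up to a twist: for v congruent to
  1 modulo p, replacing each v k by (1 - p^N (y k)(e k)) (v k) adds p^N times this sum, modulo
  p^(N+1).\<close>

primrec acomm_sum :: "(nat \<Rightarrow> 'a) \<Rightarrow> (nat \<Rightarrow> 'a) \<Rightarrow> nat \<Rightarrow> 'a" where
  "acomm_sum e y 0 = \<zero>"
| "acomm_sum e y (Suc k) = acomm_sum e y k \<oplus> (e k \<otimes> y k \<ominus> y k \<otimes> e k)"

lemma gcomm_Units [simp, intro]: "v \<in> Units R \<Longrightarrow> e \<in> Units R \<Longrightarrow> gcomm v e \<in> Units R"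
  by (auto simp: gcomm_def)

lemma gcomm_prod_Units:
  "(\<And>i. e i \<in> Units R) \<Longrightarrow> (\<And>i. v i \<in> Units R) \<Longrightarrow> gcomm_prod e v k \<in> Units R"
  by (induction k) auto

lemma acomm_sum_closed:
  "(\<And>i. e i \<in> carrier R) \<Longrightarrow> (\<And>i. y i \<in> carrier R) \<Longrightarrow> acomm_sum e y k \<in> carrier R"
  by (induction k) auto

lemma gcomm_prod_derived:
  assumes "\<And>i. e i \<in> Units R" "\<And>i. v i \<in> Units R"
  shows "gcomm_prod e v k \<in> derived (units_of R) (carrier (units_of R))"
proof (induction k)
  case 0
  then show ?case unfolding derived_def using generate.one[of "units_of R"] by (simp add: units_of_one)
next
  case (Suc k)
  have "gcomm (v k) (e k) \<in> derived (units_of R) (carrier (units_of R))"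
    unfolding derived_def using assms
    by (intro generate.incl) (auto simp: gcomm_def units_of_carrier units_of_mult units_of_inv)
  with Suc show ?case unfolding derived_def using generate.eng[of _ "units_of R"] by (simp add: units_of_mult)
qed

lemma pcong_gcomm:
  assumes "pcong R p N v v'" "v \<in> Units R" "v' \<in> Units R" "e \<in> Units R"
  shows "pcong R p N (gcomm v e) (gcomm v' e)"
  unfolding gcomm_def using assms
  by (intro pcong_mult pcong_inv pcong_refl) auto

lemma pcong_gcomm_prod:
  assumes "\<And>i. pcong R p N (v i) (v' i)" "\<And>i. v i \<in> Units R" "\<And>i. v' i \<in> Units R" "\<And>i. e i \<in> Units R"
  shows "pcong R p N (gcomm_prod e v k) (gcomm_prod e v' k)"
  by (induction k) (auto intro!: pcong_mult pcong_gcomm assms)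

lemma gcomm_one: "e \<in> Units R \<Longrightarrow> gcomm \<one> e = \<one>"
  by (simp add: gcomm_def Units_closed)

lemma gcomm_prod_one: "(\<And>i. e i \<in> Units R) \<Longrightarrow> gcomm_prod e (\<lambda>i. \<one>) k = \<one>"
  by (induction k) (auto simp: gcomm_one)

text \<open>With q = 1 - P and m = v e v^-1, the new commutator is q m q^-1 e^-1. Conjugation by q
  adds mP - Pm to first order, and m may be replaced by e in this term because v is 1 modulo
  p.\<close>

lemma pcong_gcomm_update:
  assumes N: "1 \<le> N" and v: "v \<in> Units R" "pcong R p 1 v \<one>" and e: "e \<in> Units R" and y: "y \<in> carrier R"
    and q: "\<one> \<ominus> [(p ^ N)] \<cdot> (y \<otimes> e) \<in> Units R"
  shows "pcong R p (Suc N) (gcomm ((\<one> \<ominus> [(p ^ N)] \<cdot> (y \<otimes> e)) \<otimes> v) e)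
           (gcomm v e \<oplus> [(p ^ N)] \<cdot> (e \<otimes> y \<ominus> y \<otimes> e))"
proof -
  \<comment> \<open>The factor e in z absorbs the trailing inverse of the commutator: (e z - z e)
    e^-1 = e y - y e.\<close>
  define z where "z = y \<otimes> e"
  define P where "P = [(p ^ N)] \<cdot> z"
  define q where "q = \<one> \<ominus> P"
  define m where "m = v \<otimes> e \<otimes> inv v"
  have cl [simp]: "v \<in> carrier R" "e \<in> carrier R" "inv v \<in> carrier R" "inv e \<in> carrier R" "y \<in> carrier R"
    using v e y by auto
  have zc [simp]: "z \<in> carrier R" by (simp add: z_def)
  have Pc [simp]: "P \<in> carrier R" by (simp add: P_def)
  have mc [simp]: "m \<in> carrier R" by (simp add: m_def)
  have qU [simp]: "q \<in> Units R" using q by (simp add: q_def P_def z_def)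
  have qc [simp]: "q \<in> carrier R" "inv q \<in> carrier R" using qU by (simp_all add: Units_closed)
  \<comment> \<open>Terms with two factors P carry p^(2N), and 2N is at least N + 1 because N is
    positive.\<close>
  have PP: "pcong R p (Suc N) (P \<otimes> x \<otimes> P) \<zero>" if x: "x \<in> carrier R" for x
  proof -
    have "P \<otimes> x \<otimes> P = [(p ^ (N + N))] \<cdot> (z \<otimes> x \<otimes> z)"
      using x by (simp add: P_def add_pow_ldistr add_pow_rdistr add.nat_pow_pow power_add)
    then show ?thesis using N x by (simp add: pcong_scale_zero)
  qed
  \<comment> \<open>From (1 - P)(1 + P) = 1 - P^2, where P^2 vanishes at this precision.\<close>
  have iq: "pcong R p (Suc N) (inv q) (\<one> \<oplus> P)"
  proof -
    have "q \<otimes> (\<one> \<oplus> P) = \<one> \<ominus> P \<otimes> \<one> \<otimes> P"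
      unfolding q_def by (simp add: l_distr r_distr minus_eq l_minus a_assoc r_neg1 )
    moreover have "pcong R p (Suc N) (\<one> \<ominus> P \<otimes> \<one> \<otimes> P) (\<one> \<ominus> \<zero>)"
      using PP[of \<one>] by (intro pcong_minus pcong_refl) auto
    ultimately have "pcong R p (Suc N) (q \<otimes> (\<one> \<oplus> P)) \<one>" by (simp add: minus_eq)
    from pcong_sym[OF pcong_lmult[OF this, of "inv q"]]
    show ?thesis by (simp add: m_assoc[symmetric])
  qed
  have me: "pcong R p 1 m e"
    unfolding m_def using pcong_mult[OF pcong_mult[OF v(2) pcong_refl] pcong_inv[OF v(2) v(1)]] by auto
  have qmq: "pcong R p (Suc N) (q \<otimes> m \<otimes> inv q) (m \<oplus> [(p ^ N)] \<cdot> (e \<otimes> z \<ominus> z \<otimes> e))"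
  proof -
    have "pcong R p (Suc N) (q \<otimes> m \<otimes> inv q) (q \<otimes> m \<otimes> (\<one> \<oplus> P))"
      by (intro pcong_lmult iq) auto
    also have "q \<otimes> m \<otimes> (\<one> \<oplus> P) = m \<oplus> (m \<otimes> P \<ominus> P \<otimes> m) \<ominus> P \<otimes> m \<otimes> P"
      unfolding q_def by (simp add: l_distr r_distr minus_eq l_minus a_ac minus_add)
    also have "pcong R p (Suc N) \<dots> (m \<oplus> (m \<otimes> P \<ominus> P \<otimes> m) \<ominus> \<zero>)"
      by (intro pcong_minus pcong_refl PP) auto
    also have "m \<oplus> (m \<otimes> P \<ominus> P \<otimes> m) \<ominus> \<zero> = m \<oplus> (m \<otimes> P \<ominus> P \<otimes> m)" by (simp add: minus_eq)
    also have "m \<otimes> P \<ominus> P \<otimes> m = [(p ^ N)] \<cdot> (m \<otimes> z \<ominus> z \<otimes> m)"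
      by (simp add: P_def add_pow_ldistr add_pow_rdistr minus_eq add.nat_pow_distrib add.nat_pow_inv)
    also have "pcong R p (Suc N) (m \<oplus> [(p ^ N)] \<cdot> (m \<otimes> z \<ominus> z \<otimes> m)) (m \<oplus> [(p ^ N)] \<cdot> (e \<otimes> z \<ominus> z \<otimes> e))"
    proof -
      have "pcong R p 1 (m \<otimes> z \<ominus> z \<otimes> m) (e \<otimes> z \<ominus> z \<otimes> e)"
        using me by (intro pcong_minus pcong_lmult pcong_rmult) auto
      from pcong_scale[OF this, of N] show ?thesis by (intro pcong_add) auto
    qed
    finally show ?thesis .
  qed
  have "gcomm (q \<otimes> v) e = q \<otimes> m \<otimes> inv q \<otimes> inv e"
    unfolding gcomm_def m_def using v qU by (simp add: inv_mult_Units m_assoc)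
  moreover have "pcong R p (Suc N) (q \<otimes> m \<otimes> inv q \<otimes> inv e) ((m \<oplus> [(p ^ N)] \<cdot> (e \<otimes> z \<ominus> z \<otimes> e)) \<otimes> inv e)"
    using qmq by (rule pcong_rmult) auto
  moreover have "(m \<oplus> [(p ^ N)] \<cdot> (e \<otimes> z \<ominus> z \<otimes> e)) \<otimes> inv e = gcomm v e \<oplus> [(p ^ N)] \<cdot> (e \<otimes> y \<ominus> y \<otimes> e)"
    using e by (simp add: l_distr add_pow_ldistr m_def gcomm_def z_def minus_eq l_minus m_assoc)
  ultimately show ?thesis by (simp add: q_def P_def z_def)
qed

text \<open>Product rule. The partial product F and the next commutator w are 1 modulo p, so
  multiplying a correction of order p^N by them changes nothing modulo p^(N+1), and the product of
  two corrections carries p^(2N). The corrections therefore simply add up.\<close>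

lemma pcong_gcomm_prod_update:
  assumes N: "1 \<le> N" and v: "\<And>i. v i \<in> Units R" "\<And>i. pcong R p 1 (v i) \<one>"
    and e: "\<And>i. e i \<in> Units R" and y: "\<And>i. y i \<in> carrier R"
    and q: "\<And>i. \<one> \<ominus> [(p ^ N)] \<cdot> (y i \<otimes> e i) \<in> Units R"
  shows "pcong R p (Suc N) (gcomm_prod e (\<lambda>i. (\<one> \<ominus> [(p ^ N)] \<cdot> (y i \<otimes> e i)) \<otimes> v i) k)
           (gcomm_prod e v k \<oplus> [(p ^ N)] \<cdot> acomm_sum e y k)"
proof (induction k)
  case 0
  then show ?case by simp
next
  case (Suc k)
  define F where "F = gcomm_prod e v k"
  define S where "S = acomm_sum e y k"
  define w where "w = gcomm (v k) (e k)"
  define d where "d = e k \<otimes> y k \<ominus> y k \<otimes> e k"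
  have cl [simp]: "F \<in> carrier R" "S \<in> carrier R" "w \<in> carrier R" "d \<in> carrier R"
    using v(1) e y gcomm_prod_Units[of e v k] acomm_sum_closed[of e y k]
    by (simp_all add: F_def S_def w_def d_def Units_closed)
  have F1: "pcong R p 1 F \<one>"
    using pcong_gcomm_prod[of p 1 v "\<lambda>_. \<one>" e k] v e by (simp add: F_def gcomm_prod_one)
  have w1: "pcong R p 1 w \<one>"
    using pcong_gcomm[of p 1 "v k" \<one> "e k"] v e by (simp add: w_def gcomm_one)
  have "pcong R p (Suc N) (gcomm_prod e (\<lambda>i. (\<one> \<ominus> [(p ^ N)] \<cdot> (y i \<otimes> e i)) \<otimes> v i) (Suc k))
      ((F \<oplus> [(p ^ N)] \<cdot> S) \<otimes> (w \<oplus> [(p ^ N)] \<cdot> d))"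
    unfolding gcomm_prod.simps F_def S_def w_def d_def
    by (rule pcong_mult[OF Suc pcong_gcomm_update[OF N v(1) v(2) e y q]])
  also have "(F \<oplus> [(p ^ N)] \<cdot> S) \<otimes> (w \<oplus> [(p ^ N)] \<cdot> d)
      = F \<otimes> w \<oplus> [(p ^ N)] \<cdot> (S \<otimes> w \<oplus> F \<otimes> d \<oplus> [(p ^ N)] \<cdot> (S \<otimes> d))"
    by (simp add: l_distr r_distr add_pow_ldistr add_pow_rdistr add.nat_pow_distrib a_ac)
  also have "pcong R p (Suc N) \<dots> (F \<otimes> w \<oplus> [(p ^ N)] \<cdot> (S \<otimes> \<one> \<oplus> \<one> \<otimes> d \<oplus> \<zero>))"
  proof -
    have "pcong R p 1 (S \<otimes> w \<oplus> F \<otimes> d \<oplus> [(p ^ N)] \<cdot> (S \<otimes> d)) (S \<otimes> \<one> \<oplus> \<one> \<otimes> d \<oplus> \<zero>)"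
      by (intro pcong_add pcong_lmult pcong_rmult F1 w1 pcong_scale_zero N) auto
    from pcong_scale[OF this, of N] show ?thesis by (intro pcong_add) auto
  qed
  also have "F \<otimes> w \<oplus> [(p ^ N)] \<cdot> (S \<otimes> \<one> \<oplus> \<one> \<otimes> d \<oplus> \<zero>) = gcomm_prod e v (Suc k) \<oplus> [(p ^ N)] \<cdot> acomm_sum e y (Suc k)"
    using cl by (simp add: F_def[symmetric] S_def[symmetric] w_def[symmetric] d_def[symmetric])
  finally show ?case .
qed

end

text \<open>Commutativity is not assumed, since the results are applied to matrix rings over R[G].
  \<open>complete\<close> concerns sequences whose consecutive terms agree modulo p^N, with a limit
  that agrees with term N to the same precision.\<close>

locale padic_ring = ring R for R :: "('a, 'm) ring_scheme" (structure) and p :: nat +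
  assumes separated: "a \<in> carrier R \<Longrightarrow> b \<in> carrier R \<Longrightarrow> (\<And>N. pcong R p N a b) \<Longrightarrow> a = b"
    and complete: "(\<And>N. x N \<in> carrier R) \<Longrightarrow> (\<And>N. pcong R p N (x (Suc N)) (x N)) \<Longrightarrow>
       \<exists>l\<in>carrier R. \<forall>N. pcong R p N l (x N)"
begin

text \<open>The inverse of u = 1 - z is the geometric series in z, whose term z^N vanishes modulo
  p^N. The partial sums commute with u, so their limit is an inverse on both sides.\<close>

lemma pcong_one_Units:
  assumes "pcong R p 1 u \<one>" shows "u \<in> Units R"
proof -
  obtain c where c: "c \<in> carrier R" "u = \<one> \<oplus> [p] \<cdot> c" using assms by (auto simp: pcong_def)
  define z where "z = \<ominus> ([p] \<cdot> c)"
  have z [simp]: "z \<in> carrier R" using c by (simp add: z_def)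
  have u: "u = \<one> \<ominus> z" using c by (simp add: z_def minus_eq)
  have uc: "u \<in> carrier R" using c by simp
  have zN: "pcong R p N (z [^] N) \<zero>" for N
  proof (induction N)
    case 0
    show ?case using pcong_scale_zero[of \<one> 0 0 p] by simp
  next
    case (Suc N)
    obtain d where d: "d \<in> carrier R" "z [^] N = [(p ^ N)] \<cdot> d" using Suc by (auto simp: pcong_def)
    have "z [^] Suc N = [(p ^ Suc N)] \<cdot> (\<ominus> (d \<otimes> c))"
      using c d by (simp add: z_def r_minus add_pow_ldistr add_pow_rdistr add.nat_pow_pow add.nat_pow_inv mult.commute)
    then show ?case using pcong_scale_zero[of "\<ominus> (d \<otimes> c)" "Suc N" "Suc N" p] c d by simp
  qed
  define x where "x N = (\<Oplus>k\<in>{..<N}. z [^] k)" for N :: nat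
  have xc: "x N \<in> carrier R" for N by (auto simp: x_def)
  have xS: "x (Suc N) = x N \<oplus> z [^] N" for N
    unfolding x_def by (simp add: lessThan_Suc finsum_insert Pi_def a_comm)
  have comm: "z \<otimes> x N = x N \<otimes> z" for N
    by (induction N) (auto simp: x_def[of 0] xS l_distr r_distr xc nat_pow_comm[of z 1, simplified])
  have ux: "u \<otimes> x N = \<one> \<ominus> z [^] N" for N
  proof (induction N)
    case 0
    then show ?case using uc by (simp add: x_def minus_eq r_neg)
  next
    case (Suc N)
    have "u \<otimes> x (Suc N) = (\<one> \<ominus> z [^] N) \<oplus> (\<one> \<ominus> z) \<otimes> z [^] N"
      using Suc uc xc by (simp add: xS r_distr u[symmetric])
    also have "\<dots> = \<one> \<ominus> z [^] (Suc N)"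
      by (simp add: minus_eq l_distr l_minus a_assoc r_neg1 r_neg2 nat_pow_comm[of z 1, simplified])
    finally show ?case .
  qed
  have xu: "x N \<otimes> u = u \<otimes> x N" for N
    using xc comm by (simp add: u minus_eq l_distr r_distr l_minus r_minus)
  have "pcong R p N (x (Suc N)) (x N)" for N
    using pcong_add[OF pcong_refl[OF xc[of N], of p N] zN[of N]] xc by (simp add: xS)
  then obtain l where l: "l \<in> carrier R" "\<And>N. pcong R p N l (x N)"
    using complete[of x] xc by blast
  have 1: "pcong R p N (u \<otimes> x N) \<one>" for N
    unfolding ux using pcong_minus[OF pcong_refl[of \<one> p N] zN[of N]] by (simp add: minus_eq)
  have "u \<otimes> l = \<one>"
    using pcong_trans[OF pcong_lmult[OF l(2) uc] 1] l(1) uc by (intro separated) auto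
  moreover have "l \<otimes> u = \<one>"
    using pcong_trans[OF pcong_rmult[OF l(2) uc] 1[folded xu]] l(1) uc by (intro separated) auto
  ultimately show ?thesis using l uc by (auto simp: Units_def)
qed

text \<open>Successive approximation: an approximate factorization of \<open>u\<close> modulo \<open>p\<^sup>N\<close> is corrected
  modulo \<open>p\<^bsup>N+1\<^esup>\<close> by solving the linearized equation, in which group commutators with the fixed
  units \<open>e i\<close> become additive commutators.\<close>

theorem gcomm_prod_eqI:
  assumes H: "subgroup H (units_of R)" "\<And>v w. v \<in> Units R \<Longrightarrow> w \<in> Units R \<Longrightarrow> gcomm v w \<in> H"
    and u: "u \<in> H" "pcong R p n u \<one>" and n: "1 \<le> n"
    and e: "\<And>i. e i \<in> Units R"
    and lin: "\<And>N c. n \<le> N \<Longrightarrow> c \<in> carrier R \<Longrightarrow> \<one> \<oplus> [(p ^ N)] \<cdot> c \<in> H \<Longrightarrow>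
       \<exists>y. (\<forall>i. y i \<in> carrier R) \<and> pcong R p 1 c (acomm_sum e y d)"
  obtains v where "\<And>i. v i \<in> Units R" "u = gcomm_prod e v d"
proof -
  have HU: "H \<subseteq> Units R" using subgroup.subset[OF H(1)] by (simp add: units_of_carrier)
  have Hm: "x \<otimes> y \<in> H" if "x \<in> H" "y \<in> H" for x y
    using subgroup.m_closed[OF H(1) that] by (simp add: units_of_mult)
  have Hi: "inv x \<in> H" if "x \<in> H" for x
    using subgroup.m_inv_closed[OF H(1) that] that HU by (auto simp: units_of_inv)
  have H1: "\<one> \<in> H" using subgroup.one_closed[OF H(1)] by (simp add: units_of_one)
  have Hp: "gcomm_prod e v k \<in> H" if "\<And>i. v i \<in> Units R" for v k
    by (induction k) (auto simp: H1 intro!: Hm H(2) that e)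
  \<comment> \<open>The invariant has three parts: the first entries stay 1 modulo p, the product of
    d commutators agrees with u modulo p^(n+N), and passing to the next stage alters each first
    entry only by a multiple of p^(n+N). The last part makes the entries converge.\<close>
  have "\<exists>V. \<forall>N. ((\<forall>i. pcong R p 1 (V N i) \<one>) \<and> pcong R p (n + N) u (gcomm_prod e (V N) d)) \<and>
      (\<forall>i. pcong R p (n + N) (V (Suc N) i) (V N i))"
  proof (rule dependent_nat_choice)
    show "\<exists>v. (\<forall>i. pcong R p 1 (v i) \<one>) \<and> pcong R p (n + 0) u (gcomm_prod e v d)"
      using u(2) gcomm_prod_one[of e d] e by (intro exI[of _ "\<lambda>_. \<one>"]) auto
  next
    fix v N assume v: "(\<forall>i. pcong R p 1 (v i) \<one>) \<and> pcong R p (n + N) u (gcomm_prod e v d)"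
    define M where "M = n + N"
    define F where "F = gcomm_prod e v d"
    have vU: "v i \<in> Units R" for i using v pcong_one_Units by blast
    \<comment> \<open>Since H contains all commutators, the error u F^-1 stays in H, so
      \<open>lin\<close> applies to it at every stage.\<close>
    have FH: "F \<in> H" unfolding F_def by (rule Hp[OF vU])
    then have FU [simp]: "F \<in> Units R" using HU by auto
    have Fc [simp]: "F \<in> carrier R" "inv F \<in> carrier R" "u \<in> carrier R"
      using Units_closed[OF FU] FU u(1) HU by auto
    have xH: "u \<otimes> inv F \<in> H" using FH u(1) by (intro Hm Hi)
    have "pcong R p M (u \<otimes> inv F) (F \<otimes> inv F)"
      using v by (intro pcong_rmult) (auto simp: M_def F_def[symmetric])
    then obtain c where c: "c \<in> carrier R" "u \<otimes> inv F = \<one> \<oplus> [(p ^ M)] \<cdot> c"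
      by (auto simp: pcong_def)
    obtain y where y: "\<And>i. y i \<in> carrier R" "pcong R p 1 c (acomm_sum e y d)"
      using lin[of M c] c xH by (auto simp: M_def)
    \<comment> \<open>Exactly the modification whose effect \<open>pcong_gcomm_prod_update\<close>
      computes. It is 1 modulo p^M times v, so it keeps the congruence to 1 modulo p and the
      agreement with v.\<close>
    define v' where "v' i = (\<one> \<ominus> [(p ^ M)] \<cdot> (y i \<otimes> e i)) \<otimes> v i" for i
    have M1: "1 \<le> M" using n by (simp add: M_def)
    have vc: "v i \<in> carrier R" "e i \<in> carrier R" for i using vU e by auto
    have q: "pcong R p M (\<one> \<ominus> [(p ^ M)] \<cdot> (y i \<otimes> e i)) \<one>" for i
      using pcong_minus[OF pcong_refl pcong_scale_zero[of "y i \<otimes> e i" M M p], of \<one>] y vc by (simp add: minus_eq)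
    then have qU: "\<one> \<ominus> [(p ^ M)] \<cdot> (y i \<otimes> e i) \<in> Units R" for i
      using pcong_mono[OF q M1] pcong_one_Units by blast
    have v'v: "pcong R p M (v' i) (v i)" for i
      using pcong_rmult[OF q vc(1)] vc by (simp add: v'_def)
    have F1: "pcong R p 1 F \<one>"
      using pcong_gcomm_prod[of p 1 v "\<lambda>_. \<one>" e d] vU v e by (simp add: F_def gcomm_prod_one)
    \<comment> \<open>The error was taken as a left factor, u = (1 + p^M c) F. As F is 1 modulo p,
      the term p^M c F may be replaced by p^M times the sum of additive commutators supplied by
      \<open>lin\<close>.\<close>
    have "u = (\<one> \<oplus> [(p ^ M)] \<cdot> c) \<otimes> F" using c(2)[symmetric] by (simp add: m_assoc)
    also have "\<dots> = F \<oplus> [(p ^ M)] \<cdot> (c \<otimes> F)" using c(1) by (simp add: l_distr add_pow_ldistr)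
    finally have "u = F \<oplus> [(p ^ M)] \<cdot> (c \<otimes> F)" .
    also have "pcong R p (Suc M) \<dots> (F \<oplus> [(p ^ M)] \<cdot> acomm_sum e y d)"
    proof -
      have "pcong R p 1 (c \<otimes> F) (acomm_sum e y d)"
        using pcong_mult[OF y(2) F1] acomm_sum_closed[of e y d] y(1) vc by simp
      from pcong_scale[OF this, of M] show ?thesis by (intro pcong_add) auto
    qed
    also have "pcong R p (Suc M) \<dots> (gcomm_prod e v' d)"
      unfolding F_def v'_def using v vU e y qU M1
      by (intro pcong_sym[OF pcong_gcomm_prod_update]) auto
    finally have "pcong R p (Suc M) u (gcomm_prod e v' d)" .
    moreover have "pcong R p 1 (v' i) \<one>" for i
      using pcong_trans[OF pcong_mono[OF v'v M1]] v by blast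
    ultimately show "\<exists>v'. ((\<forall>i. pcong R p 1 (v' i) \<one>) \<and> pcong R p (n + Suc N) u (gcomm_prod e v' d)) \<and>
        (\<forall>i. pcong R p (n + N) (v' i) (v i))"
      using v'v by (intro exI[of _ v']) (auto simp: M_def)
  qed
  then obtain V where V1: "\<And>N i. pcong R p 1 (V N i) \<one>"
    and V2: "\<And>N. pcong R p (n + N) u (gcomm_prod e (V N) d)"
    and V3: "\<And>N i. pcong R p (n + N) (V (Suc N) i) (V N i)" by blast
  \<comment> \<open>With d fixed, the limit can be taken in each factor separately, and
    separatedness then turns the congruences for the product into an equality.\<close>
  have "\<exists>l\<in>carrier R. \<forall>N. pcong R p N l (V N i)" for i
    by (intro complete pcong_closed[OF V1] pcong_mono[OF V3]) auto
  then obtain l where l: "\<And>i N. pcong R p N (l i) (V N i)" by metis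
  have lU: "l i \<in> Units R" for i
    using pcong_trans[OF l[of 1 i] V1] by (rule pcong_one_Units)
  have "pcong R p N u (gcomm_prod e l d)" for N
    using pcong_trans[OF pcong_mono[OF V2[of N]] pcong_sym[OF pcong_gcomm_prod[OF l lU]]] V1 e pcong_one_Units
    by auto
  then have "u = gcomm_prod e l d"
    using pcong_closed by (intro separated) blast+
  with lU show ?thesis by (rule that)
qed

end

section \<open>Determinants over a commutative ring\<close>

definition perm_sign :: "('a, 'm) ring_scheme \<Rightarrow> (nat \<Rightarrow> nat) \<Rightarrow> 'a" where
  "perm_sign R p = (if evenperm p then \<one>\<^bsub>R\<^esub> else \<ominus>\<^bsub>R\<^esub> \<one>\<^bsub>R\<^esub>)"

text \<open>The Leibniz formula needs no division and is preserved by ring homomorphisms term by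
  term. Entries outside the k by k block are ignored, so no padding has to be stripped.\<close>

definition cdet :: "('a, 'm) ring_scheme \<Rightarrow> nat \<Rightarrow> (nat \<Rightarrow> nat \<Rightarrow> 'a) \<Rightarrow> 'a" where
  "cdet R k M = (\<Oplus>\<^bsub>R\<^esub>p\<in>{p. p permutes {..<k}}. perm_sign R p \<otimes>\<^bsub>R\<^esub> (\<Otimes>\<^bsub>R\<^esub>i\<in>{..<k}. M i (p i)))"

context cring begin

lemma perm_sign_closed [simp, intro]: "perm_sign R p \<in> carrier R"
  by (simp add: perm_sign_def)

lemma finite_permutes [simp, intro]: "finite {p. p permutes {..<k::nat}}"
  by (simp add: finite_permutations)

lemma perm_sign_compose:
  assumes "p permutes {..<k}" "q permutes {..<k}"
  shows "perm_sign R (p \<circ> q) = perm_sign R p \<otimes> perm_sign R q"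
proof -
  have "permutation p" "permutation q" using assms by (auto simp: permutation_permutes)
  then show ?thesis by (auto simp: perm_sign_def evenperm_comp l_minus)
qed

lemma cdet_closed:
  "(\<And>i j. i < k \<Longrightarrow> j < k \<Longrightarrow> M i j \<in> carrier R) \<Longrightarrow> cdet R k M \<in> carrier R"
  unfolding cdet_def
  by (intro finsum_closed funcsetI m_closed perm_sign_closed finprod_closed)
     (auto dest: permutes_in_image)

lemma cdet_cong:
  assumes "\<And>i j. i < k \<Longrightarrow> j < k \<Longrightarrow> M i j = N i j" "\<And>i j. i < k \<Longrightarrow> j < k \<Longrightarrow> N i j \<in> carrier R"
  shows "cdet R k M = cdet R k N"
proof -
  have *: "(\<Otimes>i\<in>{..<k}. M i (p i)) = (\<Otimes>i\<in>{..<k}. N i (p i))" "(\<Otimes>i\<in>{..<k}. N i (p i)) \<in> carrier R"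
    if "p permutes {..<k}" for p
    using assms permutes_in_image[OF that] by (auto intro!: finprod_cong' finprod_closed)
  show ?thesis unfolding cdet_def by (intro finsum_cong') (auto simp: *)
qed

lemma prod_of_sums:
  assumes "finite I" "finite J" "\<And>i j. i \<in> I \<Longrightarrow> j \<in> J \<Longrightarrow> f i j \<in> carrier R"
  shows "(\<Otimes>i\<in>I. \<Oplus>j\<in>J. f i j) = (\<Oplus>\<phi>\<in>I \<rightarrow>\<^sub>E J. \<Otimes>i\<in>I. f i (\<phi> i))"
  using assms(1,3)
proof (induction I)
  case empty
  then show ?case by (simp add: PiE_empty_domain)
next
  case (insert x I)
  have fin: "finite (I \<rightarrow>\<^sub>E J)" using insert assms(2) by (simp add: finite_PiE)
  have cl: "(\<Otimes>i\<in>I. f i (\<phi> i)) \<in> carrier R" if "\<phi> \<in> I \<rightarrow>\<^sub>E J" for \<phi>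
    using that insert.prems by (intro finprod_closed) (auto simp: PiE_iff)
  have eq: "insert x I \<rightarrow>\<^sub>E J = (\<lambda>(j, \<phi>). \<phi>(x := j)) ` (J \<times> (I \<rightarrow>\<^sub>E J))"
    by (simp add: PiE_insert_eq)
  have inj: "inj_on (\<lambda>(j, \<phi>). \<phi>(x := j)) (J \<times> (I \<rightarrow>\<^sub>E J))"
    using insert.hyps(2) by (auto simp: inj_on_def fun_eq_iff PiE_iff extensional_def)
  have upd: "(\<Otimes>i\<in>insert x I. f i ((\<phi>(x := j)) i)) = f x j \<otimes> (\<Otimes>i\<in>I. f i (\<phi> i))"
    if "j \<in> J" "\<phi> \<in> I \<rightarrow>\<^sub>E J" for j \<phi>
  proof -
    have "(\<Otimes>i\<in>I. f i ((\<phi>(x := j)) i)) = (\<Otimes>i\<in>I. f i (\<phi> i))"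
      using insert that by (intro finprod_cong') (auto simp: PiE_iff)
    then show ?thesis using insert that by (subst finprod_insert) (auto simp: PiE_iff)
  qed
  have "(\<Oplus>\<phi>\<in>insert x I \<rightarrow>\<^sub>E J. \<Otimes>i\<in>insert x I. f i (\<phi> i))
      = finsum R (\<lambda>(j, \<phi>). f x j \<otimes> (\<Otimes>i\<in>I. f i (\<phi> i))) (J \<times> (I \<rightarrow>\<^sub>E J))"
  proof -
    have "(\<Oplus>\<phi>\<in>insert x I \<rightarrow>\<^sub>E J. \<Otimes>i\<in>insert x I. f i (\<phi> i))
        = finsum R (\<lambda>z. \<Otimes>i\<in>insert x I. f i ((case z of (j, \<phi>) \<Rightarrow> \<phi>(x := j)) i)) (J \<times> (I \<rightarrow>\<^sub>E J))"
      unfolding eq using insert.prems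
      by (intro finsum_reindex inj) (auto intro!: finprod_closed simp: PiE_iff)
    also have "\<dots> = finsum R (\<lambda>(j, \<phi>). f x j \<otimes> (\<Otimes>i\<in>I. f i (\<phi> i))) (J \<times> (I \<rightarrow>\<^sub>E J))"
      using insert.prems upd cl by (intro finsum_cong') (auto simp del: finprod_insert fun_upd_apply)
    finally show ?thesis .
  qed
  also have "\<dots> = (\<Oplus>j\<in>J. \<Oplus>\<phi>\<in>I \<rightarrow>\<^sub>E J. f x j \<otimes> (\<Otimes>i\<in>I. f i (\<phi> i)))"
    using insert.prems cl fin assms(2) by (subst finsum_cartesian) auto
  also have "\<dots> = (\<Oplus>j\<in>J. f x j \<otimes> (\<Oplus>\<phi>\<in>I \<rightarrow>\<^sub>E J. \<Otimes>i\<in>I. f i (\<phi> i)))"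
    using insert.prems cl fin by (intro finsum_cong') (auto simp: finsum_rdistr Pi_def)
  also have "\<dots> = (\<Oplus>j\<in>J. f x j) \<otimes> (\<Oplus>\<phi>\<in>I \<rightarrow>\<^sub>E J. \<Otimes>i\<in>I. f i (\<phi> i))"
    using insert.prems cl assms(2) by (intro finsum_ldistr[symmetric]) (auto intro!: finsum_closed)
  also have "\<dots> = (\<Otimes>i\<in>insert x I. \<Oplus>j\<in>J. f i j)"
    using insert by (subst finprod_insert) (auto intro!: finsum_closed)
  finally show ?case ..
qed

text \<open>Composition with the transposition of a and b pairs even with odd permutations and
  preserves the product of entries, as rows a and b agree. Cancelling in pairs works in every
  commutative ring, whereas the argument that the determinant is its own negative would require
  division by 2.\<close>

lemma cdet_rows_inj:
  assumes N: "\<And>i j. i < k \<Longrightarrow> j < k \<Longrightarrow> N i j \<in> carrier R"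
    and f: "f \<in> {..<k} \<rightarrow> {..<k}"
    and ab: "a < k" "b < k" "a \<noteq> b" "f a = f b"
  shows "cdet R k (\<lambda>i j. N (f i) j) = \<zero>"
proof -
  let ?t = "transpose a b"
  define g where "g p = (\<Otimes>i\<in>{..<k}. N (f i) (p i))" for p
  have t: "?t permutes {..<k}" using ab by (intro permutes_swap_id) auto
  have gc: "g p \<in> carrier R" if "p permutes {..<k}" for p
    unfolding g_def using N f permutes_in_image[OF that] by (intro finprod_closed) auto
  have gt: "g (p \<circ> ?t) = g p" if p: "p permutes {..<k}" for p
  proof -
    have "g p = (\<Otimes>i\<in>?t ` {..<k}. N (f i) (p i))"
      by (simp only: permutes_image[OF t] g_def)
    also have "\<dots> = (\<Otimes>i\<in>{..<k}. N (f (?t i)) (p (?t i)))"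
      using N f permutes_in_image[OF p] permutes_in_image[OF t] permutes_inj_on[OF t]
      by (intro finprod_reindex) (auto simp: Pi_def)
    also have "\<dots> = g (p \<circ> ?t)"
    proof -
      have "f (?t i) = f i" for i using ab by (auto simp: transpose_def)
      then show ?thesis by (simp add: g_def)
    qed
    finally show ?thesis ..
  qed
  define E where "E = {p. p permutes {..<k} \<and> evenperm p}"
  define O' where "O' = {p. p permutes {..<k} \<and> \<not> evenperm p}"
  have perm: "permutation p" if "p permutes {..<k}" for p using that by (auto simp: permutation_permutes)
  have odd: "\<not> evenperm ?t" using ab by (simp add: evenperm_swap)
  have bij: "bij_betw (\<lambda>p. p \<circ> ?t) E O'"
  proof (rule bij_betwI[where g = "\<lambda>p. p \<circ> ?t"])
    show "(\<lambda>p. p \<circ> ?t) \<in> E \<rightarrow> O'" "(\<lambda>p. p \<circ> ?t) \<in> O' \<rightarrow> E"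
      using odd perm t by (auto simp: E_def O'_def evenperm_comp permutes_compose)
  qed (auto simp: comp_assoc)
  have fin: "finite E" "finite O'" unfolding E_def O'_def by (auto intro: finite_subset[OF _ finite_permutes])
  have U: "{p. p permutes {..<k}} = E \<union> O'" "E \<inter> O' = {}" by (auto simp: E_def O'_def)
  have "cdet R k (\<lambda>i j. N (f i) j) = (\<Oplus>p\<in>E. perm_sign R p \<otimes> g p) \<oplus> (\<Oplus>p\<in>O'. perm_sign R p \<otimes> g p)"
    unfolding cdet_def U(1) g_def[symmetric] using fin U(2) gc
    by (intro finsum_Un_disjoint) (auto simp: E_def O'_def)
  also have "(\<Oplus>p\<in>O'. perm_sign R p \<otimes> g p) = (\<Oplus>p\<in>E. perm_sign R (p \<circ> ?t) \<otimes> g (p \<circ> ?t))"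
    using gc by (intro finsum_bij[OF bij]) (auto simp: O'_def)
  also have "\<dots> = (\<Oplus>p\<in>E. \<ominus> (perm_sign R p \<otimes> g p))"
    using gc gt odd perm t
    by (intro finsum_cong') (auto simp: E_def perm_sign_def evenperm_comp l_minus)
  also have "(\<Oplus>p\<in>E. perm_sign R p \<otimes> g p) \<oplus> (\<Oplus>p\<in>E. \<ominus> (perm_sign R p \<otimes> g p))
     = (\<Oplus>p\<in>E. perm_sign R p \<otimes> g p \<oplus> \<ominus> (perm_sign R p \<otimes> g p))"
    using gc by (intro finsum_addf[symmetric]) (auto simp: E_def)
  also have "\<dots> = \<zero>" using gc by (intro add.finprod_one_eqI) (auto simp: E_def r_neg)
  finally show ?thesis .
qed

text \<open>Reindex the Leibniz sum by p -> p o f and the product by f; the sign of f splits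
  off.\<close>

lemma cdet_rows_perm:
  assumes N: "\<And>i j. i < k \<Longrightarrow> j < k \<Longrightarrow> N i j \<in> carrier R"
    and f: "f permutes {..<k}"
  shows "cdet R k (\<lambda>i j. N (f i) j) = perm_sign R f \<otimes> cdet R k N"
proof -
  have bij: "bij_betw (\<lambda>p. p \<circ> f) {p. p permutes {..<k}} {p. p permutes {..<k}}"
    by (rule bij_betwI[where g = "\<lambda>p. p \<circ> inv_into UNIV f"])
       (auto simp: permutes_compose f permutes_inv comp_assoc permutes_inv_o[OF f])
  have cl: "(\<Otimes>i\<in>{..<k}. N (h i) (p i)) \<in> carrier R" if "p permutes {..<k}" "h permutes {..<k}" for p h
    using N permutes_in_image[OF that(1)] permutes_in_image[OF that(2)] by (intro finprod_closed) auto
  have cl': "(\<Otimes>i\<in>{..<k}. N i (p i)) \<in> carrier R" if "p permutes {..<k}" for p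
    using cl[OF that permutes_id] by simp
  have re: "(\<Otimes>i\<in>{..<k}. N (f i) ((p \<circ> f) i)) = (\<Otimes>i\<in>{..<k}. N i (p i))" if p: "p permutes {..<k}" for p
  proof -
    have "(\<Otimes>i\<in>{..<k}. N i (p i)) = (\<Otimes>i\<in>f ` {..<k}. N i (p i))"
      by (simp only: permutes_image[OF f])
    also have "\<dots> = (\<Otimes>i\<in>{..<k}. N (f i) (p (f i)))"
      using N permutes_in_image[OF p] permutes_in_image[OF f] permutes_inj_on[OF f]
      by (intro finprod_reindex) (auto simp: Pi_def)
    finally show ?thesis by simp
  qed
  have "cdet R k (\<lambda>i j. N (f i) j)
      = (\<Oplus>p\<in>{p. p permutes {..<k}}. perm_sign R (p \<circ> f) \<otimes> (\<Otimes>i\<in>{..<k}. N (f i) ((p \<circ> f) i)))"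
    unfolding cdet_def using cl f by (intro finsum_bij[OF bij]) auto
  also have "\<dots> = (\<Oplus>p\<in>{p. p permutes {..<k}}. perm_sign R f \<otimes> (perm_sign R p \<otimes> (\<Otimes>i\<in>{..<k}. N i (p i))))"
    using cl' f by (intro finsum_cong') (auto simp: re perm_sign_compose[of _ k] m_ac simp del: comp_apply)
  also have "\<dots> = perm_sign R f \<otimes> cdet R k N"
    unfolding cdet_def using cl' by (intro finsum_rdistr[symmetric]) auto
  finally show ?thesis .
qed

text \<open>Expanding the product of row sums gives one term for each function f selecting rows of
  N. The term is a determinant with rows chosen by f, which vanishes unless f is injective, that is,
  a permutation.\<close>

theorem cdet_mult:
  assumes M: "\<And>i j. i < k \<Longrightarrow> j < k \<Longrightarrow> M i j \<in> carrier R"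
    and N: "\<And>i j. i < k \<Longrightarrow> j < k \<Longrightarrow> N i j \<in> carrier R"
  shows "cdet R k (\<lambda>i l. \<Oplus>j\<in>{..<k}. M i j \<otimes> N j l) = cdet R k M \<otimes> cdet R k N"
proof -
  let ?P = "{p. p permutes {..<k}}" and ?F = "{..<k} \<rightarrow>\<^sub>E {..<k}"
  define m where "m f = (\<Otimes>i\<in>{..<k}. M i (f i))" for f
  define g where "g f p = (\<Otimes>i\<in>{..<k}. N (f i) (p i))" for f p
  have finF: "finite ?F" by (simp add: finite_PiE)
  have mc: "m f \<in> carrier R" if "f \<in> {..<k} \<rightarrow> {..<k}" for f
    unfolding m_def using M that by (intro finprod_closed) auto
  have gc: "g f p \<in> carrier R" if "f \<in> {..<k} \<rightarrow> {..<k}" "p \<in> {..<k} \<rightarrow> {..<k}" for f p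
    unfolding g_def using N that by (intro finprod_closed) auto
  have pk: "p i < k" if "p \<in> ?P" "i < k" for p i using that permutes_in_image[of p "{..<k}"] by simp
  have pF: "p \<in> {..<k} \<rightarrow> {..<k}" if "p \<in> ?P" for p using pk[OF that] by auto
  have rF: "restrict p {..<k} \<in> {..<k} \<rightarrow>\<^sub>E {..<k}" if "p \<in> ?P" for p using pk[OF that] by auto
  have FF: "f \<in> {..<k} \<rightarrow> {..<k}" if "f \<in> ?F" for f using that by auto
  have dc: "cdet R k (\<lambda>i j. N (f i) j) \<in> carrier R" if "f \<in> {..<k} \<rightarrow> {..<k}" for f
    using that N by (intro cdet_closed) auto
  have "cdet R k (\<lambda>i l. \<Oplus>j\<in>{..<k}. M i j \<otimes> N j l) = (\<Oplus>p\<in>?P. \<Oplus>f\<in>?F. m f \<otimes> (perm_sign R p \<otimes> g f p))"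
    unfolding cdet_def
  proof (rule finsum_cong', rule refl)
    fix p assume p: "p \<in> ?P"
    have "(\<Otimes>i\<in>{..<k}. \<Oplus>j\<in>{..<k}. M i j \<otimes> N j (p i)) = (\<Oplus>f\<in>?F. \<Otimes>i\<in>{..<k}. M i (f i) \<otimes> N (f i) (p i))"
      using M N pk[OF p] by (intro prod_of_sums) auto
    also have "\<dots> = (\<Oplus>f\<in>?F. m f \<otimes> g f p)"
      unfolding m_def g_def using M N pk[OF p]
      by (intro finsum_cong') (auto simp: finprod_multf Pi_def PiE_iff intro!: finprod_closed)
    finally have "perm_sign R p \<otimes> (\<Otimes>i\<in>{..<k}. \<Oplus>j\<in>{..<k}. M i j \<otimes> N j (p i))
       = (\<Oplus>f\<in>?F. perm_sign R p \<otimes> (m f \<otimes> g f p))"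
      using finF mc[OF FF] gc[OF FF pF[OF p]] by (simp add: finsum_rdistr Pi_def)
    also have "\<dots> = (\<Oplus>f\<in>?F. m f \<otimes> (perm_sign R p \<otimes> g f p))"
      using mc[OF FF] gc[OF FF pF[OF p]] by (intro finsum_cong') (auto simp: m_lcomm)
    finally show "perm_sign R p \<otimes> (\<Otimes>i\<in>{..<k}. \<Oplus>j\<in>{..<k}. M i j \<otimes> N j (p i)) = \<dots>" .
  qed (use mc[OF FF] gc[OF FF pF] in \<open>auto intro!: finsum_closed\<close>)
  also have "\<dots> = (\<Oplus>f\<in>?F. \<Oplus>p\<in>?P. m f \<otimes> (perm_sign R p \<otimes> g f p))"
    using mc[OF FF] gc[OF FF pF] finF by (intro finsum_swap) auto
  also have "\<dots> = (\<Oplus>f\<in>?F. m f \<otimes> cdet R k (\<lambda>i j. N (f i) j))"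
    using mc[OF FF] gc[OF FF pF] dc[OF FF] unfolding cdet_def g_def[symmetric]
    by (intro finsum_cong') (auto simp: finsum_rdistr Pi_def)
  \<comment> \<open>Elements of \<open>?F\<close> are \<open>undefined\<close> outside
    \<open>{..<k}\<close> while permutations are the identity there; \<open>restrict\<close>
    translates between the two conventions.\<close>
  also have "\<dots> = (\<Oplus>f\<in>(\<lambda>p. restrict p {..<k}) ` ?P. m f \<otimes> cdet R k (\<lambda>i j. N (f i) j))"
  proof (rule add.finprod_mono_neutral_cong_right[OF finF])
    show "(\<lambda>p. restrict p {..<k}) ` ?P \<subseteq> ?F" using rF by blast
    show "m f \<otimes> cdet R k (\<lambda>i j. N (f i) j) = \<zero>" if "f \<in> ?F - (\<lambda>p. restrict p {..<k}) ` ?P" for f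
    proof -
      have f: "f \<in> ?F" using that by auto
      have "\<not> inj_on f {..<k}"
      proof
        assume inj: "inj_on f {..<k}"
        have "f ` {..<k} = {..<k}" using f inj by (intro endo_inj_surj) auto
        then have "bij_betw f {..<k} {..<k}" using inj by (simp add: bij_betw_def)
        then have "bij_betw (\<lambda>i. if i < k then f i else i) {..<k} {..<k}"
          by (subst bij_betw_cong[where g = f]) auto
        then have "(\<lambda>i. if i < k then f i else i) permutes {..<k}"
          by (rule bij_imp_permutes) auto
        moreover have "f = restrict (\<lambda>i. if i < k then f i else i) {..<k}"
          using f by (auto simp: PiE_iff extensional_def fun_eq_iff)
        ultimately show False using that by blast
      qed
      then obtain a b where "a < k" "b < k" "a \<noteq> b" "f a = f b" by (auto simp: inj_on_def)
      then have "cdet R k (\<lambda>i j. N (f i) j) = \<zero>" using FF[OF f] N by (intro cdet_rows_inj[of k N f a b]) auto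
      then show ?thesis using mc[OF FF[OF f]] by simp
    qed
  qed (use mc[OF FF] dc[OF FF] in auto)
  also have "\<dots> = (\<Oplus>p\<in>?P. m (restrict p {..<k}) \<otimes> cdet R k (\<lambda>i j. N (restrict p {..<k} i) j))"
  proof (rule finsum_reindex)
    have "p = q" if "p permutes {..<k}" "q permutes {..<k}" "restrict p {..<k} = restrict q {..<k}" for p q
      using that by (metis permutes_not_in restrict_apply' ext)
    then show "inj_on (\<lambda>p. restrict p {..<k}) ?P" by (auto simp: inj_on_def)
    show "(\<lambda>f. m f \<otimes> cdet R k (\<lambda>i. N (f i))) \<in> (\<lambda>p. restrict p {..<k}) ` ?P \<rightarrow> carrier R"
      using mc[OF FF[OF rF]] dc[OF FF[OF rF]] by (blast intro: m_closed)
  qed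
  also have "\<dots> = (\<Oplus>p\<in>?P. (perm_sign R p \<otimes> m p) \<otimes> cdet R k N)"
  proof (rule finsum_cong', rule refl)
    fix p assume p: "p \<in> ?P"
    have "m (restrict p {..<k}) = m p"
      unfolding m_def using M pF[OF p] by (intro finprod_cong') auto
    moreover have "cdet R k (\<lambda>i j. N (restrict p {..<k} i) j) = cdet R k (\<lambda>i j. N (p i) j)"
      using N pF[OF p] by (intro cdet_cong) auto
    moreover have "cdet R k (\<lambda>i j. N (p i) j) = perm_sign R p \<otimes> cdet R k N"
      using N p by (intro cdet_rows_perm) auto
    ultimately show "m (restrict p {..<k}) \<otimes> cdet R k (\<lambda>i j. N (restrict p {..<k} i) j)
       = (perm_sign R p \<otimes> m p) \<otimes> cdet R k N"
      using mc[OF pF[OF p]] cdet_closed[OF N] by (simp add: m_ac)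
  qed (use mc[OF pF] cdet_closed[OF N] in auto)
  also have "\<dots> = cdet R k M \<otimes> cdet R k N"
    using mc[OF pF] cdet_closed[OF N] by (subst finsum_ldistr[symmetric]) (auto simp: cdet_def m_def)
  finally show ?thesis .
qed

lemma pcong_finsum:
  assumes "finite A" and fg: "\<And>a. a \<in> A \<Longrightarrow> pcong R p N (f a) (g a)"
  shows "pcong R p N (finsum R f A) (finsum R g A)"
proof -
  have "f a \<in> carrier R" "g a \<in> carrier R" if "a \<in> A" for a
    using pcong_closed[OF fg[OF that]] by auto
  with assms show ?thesis
    by (induction A) (simp_all add: Pi_def pcong_add)
qed

lemma pcong_prod_one_plus:
  assumes "finite A" "\<And>a. a \<in> A \<Longrightarrow> b a \<in> carrier R"
  shows "pcong R p (N + N) (\<Otimes>a\<in>A. \<one> \<oplus> [(p ^ N)] \<cdot> b a) (\<one> \<oplus> [(p ^ N)] \<cdot> (\<Oplus>a\<in>A. b a))"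
  using assms
proof (induction A)
  case (insert x A)
  have cl: "b x \<in> carrier R" "(\<Oplus>a\<in>A. b a) \<in> carrier R" using insert.prems by (auto intro!: finsum_closed)
  have "pcong R p (N + N) ((\<one> \<oplus> [(p ^ N)] \<cdot> b x) \<otimes> (\<Otimes>a\<in>A. \<one> \<oplus> [(p ^ N)] \<cdot> b a))
      ((\<one> \<oplus> [(p ^ N)] \<cdot> b x) \<otimes> (\<one> \<oplus> [(p ^ N)] \<cdot> (\<Oplus>a\<in>A. b a)))"
    using insert cl by (intro pcong_lmult) auto
  also have "(\<one> \<oplus> [(p ^ N)] \<cdot> b x) \<otimes> (\<one> \<oplus> [(p ^ N)] \<cdot> (\<Oplus>a\<in>A. b a))
      = (\<one> \<oplus> [(p ^ N)] \<cdot> (b x \<oplus> (\<Oplus>a\<in>A. b a))) \<oplus> [(p ^ (N + N))] \<cdot> (b x \<otimes> (\<Oplus>a\<in>A. b a))"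
    using cl by (simp add: l_distr r_distr add_pow_ldistr add_pow_rdistr add.nat_pow_distrib
        add.nat_pow_pow power_add a_ac)
  also have "pcong R p (N + N) \<dots> (\<one> \<oplus> [(p ^ N)] \<cdot> (b x \<oplus> (\<Oplus>a\<in>A. b a)))"
    using cl by (intro pcong_add_pow) auto
  finally show ?case using insert by (simp add: Pi_def)
qed simp

text \<open>Off the diagonal every entry is a multiple of p^N, and a permutation other than the
  identity moves at least two points, so modulo p^(2N) only the product of the diagonal entries
  remains.\<close>

theorem pcong_cdet_one_plus:
  assumes B: "\<And>i j. i < k \<Longrightarrow> j < k \<Longrightarrow> B i j \<in> carrier R"
  shows "pcong R p (N + N) (cdet R k (\<lambda>i j. (if i = j then \<one> else \<zero>) \<oplus> [(p ^ N)] \<cdot> B i j))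
           (\<one> \<oplus> [(p ^ N)] \<cdot> (\<Oplus>i\<in>{..<k}. B i i))"
proof -
  let ?M = "\<lambda>i j. (if i = j then \<one> else \<zero>) \<oplus> [(p ^ N)] \<cdot> B i j"
  let ?r = "\<one> \<oplus> [(p ^ N)] \<cdot> (\<Oplus>i\<in>{..<k}. B i i)"
  have rc: "?r \<in> carrier R" using B by (auto intro!: finsum_closed)
  have Mc: "?M i j \<in> carrier R" if "i < k" "j < k" for i j using B[OF that] by auto
  have "pcong R p (N + N) (perm_sign R q \<otimes> (\<Otimes>i\<in>{..<k}. ?M i (q i))) (if q = id then ?r else \<zero>)"
    if q: "q permutes {..<k}" for q
  proof (cases "q = id")
    case True
    then show ?thesis using pcong_prod_one_plus[of "{..<k}" "\<lambda>i. B i i"] B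
      by (simp add: perm_sign_def finprod_closed Pi_def)
  next
    case False
    then obtain a where a: "q a \<noteq> a" by (auto simp: fun_eq_iff)
    define b where "b = q a"
    have ak: "a < k" using a permutes_not_in[OF q] by force
    have bk: "b < k" using ak permutes_in_image[OF q] by (auto simp: b_def)
    \<comment> \<open>The second moved point is b = q a: by injectivity of q, q b = b would give q a
      = a.\<close>
    have qb: "q b \<noteq> b" using a permutes_inj[OF q] by (auto simp: b_def dest: injD)
    have qk: "q i < k" if "i < k" for i using that permutes_in_image[OF q] by auto
    define F where "F i = ?M i (q i)" for i
    have Fc: "F i \<in> carrier R" if "i < k" for i unfolding F_def using Mc[OF that qk[OF that]] .
    define rest where "rest = finprod R F ({..<k} - {a, b})"
    have restc: "rest \<in> carrier R" unfolding rest_def using Fc by (intro finprod_closed) auto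
    have set: "insert a (insert b ({..<k} - {a, b})) = {..<k}" using ak bk by auto
    have "finprod R F (insert a (insert b ({..<k} - {a, b}))) = F a \<otimes> finprod R F (insert b ({..<k} - {a, b}))"
      using Fc ak bk a by (intro finprod_insert) (auto simp: b_def)
    also have "finprod R F (insert b ({..<k} - {a, b})) = F b \<otimes> rest"
      unfolding rest_def using Fc bk by (intro finprod_insert) auto
    finally have "finprod R F {..<k} = F a \<otimes> (F b \<otimes> rest)" unfolding set .
    also have "F a = [(p ^ N)] \<cdot> B a (q a)" using a B[OF ak qk[OF ak]] by (simp add: F_def)
    also have "F b = [(p ^ N)] \<cdot> B b (q b)" using qb B[OF bk qk[OF bk]] by (simp add: F_def)
    also have "[(p ^ N)] \<cdot> B a (q a) \<otimes> ([(p ^ N)] \<cdot> B b (q b) \<otimes> rest)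
        = [(p ^ (N + N))] \<cdot> (B a (q a) \<otimes> (B b (q b) \<otimes> rest))"
      using B[OF ak qk[OF ak]] B[OF bk qk[OF bk]] restc
      by (simp add: add_pow_ldistr add_pow_rdistr add.nat_pow_pow power_add)
    finally have "pcong R p (N + N) (finprod R F {..<k}) \<zero>"
      using B[OF ak qk[OF ak]] B[OF bk qk[OF bk]] restc by (simp add: pcong_scale_zero)
    from pcong_lmult[OF this, of "perm_sign R q"] show ?thesis using False by (simp add: F_def[abs_def])
  qed
  then have "pcong R p (N + N) (cdet R k ?M) (\<Oplus>q\<in>{q. q permutes {..<k}}. if q = id then ?r else \<zero>)"
    unfolding cdet_def by (intro pcong_finsum) auto
  also have "(\<Oplus>q\<in>{q. q permutes {..<k}}. if q = id then ?r else \<zero>) = ?r"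
    using rc finsum_delta[of "{q. q permutes {..<k}}" "\<lambda>_. ?r" id] by (simp add: permutes_id)
  finally show ?thesis .
qed

text \<open>The case B = 0, p = 0, N = 1 of the expansion: the modulus 0^2 is 0, so the congruence
  is an equality.\<close>

lemma cdet_one: "cdet R k (\<lambda>i j. if i = j then \<one> else \<zero>) = \<one>"
  using pcong_cdet_one_plus[of k "\<lambda>_ _. \<zero>" 0 1] 
  by (auto simp: pcong_def finsum_zero cong: if_cong)

end

lemma (in ring_hom_cring) hom_cdet:
  assumes "\<And>i j. i < k \<Longrightarrow> j < k \<Longrightarrow> M i j \<in> carrier R"
  shows "h (cdet R k M) = cdet S k (\<lambda>i j. h (M i j))"
proof -
  have cl: "(\<Otimes>\<^bsub>R\<^esub>i\<in>{..<k}. M i (p i)) \<in> carrier R" if "p permutes {..<k}" for p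
    using assms permutes_in_image[OF that] by (intro R.finprod_closed) auto
  have "h (perm_sign R p \<otimes>\<^bsub>R\<^esub> (\<Otimes>\<^bsub>R\<^esub>i\<in>{..<k}. M i (p i))) = perm_sign S p \<otimes>\<^bsub>S\<^esub> (\<Otimes>\<^bsub>S\<^esub>i\<in>{..<k}. h (M i (p i)))"
    if p: "p permutes {..<k}" for p
    using assms permutes_in_image[OF p] cl[OF p]
    by (auto simp: perm_sign_def hom_finprod Pi_def comp_def)
  moreover have "(\<Otimes>\<^bsub>S\<^esub>i\<in>{..<k}. h (M i (p i))) \<in> carrier S" if "p permutes {..<k}" for p
    using assms permutes_in_image[OF that] by (intro S.finprod_closed) auto
  ultimately show ?thesis
    unfolding cdet_def using cl by (subst hom_finsum) (auto intro!: S.finsum_cong' simp: comp_def)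
qed

section \<open>Restriction of matrices over a group ring to a commutative subgroup\<close>

lemma bij_betw_div_mod:
  fixes m d :: nat
  assumes "0 < d"
  shows "bij_betw (\<lambda>(i, s). i * d + s) ({..<m} \<times> {..<d}) {..<m * d}"
proof (rule bij_betwI[where g = "\<lambda>q. (q div d, q mod d)"])
  have "i * d + s < m * d" if "i < m" "s < d" for i s
  proof -
    have "i * d + s < (i + 1) * d" using that by simp
    also have "\<dots> \<le> m * d" using that by (intro mult_right_mono) auto
    finally show ?thesis .
  qed
  then show "(\<lambda>(i, s). i * d + s) \<in> {..<m} \<times> {..<d} \<rightarrow> {..<m * d}" by auto
qed (use assms in \<open>auto simp: less_mult_imp_div_less\<close>)

lemma (in abelian_monoid) finsum_div_mod:
  fixes m d :: nat
  assumes "0 < d" "\<And>i s. i < m \<Longrightarrow> s < d \<Longrightarrow> f i s \<in> carrier G"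
  shows "(\<Oplus>q\<in>{..<m * d}. f (q div d) (q mod d)) = (\<Oplus>i\<in>{..<m}. \<Oplus>s\<in>{..<d}. f i s)"
proof -
  have "(\<Oplus>q\<in>{..<m * d}. f (q div d) (q mod d))
      = finsum G (\<lambda>z. f ((case z of (i, s) \<Rightarrow> i * d + s) div d) ((case z of (i, s) \<Rightarrow> i * d + s) mod d)) ({..<m} \<times> {..<d})"
    using assms by (intro finsum_bij[OF bij_betw_div_mod]) (auto simp: less_mult_imp_div_less)
  also have "\<dots> = finsum G (\<lambda>(i, s). f i s) ({..<m} \<times> {..<d})"
    using assms by (intro finsum_cong') auto
  also have "\<dots> = (\<Oplus>i\<in>{..<m}. \<Oplus>s\<in>{..<d}. f i s)"
    using assms by (intro finsum_cartesian[symmetric]) auto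
  finally show ?thesis .
qed

section \<open>Left transversals and restriction of scalars\<close>

definition (in group) is_transversal :: "'a set \<Rightarrow> (nat \<Rightarrow> 'a) \<Rightarrow> nat \<Rightarrow> bool" where
  "is_transversal C t d \<longleftrightarrow> bij_betw (\<lambda>(s, c). t s \<otimes> c) ({..<d} \<times> C) (carrier G) \<and> (\<forall>s<d. t s \<in> carrier G)"

text \<open>Choose a representative r x in each left coset of C. The predicate under the choice
  operator is the same for all elements of a coset, so r is constant on cosets and idempotent, and
  any enumeration t of its image serves.\<close>

lemma (in group) transversal_exists:
  assumes C: "subgroup C G" and fin: "finite (carrier G)"
  obtains t d where "is_transversal C t d"
proof -
  interpret C: subgroup C G by fact
  define r where "r x = (SOME y. y \<in> carrier G \<and> inv x \<otimes> y \<in> C)" for x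
  have r: "r x \<in> carrier G \<and> inv x \<otimes> r x \<in> C" if "x \<in> carrier G" for x
    unfolding r_def by (rule someI[of _ x]) (use that in auto)
  have req: "r x = r x'" if "x \<in> carrier G" "x' \<in> carrier G" "inv x \<otimes> x' \<in> C" for x x'
  proof -
    have "inv x \<otimes> y \<in> C \<longleftrightarrow> inv x' \<otimes> y \<in> C" if y: "y \<in> carrier G" for y
    proof -
      have a: "inv x \<otimes> y = (inv x \<otimes> x') \<otimes> (inv x' \<otimes> y)"
      proof -
        have "(inv x \<otimes> x') \<otimes> (inv x' \<otimes> y) = inv x \<otimes> (x' \<otimes> inv x') \<otimes> y"
          using that \<open>x \<in> carrier G\<close> \<open>x' \<in> carrier G\<close> by (simp only: m_assoc m_closed inv_closed)
        then show ?thesis using y \<open>x \<in> carrier G\<close> \<open>x' \<in> carrier G\<close> by simp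
      qed
      have b: "inv x' \<otimes> y = inv (inv x \<otimes> x') \<otimes> (inv x \<otimes> y)"
        using y \<open>x \<in> carrier G\<close> \<open>x' \<in> carrier G\<close> by (simp add: a inv_solve_left)
      show ?thesis using a b \<open>inv x \<otimes> x' \<in> C\<close> by (metis C.m_closed C.m_inv_closed)
    qed
    then show ?thesis unfolding r_def by (intro arg_cong[where f = Eps]) auto
  qed
  have rr: "r (r x) = r x" if "x \<in> carrier G" for x using req[OF that] r[OF that] by metis
  have finT: "finite (r ` carrier G)" using fin by simp
  then obtain t where t: "bij_betw t {..<card (r ` carrier G)} (r ` carrier G)"
    using ex_bij_betw_nat_finite[OF finT] by (auto simp: atLeast0LessThan)
  let ?d = "card (r ` carrier G)"
  have tT: "t s \<in> r ` carrier G" if "s < ?d" for s using t that by (auto simp: bij_betw_def)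
  have tG: "t s \<in> carrier G" "r (t s) = t s" if "s < ?d" for s using tT[OF that] r rr by auto
  have "bij_betw (\<lambda>(s, c). t s \<otimes> c) ({..<?d} \<times> C) (carrier G)"
    unfolding bij_betw_def
  proof (intro conjI inj_onI subset_antisym subsetI)
    fix z z' assume z: "z \<in> {..<?d} \<times> C" "z' \<in> {..<?d} \<times> C"
      and eq: "(case z of (s, c) \<Rightarrow> t s \<otimes> c) = (case z' of (s, c) \<Rightarrow> t s \<otimes> c)"
    obtain s c s' c' where zz: "z = (s, c)" "z' = (s', c')" by (cases z, cases z')
    have cl: "s < ?d" "s' < ?d" "c \<in> C" "c' \<in> C" "c \<in> carrier G" "c' \<in> carrier G" "t s \<in> carrier G" "t s' \<in> carrier G"
      using z zz tG by auto
    have e: "t s \<otimes> c = t s' \<otimes> c'" using eq zz by simp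
    have "inv (t s) \<otimes> t s' = c \<otimes> inv c'"
    proof -
      have "t s' = t s \<otimes> c \<otimes> inv c'" using e cl by (simp add: m_assoc)
      then show ?thesis using cl by (simp add: m_assoc[symmetric])
    qed
    then have "r (t s) = r (t s')" using cl by (intro req) auto
    then have "t s = t s'" using tG cl by simp
    then have "s = s'" using t cl by (auto simp: bij_betw_def inj_on_def)
    then show "z = z'" using e cl zz by simp
  next
    fix x assume x: "x \<in> carrier G"
    have rx: "r x \<in> carrier G" "inv x \<otimes> r x \<in> C" using r[OF x] by auto
    have "r x \<in> t ` {..<?d}" using t x by (simp add: bij_betw_def)
    then obtain s where s: "s < ?d" "t s = r x" by auto
    have "inv (r x) \<otimes> x = inv (inv x \<otimes> r x)" using x rx by (simp add: inv_mult_group)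
    then have "inv (r x) \<otimes> x \<in> C" using rx by simp
    moreover have "x = t s \<otimes> (inv (r x) \<otimes> x)" using x rx s by (simp add: m_assoc[symmetric])
    ultimately show "x \<in> (\<lambda>(s, c). t s \<otimes> c) ` ({..<?d} \<times> C)" using s by force
  qed (use tG in auto)
  with tG show ?thesis using that[of t ?d] by (auto simp: is_transversal_def)
qed

abbreviation (in finite_group_ring) "MG m \<equiv> mat_ring (group_ring R G) m"

text \<open>The subgroup and the transversal are parameters, so that the same matrix of restriction
  can be formed over R and over L and compared entry by entry.\<close>

locale group_ring_restriction = cring R + finite_group_ring R G
  for R :: "('r, 'm) ring_scheme" (structure) and G :: "('g, 'k) monoid_scheme" (structure) +
  fixes C :: "'g set" and t :: "nat \<Rightarrow> 'g" and d :: nat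
  assumes C_subgroup: "subgroup C G"
    and C_comm: "\<And>x y. x \<in> C \<Longrightarrow> y \<in> C \<Longrightarrow> x \<otimes>\<^bsub>G\<^esub> y = y \<otimes>\<^bsub>G\<^esub> x"
    and transversal: "G.is_transversal C t d"
begin

abbreviation "GC \<equiv> G\<lparr>carrier := C\<rparr>"
abbreviation "RC \<equiv> group_ring R GC"

sublocale Csub: subgroup C G by (rule C_subgroup)

lemma C_group: "comm_group GC"
  using C_comm by (intro group.group_comm_groupI Csub.subgroup_is_group G.group_axioms) simp

lemma C_finite [simp, intro]: "finite C"
  using finite_subset[OF Csub.subset fin] .

sublocale C: comm_group GC by (rule C_group)

sublocale SC: finite_group_ring R GC
  by unfold_locales simp

sublocale RC: cring RC
  by (rule group_ring_cring) (auto intro: C_group cring_axioms)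

sublocale RG: ring RG by (rule group_ring_ring)

lemma t_closed [simp, intro]: "s < d \<Longrightarrow> t s \<in> carrier G"
  using transversal by (simp add: G.is_transversal_def)

lemma t_bij: "bij_betw (\<lambda>(s, c). t s \<otimes>\<^bsub>G\<^esub> c) ({..<d} \<times> C) (carrier G)"
  using transversal by (simp add: G.is_transversal_def)

lemma t_inj: "s < d \<Longrightarrow> s' < d \<Longrightarrow> c \<in> C \<Longrightarrow> c' \<in> C \<Longrightarrow> t s \<otimes>\<^bsub>G\<^esub> c = t s' \<otimes>\<^bsub>G\<^esub> c' \<Longrightarrow> s = s' \<and> c = c'"
  using t_bij by (auto simp: bij_betw_def inj_on_def)

lemma d_pos: "0 < d"
proof (rule ccontr)
  assume "\<not> 0 < d"
  then have "carrier G = {}" using t_bij by (auto simp: bij_betw_def)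
  then show False using G.one_closed by blast
qed

lemma C_carrier [simp, intro]: "c \<in> C \<Longrightarrow> c \<in> carrier G"
  using Csub.subset by auto

lemma inv_GC [simp]: "c \<in> C \<Longrightarrow> inv\<^bsub>GC\<^esub> c = inv\<^bsub>G\<^esub> c"
  using G.m_inv_consistent[OF C_subgroup] by simp

lemma RC_extensional: "f \<in> carrier RC \<Longrightarrow> f \<in> extensional C"
  by (simp add: SC.group_ring_simps(1) PiE_iff)

text \<open>The matrix of \<open>M\<close> acting by left multiplication on \<open>R[G]\<^sup>m\<close>, a free right \<open>R[C]\<close>-module
  with basis \<open>e\<^sub>i t\<^sub>s\<close>, where the basis vector \<open>e\<^sub>i t\<^sub>s\<close> has index \<open>i d + s\<close>.\<close>

definition res :: "(nat \<Rightarrow> nat \<Rightarrow> 'g \<Rightarrow> 'r) \<Rightarrow> nat \<Rightarrow> nat \<Rightarrow> 'g \<Rightarrow> 'r" where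
  "res M a b = (\<lambda>c\<in>C. M (a div d) (b div d) (t (a mod d) \<otimes>\<^bsub>G\<^esub> c \<otimes>\<^bsub>G\<^esub> inv\<^bsub>G\<^esub> t (b mod d)))"

lemma a_mod_d_less [simp, intro]: "a mod d < d" using d_pos by simp

lemma entry_closed:
  "M \<in> carrier (MG m) \<Longrightarrow> x \<in> carrier G \<Longrightarrow> M i j x \<in> carrier R"
  by (auto simp: mat_ring_simps group_ring_simps PiE_iff)

lemma res_closed: "M \<in> carrier (MG m) \<Longrightarrow> res M a b \<in> carrier RC"
  by (auto simp: res_def SC.group_ring_simps intro!: entry_closed)

text \<open>Inverting the unique factorization t s c shows that each element of G is c (t s)^-1 for
  exactly one pair; the factor y on the left only permutes G.\<close>

lemma finsum_transversal:
  assumes y: "y \<in> carrier G" and f: "\<And>x. x \<in> carrier G \<Longrightarrow> f x \<in> carrier R"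
  shows "(\<Oplus>s\<in>{..<d}. \<Oplus>c\<in>C. f (y \<otimes>\<^bsub>G\<^esub> c \<otimes>\<^bsub>G\<^esub> inv\<^bsub>G\<^esub> t s)) = (\<Oplus>x\<in>carrier G. f x)"
proof -
  have b1: "bij_betw (\<lambda>(s, c). (s, inv\<^bsub>G\<^esub> c)) ({..<d} \<times> C) ({..<d} \<times> C)"
    by (rule bij_betwI[where g = "\<lambda>(s, c). (s, inv\<^bsub>G\<^esub> c)"]) auto
  have b2: "bij_betw (\<lambda>x. y \<otimes>\<^bsub>G\<^esub> inv\<^bsub>G\<^esub> x) (carrier G) (carrier G)"
    by (rule bij_betwI[where g = "\<lambda>x. inv\<^bsub>G\<^esub> x \<otimes>\<^bsub>G\<^esub> y"])
       (use y in \<open>auto simp: G.inv_mult_group G.m_assoc\<close>, simp add: G.m_assoc[symmetric])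
  have "bij_betw ((\<lambda>x. y \<otimes>\<^bsub>G\<^esub> inv\<^bsub>G\<^esub> x) \<circ> ((\<lambda>(s, c). t s \<otimes>\<^bsub>G\<^esub> c) \<circ> (\<lambda>(s, c). (s, inv\<^bsub>G\<^esub> c)))) ({..<d} \<times> C) (carrier G)"
    by (intro bij_betw_trans[OF bij_betw_trans[OF b1 t_bij] b2])
  then have bij: "bij_betw (\<lambda>(s, c). y \<otimes>\<^bsub>G\<^esub> c \<otimes>\<^bsub>G\<^esub> inv\<^bsub>G\<^esub> t s) ({..<d} \<times> C) (carrier G)"
    by (rule bij_betw_cong[THEN iffD1, rotated]) (use y in \<open>auto simp: G.inv_mult_group G.m_assoc\<close>)
  have "(\<Oplus>x\<in>carrier G. f x) = finsum R (\<lambda>z. f (case z of (s, c) \<Rightarrow> y \<otimes>\<^bsub>G\<^esub> c \<otimes>\<^bsub>G\<^esub> inv\<^bsub>G\<^esub> t s)) ({..<d} \<times> C)"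
    using f by (intro finsum_bij[OF bij])
  also have "\<dots> = finsum R (\<lambda>(s, c). f (y \<otimes>\<^bsub>G\<^esub> c \<otimes>\<^bsub>G\<^esub> inv\<^bsub>G\<^esub> t s)) ({..<d} \<times> C)"
    using f y by (intro finsum_cong') auto
  also have "\<dots> = (\<Oplus>s\<in>{..<d}. \<Oplus>c\<in>C. f (y \<otimes>\<^bsub>G\<^esub> c \<otimes>\<^bsub>G\<^esub> inv\<^bsub>G\<^esub> t s))"
    using f y by (intro finsum_cartesian[symmetric]) auto
  finally show ?thesis ..
qed

lemma mat_mult_apply:
  assumes "M \<in> carrier (MG m)" "N \<in> carrier (MG m)" "y \<in> carrier G"
  shows "(M \<otimes>\<^bsub>MG m\<^esub> N) i k y
     = (\<Oplus>j\<in>{..<m}. \<Oplus>x\<in>carrier G. M i j x \<otimes> N j k (inv\<^bsub>G\<^esub> x \<otimes>\<^bsub>G\<^esub> y))"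
proof -
  have cl: "M i j \<in> carrier RG" "N i j \<in> carrier RG" for i j using assms by (auto simp: mat_ring_simps)
  then have "(M \<otimes>\<^bsub>MG m\<^esub> N) i k y = (\<Oplus>j\<in>{..<m}. (M i j \<otimes>\<^bsub>RG\<^esub> N j k) y)"
    unfolding mat_ring_simps using assms(3) by (intro finsum_group_ring) auto
  then show ?thesis using assms(3) by (simp add: group_ring_simps(2))
qed

text \<open>Summing over a block index j, a coset index s and an element h of C amounts to summing
  over j and u = x h (t s)^-1 in G, which is the convolution in the entry of the product over
  R[G].\<close>

lemma res_mult:
  assumes M: "M \<in> carrier (MG m)" and N: "N \<in> carrier (MG m)"
  shows "res (M \<otimes>\<^bsub>MG m\<^esub> N) a b = (\<Oplus>\<^bsub>RC\<^esub>q\<in>{..<m * d}. res M a q \<otimes>\<^bsub>RC\<^esub> res N q b)"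
proof (rule extensionalityI[of _ C])
  show "res (M \<otimes>\<^bsub>MG m\<^esub> N) a b \<in> extensional C" by (simp add: res_def)
  have cl: "(\<Oplus>\<^bsub>RC\<^esub>q\<in>{..<m * d}. res M a q \<otimes>\<^bsub>RC\<^esub> res N q b) \<in> carrier RC"
    using res_closed[OF M] res_closed[OF N] by (intro RC.finsum_closed) auto
  then show "(\<Oplus>\<^bsub>RC\<^esub>q\<in>{..<m * d}. res M a q \<otimes>\<^bsub>RC\<^esub> res N q b) \<in> extensional C"
    by (rule RC_extensional)
  fix c assume c: "c \<in> C"
  define i where "i = a div d"
  define k where "k = b div d"
  define x where "x = t (a mod d)"
  define y where "y = t (b mod d)"
  have xy [simp, intro]: "x \<in> carrier G" "y \<in> carrier G" by (simp_all add: x_def y_def)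
  let ?z = "x \<otimes>\<^bsub>G\<^esub> c \<otimes>\<^bsub>G\<^esub> inv\<^bsub>G\<^esub> y"
  have Mc: "M i j u \<in> carrier R" "N i j u \<in> carrier R" if "u \<in> carrier G" for i j u
    using that M N entry_closed by auto
  have "(\<Oplus>\<^bsub>RC\<^esub>q\<in>{..<m * d}. res M a q \<otimes>\<^bsub>RC\<^esub> res N q b) c = (\<Oplus>q\<in>{..<m * d}. (res M a q \<otimes>\<^bsub>RC\<^esub> res N q b) c)"
    using res_closed[OF M] res_closed[OF N] c by (intro SC.finsum_group_ring) auto
  also have "\<dots> = (\<Oplus>q\<in>{..<m * d}. \<Oplus>h\<in>C. M i (q div d) (x \<otimes>\<^bsub>G\<^esub> h \<otimes>\<^bsub>G\<^esub> inv\<^bsub>G\<^esub> t (q mod d)) \<otimes>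
       N (q div d) k (inv\<^bsub>G\<^esub> (x \<otimes>\<^bsub>G\<^esub> h \<otimes>\<^bsub>G\<^esub> inv\<^bsub>G\<^esub> t (q mod d)) \<otimes>\<^bsub>G\<^esub> ?z))"
  proof (rule finsum_cong', rule refl)
    fix q assume "q \<in> {..<m * d}"
    \<comment> \<open>The second argument is u^-1 times \<open>?z\<close> for the u of the first
      argument, so each summand is already a summand of the convolution at
      \<open>?z\<close>.\<close>
    have "inv\<^bsub>G\<^esub> (x \<otimes>\<^bsub>G\<^esub> h \<otimes>\<^bsub>G\<^esub> inv\<^bsub>G\<^esub> t (q mod d)) \<otimes>\<^bsub>G\<^esub> ?z = t (q mod d) \<otimes>\<^bsub>G\<^esub> (inv\<^bsub>G\<^esub> h \<otimes>\<^bsub>G\<^esub> c) \<otimes>\<^bsub>G\<^esub> inv\<^bsub>G\<^esub> y"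
      if h: "h \<in> C" for h
    proof -
      have "inv\<^bsub>G\<^esub> (x \<otimes>\<^bsub>G\<^esub> h \<otimes>\<^bsub>G\<^esub> inv\<^bsub>G\<^esub> t (q mod d)) \<otimes>\<^bsub>G\<^esub> ?z
        = t (q mod d) \<otimes>\<^bsub>G\<^esub> inv\<^bsub>G\<^esub> h \<otimes>\<^bsub>G\<^esub> (inv\<^bsub>G\<^esub> x \<otimes>\<^bsub>G\<^esub> x) \<otimes>\<^bsub>G\<^esub> c \<otimes>\<^bsub>G\<^esub> inv\<^bsub>G\<^esub> y"
        using h c by (simp only: G.inv_mult_group G.inv_inv G.m_assoc G.m_closed G.inv_closed C_carrier t_closed a_mod_d_less xy)
      then show ?thesis using h c by (simp add: G.m_assoc)
    qed
    then show "(res M a q \<otimes>\<^bsub>RC\<^esub> res N q b) c = (\<Oplus>h\<in>C. M i (q div d) (x \<otimes>\<^bsub>G\<^esub> h \<otimes>\<^bsub>G\<^esub> inv\<^bsub>G\<^esub> t (q mod d)) \<otimes>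
       N (q div d) k (inv\<^bsub>G\<^esub> (x \<otimes>\<^bsub>G\<^esub> h \<otimes>\<^bsub>G\<^esub> inv\<^bsub>G\<^esub> t (q mod d)) \<otimes>\<^bsub>G\<^esub> ?z))"
      using c Mc unfolding SC.group_ring_simps
      by (auto simp: res_def i_def[symmetric] k_def[symmetric] x_def[symmetric] y_def[symmetric] intro!: finsum_cong')
  qed (use c Mc in \<open>auto intro!: finsum_closed\<close>)
  also have "\<dots> = (\<Oplus>j\<in>{..<m}. \<Oplus>s\<in>{..<d}. \<Oplus>h\<in>C. M i j (x \<otimes>\<^bsub>G\<^esub> h \<otimes>\<^bsub>G\<^esub> inv\<^bsub>G\<^esub> t s) \<otimes>
       N j k (inv\<^bsub>G\<^esub> (x \<otimes>\<^bsub>G\<^esub> h \<otimes>\<^bsub>G\<^esub> inv\<^bsub>G\<^esub> t s) \<otimes>\<^bsub>G\<^esub> ?z))"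
    using c Mc d_pos
    by (intro finsum_div_mod[where f = "\<lambda>j s. \<Oplus>h\<in>C. M i j (x \<otimes>\<^bsub>G\<^esub> h \<otimes>\<^bsub>G\<^esub> inv\<^bsub>G\<^esub> t s) \<otimes>
       N j k (inv\<^bsub>G\<^esub> (x \<otimes>\<^bsub>G\<^esub> h \<otimes>\<^bsub>G\<^esub> inv\<^bsub>G\<^esub> t s) \<otimes>\<^bsub>G\<^esub> ?z)"]) (auto intro!: finsum_closed)
  also have "\<dots> = (\<Oplus>j\<in>{..<m}. \<Oplus>u\<in>carrier G. M i j u \<otimes> N j k (inv\<^bsub>G\<^esub> u \<otimes>\<^bsub>G\<^esub> ?z))"
  proof (rule finsum_cong', rule refl)
    fix j assume "j \<in> {..<m}"
    show "(\<Oplus>s\<in>{..<d}. \<Oplus>h\<in>C. M i j (x \<otimes>\<^bsub>G\<^esub> h \<otimes>\<^bsub>G\<^esub> inv\<^bsub>G\<^esub> t s) \<otimes>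
       N j k (inv\<^bsub>G\<^esub> (x \<otimes>\<^bsub>G\<^esub> h \<otimes>\<^bsub>G\<^esub> inv\<^bsub>G\<^esub> t s) \<otimes>\<^bsub>G\<^esub> ?z)) = (\<Oplus>u\<in>carrier G. M i j u \<otimes> N j k (inv\<^bsub>G\<^esub> u \<otimes>\<^bsub>G\<^esub> ?z))"
      using c Mc by (intro finsum_transversal) auto
  qed (use c Mc in \<open>auto intro!: finsum_closed\<close>)
  also have "\<dots> = (M \<otimes>\<^bsub>MG m\<^esub> N) i k ?z"
    using c M N by (intro mat_mult_apply[symmetric]) auto
  also have "\<dots> = res (M \<otimes>\<^bsub>MG m\<^esub> N) a b c"
    using c by (simp add: res_def i_def k_def x_def y_def)
  finally show "res (M \<otimes>\<^bsub>MG m\<^esub> N) a b c = (\<Oplus>\<^bsub>RC\<^esub>q\<in>{..<m * d}. res M a q \<otimes>\<^bsub>RC\<^esub> res N q b) c" ..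
qed

text \<open>On units this is the transfer from K_1(R[G]) to K_1(R[C]) followed by the
  determinant.\<close>

definition res_det :: "nat \<Rightarrow> (nat \<Rightarrow> nat \<Rightarrow> 'g \<Rightarrow> 'r) \<Rightarrow> 'g \<Rightarrow> 'r" where
  "res_det m M = cdet RC (m * d) (res M)"

lemma res_det_closed: "M \<in> carrier (MG m) \<Longrightarrow> res_det m M \<in> carrier RC"
  unfolding res_det_def by (intro RC.cdet_closed res_closed)

lemma res_det_mult:
  assumes "M \<in> carrier (MG m)" "N \<in> carrier (MG m)"
  shows "res_det m (M \<otimes>\<^bsub>MG m\<^esub> N) = res_det m M \<otimes>\<^bsub>RC\<^esub> res_det m N"
proof -
  have "res (M \<otimes>\<^bsub>MG m\<^esub> N) = (\<lambda>a b. \<Oplus>\<^bsub>RC\<^esub>q\<in>{..<m * d}. res M a q \<otimes>\<^bsub>RC\<^esub> res N q b)"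
    by (rule ext, rule ext, rule res_mult[OF assms])
  then show ?thesis unfolding res_det_def
    using RC.cdet_mult[of "m * d" "res M" "res N"] res_closed[OF assms(1)] res_closed[OF assms(2)] by simp
qed

lemma res_one:
  assumes "a < m * d" "b < m * d"
  shows "res \<one>\<^bsub>MG m\<^esub> a b = (if a = b then \<one>\<^bsub>RC\<^esub> else \<zero>\<^bsub>RC\<^esub>)"
proof -
  have ab: "a div d < m" using assms by (simp add: less_mult_imp_div_less)
  \<comment> \<open>Uniqueness in the transversal: t s c = t s' 1 forces s = s' and c = 1.\<close>
  have "t (a mod d) \<otimes>\<^bsub>G\<^esub> c \<otimes>\<^bsub>G\<^esub> inv\<^bsub>G\<^esub> t (b mod d) = \<one>\<^bsub>G\<^esub> \<longleftrightarrow> a mod d = b mod d \<and> c = \<one>\<^bsub>G\<^esub>" if c: "c \<in> C" for c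
  proof
    assume "t (a mod d) \<otimes>\<^bsub>G\<^esub> c \<otimes>\<^bsub>G\<^esub> inv\<^bsub>G\<^esub> t (b mod d) = \<one>\<^bsub>G\<^esub>"
    then have "t (a mod d) \<otimes>\<^bsub>G\<^esub> c = t (b mod d) \<otimes>\<^bsub>G\<^esub> \<one>\<^bsub>G\<^esub>"
      using c by (simp add: G.inv_solve_right')
    then show "a mod d = b mod d \<and> c = \<one>\<^bsub>G\<^esub>" using c by (intro t_inj) auto
  qed auto
  moreover have "a = b \<longleftrightarrow> a div d = b div d \<and> a mod d = b mod d"
    by (metis div_mult_mod_eq)
  ultimately show ?thesis using ab
    by (auto simp: res_def mat_ring_simps group_ring_simps SC.group_ring_simps fun_eq_iff restrict_def)
qed

lemma res_det_one: "res_det m \<one>\<^bsub>MG m\<^esub> = \<one>\<^bsub>RC\<^esub>"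
proof -
  have "res_det m \<one>\<^bsub>MG m\<^esub> = cdet RC (m * d) (\<lambda>a b. if a = b then \<one>\<^bsub>RC\<^esub> else \<zero>\<^bsub>RC\<^esub>)"
    unfolding res_det_def by (intro RC.cdet_cong res_one) auto
  then show ?thesis by (simp add: RC.cdet_one)
qed

lemma res_one_plus:
  assumes B: "B \<in> carrier (MG m)" and ab: "a < m * d" "b < m * d"
  shows "res (\<one>\<^bsub>MG m\<^esub> \<oplus>\<^bsub>MG m\<^esub> add_pow (MG m) (k::nat) B) a b
     = (if a = b then \<one>\<^bsub>RC\<^esub> else \<zero>\<^bsub>RC\<^esub>) \<oplus>\<^bsub>RC\<^esub> add_pow RC k (res B a b)"
proof -
  interpret M: ring "MG m" by (rule RG.mat_ring_ring)
  have add: "res (U \<oplus>\<^bsub>MG m\<^esub> V) a b = res U a b \<oplus>\<^bsub>RC\<^esub> res V a b"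
    for U V :: "nat \<Rightarrow> nat \<Rightarrow> 'g \<Rightarrow> 'r"
    by (auto simp: res_def mat_ring_simps group_ring_simps SC.group_ring_simps fun_eq_iff)
  have "res (add_pow (MG m) k B) a b = add_pow RC k (res B a b)"
  proof (induction k)
    case 0
    show ?case by (auto simp: res_def mat_ring_simps group_ring_simps SC.group_ring_simps fun_eq_iff restrict_def)
  next
    case (Suc k)
    then show ?case by (simp add: add)
  qed
  then show ?thesis by (simp add: add res_one[OF ab])
qed

text \<open>The expansion of the determinant reads 1 = 1 + p^N tr + p^(2N) x over R[C]. Absence of
  torsion permits cancelling p^N, so tr = -p^N x at g. Summing over all y in G, instead of over
  coset representatives, gives |C| times the trace coefficient and an expression that no longer
  depends on the transversal.\<close>

theorem res_trace_dvd:
  fixes p N :: nat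
  assumes tf: "\<And>k r. 0 < k \<Longrightarrow> r \<in> carrier R \<Longrightarrow> [(k::nat)] \<cdot> r = \<zero> \<Longrightarrow> r = \<zero>"
    and p: "0 < p" and B: "B \<in> carrier (MG m)"
    and det: "res_det m (\<one>\<^bsub>MG m\<^esub> \<oplus>\<^bsub>MG m\<^esub> add_pow (MG m) (p ^ N) B) = \<one>\<^bsub>RC\<^esub>"
    and g: "g \<in> C"
  shows "\<exists>r\<in>carrier R. (\<Oplus>i\<in>{..<m}. \<Oplus>y\<in>carrier G. B i i (y \<otimes>\<^bsub>G\<^esub> g \<otimes>\<^bsub>G\<^esub> inv\<^bsub>G\<^esub> y)) = [(p ^ N)] \<cdot> r"
proof -
  define tr where "tr = (\<Oplus>\<^bsub>RC\<^esub>a\<in>{..<m * d}. res B a a)"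
  have trc: "tr \<in> carrier RC" unfolding tr_def using res_closed[OF B] by (intro RC.finsum_closed) auto
  have "res_det m (\<one>\<^bsub>MG m\<^esub> \<oplus>\<^bsub>MG m\<^esub> add_pow (MG m) (p ^ N) B)
      = cdet RC (m * d) (\<lambda>a b. (if a = b then \<one>\<^bsub>RC\<^esub> else \<zero>\<^bsub>RC\<^esub>) \<oplus>\<^bsub>RC\<^esub> add_pow RC (p ^ N) (res B a b))"
    unfolding res_det_def using res_closed[OF B] by (intro RC.cdet_cong) (simp_all add: res_one_plus[OF B])
  with det RC.pcong_cdet_one_plus[of "m * d" "res B" p N] res_closed[OF B]
  have "pcong RC p (N + N) \<one>\<^bsub>RC\<^esub> (\<one>\<^bsub>RC\<^esub> \<oplus>\<^bsub>RC\<^esub> add_pow RC (p ^ N) tr)" by (simp add: tr_def)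
  then obtain x where x: "x \<in> carrier RC"
    "\<one>\<^bsub>RC\<^esub> = \<one>\<^bsub>RC\<^esub> \<oplus>\<^bsub>RC\<^esub> add_pow RC (p ^ N) tr \<oplus>\<^bsub>RC\<^esub> add_pow RC (p ^ (N + N)) x"
    by (auto simp: pcong_def)
  define w where "w = tr \<oplus>\<^bsub>RC\<^esub> add_pow RC (p ^ N) x"
  have wc: "w \<in> carrier RC" using trc x by (simp add: w_def)
  have w1: "\<one>\<^bsub>RC\<^esub> \<oplus>\<^bsub>RC\<^esub> add_pow RC (p ^ N) w = \<one>\<^bsub>RC\<^esub>"
    using x(1) trc unfolding w_def
    by (subst (2) x(2)) (simp add: RC.add.nat_pow_distrib RC.add.nat_pow_pow power_add RC.a_assoc)
  have "add_pow RC (p ^ N) w = \<ominus>\<^bsub>RC\<^esub> \<one>\<^bsub>RC\<^esub> \<oplus>\<^bsub>RC\<^esub> (\<one>\<^bsub>RC\<^esub> \<oplus>\<^bsub>RC\<^esub> add_pow RC (p ^ N) w)"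
    using wc by (simp add: RC.r_neg1)
  then have "add_pow RC (p ^ N) w = \<zero>\<^bsub>RC\<^esub>" unfolding w1 by (simp add: RC.l_neg)
  then have "[(p ^ N)] \<cdot> w g = \<zero>"
    using SC.add_pow_group_ring[OF wc, of g "p ^ N"] g by (simp add: SC.group_ring_simps)
  moreover have wg: "w g \<in> carrier R" "tr g \<in> carrier R" "x g \<in> carrier R"
    using wc trc x(1) g by (auto simp: SC.group_ring_simps PiE_iff)
  ultimately have "w g = \<zero>" using tf[of "p ^ N" "w g"] p by simp
  then have w0: "tr g \<oplus> [(p ^ N)] \<cdot> x g = \<zero>"
    using g x(1) SC.add_pow_group_ring[OF x(1), of g "p ^ N"] by (simp add: w_def SC.group_ring_simps(5))
  then have trg: "tr g = [(p ^ N)] \<cdot> (\<ominus> x g)"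
    using wg minus_equality[OF w0] by (simp add: add.nat_pow_inv)
  have Bc: "B i j u \<in> carrier R" if "u \<in> carrier G" for i j u using that B entry_closed by auto
  have gG: "g \<in> carrier G" using g by auto
  have "tr g = (\<Oplus>a\<in>{..<m * d}. res B a a g)"
    unfolding tr_def using res_closed[OF B] g by (intro SC.finsum_group_ring) auto
  also have "\<dots> = (\<Oplus>a\<in>{..<m * d}. B (a div d) (a div d) (t (a mod d) \<otimes>\<^bsub>G\<^esub> g \<otimes>\<^bsub>G\<^esub> inv\<^bsub>G\<^esub> t (a mod d)))"
    using g by (simp add: res_def)
  also have "\<dots> = (\<Oplus>i\<in>{..<m}. \<Oplus>s\<in>{..<d}. B i i (t s \<otimes>\<^bsub>G\<^esub> g \<otimes>\<^bsub>G\<^esub> inv\<^bsub>G\<^esub> t s))"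
    using Bc gG d_pos by (intro finsum_div_mod[where f = "\<lambda>i s. B i i (t s \<otimes>\<^bsub>G\<^esub> g \<otimes>\<^bsub>G\<^esub> inv\<^bsub>G\<^esub> t s)"]) auto
  finally have trg': "tr g = (\<Oplus>i\<in>{..<m}. \<Oplus>s\<in>{..<d}. B i i (t s \<otimes>\<^bsub>G\<^esub> g \<otimes>\<^bsub>G\<^esub> inv\<^bsub>G\<^esub> t s))" .
  \<comment> \<open>As C is commutative and contains g, conjugating g by t s c has the same effect
    as conjugating by t s, so each coset contributes |C| equal terms.\<close>
  have conj: "(\<Oplus>y\<in>carrier G. B i i (y \<otimes>\<^bsub>G\<^esub> g \<otimes>\<^bsub>G\<^esub> inv\<^bsub>G\<^esub> y))
      = [card C] \<cdot> (\<Oplus>s\<in>{..<d}. B i i (t s \<otimes>\<^bsub>G\<^esub> g \<otimes>\<^bsub>G\<^esub> inv\<^bsub>G\<^esub> t s))" for i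
  proof -
    define f where "f y = B i i (y \<otimes>\<^bsub>G\<^esub> g \<otimes>\<^bsub>G\<^esub> inv\<^bsub>G\<^esub> y)" for y
    have fc: "f y \<in> carrier R" if "y \<in> carrier G" for y using that gG Bc by (simp add: f_def)
    have ft: "f (t s \<otimes>\<^bsub>G\<^esub> c) = f (t s)" if "s < d" "c \<in> C" for s c
    proof -
      have "t s \<otimes>\<^bsub>G\<^esub> c \<otimes>\<^bsub>G\<^esub> g \<otimes>\<^bsub>G\<^esub> inv\<^bsub>G\<^esub> (t s \<otimes>\<^bsub>G\<^esub> c) = t s \<otimes>\<^bsub>G\<^esub> (c \<otimes>\<^bsub>G\<^esub> g) \<otimes>\<^bsub>G\<^esub> inv\<^bsub>G\<^esub> c \<otimes>\<^bsub>G\<^esub> inv\<^bsub>G\<^esub> t s"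
        using that gG by (simp add: G.inv_mult_group G.m_assoc)
      also have "\<dots> = t s \<otimes>\<^bsub>G\<^esub> g \<otimes>\<^bsub>G\<^esub> (c \<otimes>\<^bsub>G\<^esub> inv\<^bsub>G\<^esub> c) \<otimes>\<^bsub>G\<^esub> inv\<^bsub>G\<^esub> t s"
        unfolding C_comm[OF that(2) g] using that gG
        by (simp only: G.m_assoc G.m_closed G.inv_closed C_carrier t_closed)
      finally show ?thesis using that gG by (simp add: f_def)
    qed
    have "(\<Oplus>y\<in>carrier G. f y) = finsum R (\<lambda>z. f (case z of (s, c) \<Rightarrow> t s \<otimes>\<^bsub>G\<^esub> c)) ({..<d} \<times> C)"
      using fc by (intro finsum_bij[OF t_bij])
    also have "\<dots> = finsum R (\<lambda>(s, c). f (t s)) ({..<d} \<times> C)"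
      using fc ft by (intro finsum_cong') auto
    also have "\<dots> = (\<Oplus>s\<in>{..<d}. \<Oplus>c\<in>C. f (t s))"
      using fc by (intro finsum_cartesian[symmetric]) auto
    also have "\<dots> = (\<Oplus>s\<in>{..<d}. [card C] \<cdot> f (t s))"
      using fc by (intro finsum_cong') (auto simp: add.finprod_const)
    also have "\<dots> = [card C] \<cdot> (\<Oplus>s\<in>{..<d}. f (t s))"
      using fc by (intro finsum_add_pow) auto
    finally show ?thesis by (simp add: f_def)
  qed
  have "(\<Oplus>i\<in>{..<m}. \<Oplus>y\<in>carrier G. B i i (y \<otimes>\<^bsub>G\<^esub> g \<otimes>\<^bsub>G\<^esub> inv\<^bsub>G\<^esub> y)) = [card C] \<cdot> tr g"
    unfolding conj trg' using Bc gG by (intro finsum_add_pow) (auto intro!: finsum_closed)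
  also have "\<dots> = [(p ^ N)] \<cdot> ([card C] \<cdot> (\<ominus> x g))"
    unfolding trg using wg by (simp add: add.nat_pow_pow mult.commute)
  finally show ?thesis using wg by auto
qed

end

section \<open>Additive commutators of matrices over a group ring\<close>

context ring begin

text \<open>Only powers of x occur until r enters, so the binomial expansion is available in a
  noncommutative ring. It is kept explicit up to the square, whose binomial coefficient supplies a
  needed factor p when p is odd; the remaining terms are gathered in r.\<close>

lemma one_plus_pow:
  assumes x: "x \<in> carrier R"
  shows "\<exists>r\<in>carrier R. (\<one> \<oplus> x) [^] (k::nat) = \<one> \<oplus> [k] \<cdot> x \<oplus> [(k choose 2)] \<cdot> (x \<otimes> x) \<oplus> x \<otimes> x \<otimes> x \<otimes> r"
proof (induction k)
  case 0
  show ?case using x by (intro bexI[of _ \<zero>]) (auto simp: numeral_2_eq_2)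
next
  case (Suc k)
  then obtain r where r: "r \<in> carrier R"
    "(\<one> \<oplus> x) [^] k = \<one> \<oplus> [k] \<cdot> x \<oplus> [(k choose 2)] \<cdot> (x \<otimes> x) \<oplus> x \<otimes> x \<otimes> x \<otimes> r" by auto
  have ch: "Suc k choose 2 = k + (k choose 2)" by (simp add: numeral_2_eq_2)
  define c where "c = [(k choose 2)] \<cdot> \<one>"
  have c [simp]: "c \<in> carrier R" by (simp add: c_def)
  have cx: "[(k choose 2)] \<cdot> (x \<otimes> x) \<otimes> x = x \<otimes> x \<otimes> x \<otimes> c"
    using x by (simp add: c_def add_pow_ldistr add_pow_rdistr)
  have "(\<one> \<oplus> x) [^] Suc k = (\<one> \<oplus> [k] \<cdot> x \<oplus> [(k choose 2)] \<cdot> (x \<otimes> x) \<oplus> x \<otimes> x \<otimes> x \<otimes> r) \<otimes> (\<one> \<oplus> x)"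
    using r by simp
  also have "\<dots> = \<one> \<oplus> ([k] \<cdot> x \<oplus> x) \<oplus> ([k] \<cdot> (x \<otimes> x) \<oplus> [(k choose 2)] \<cdot> (x \<otimes> x)) \<oplus> x \<otimes> x \<otimes> x \<otimes> (r \<oplus> r \<otimes> x \<oplus> c)"
    using x r(1) cx by (simp add: l_distr r_distr add_pow_ldistr m_assoc a_ac)
  also have "\<dots> = \<one> \<oplus> [Suc k] \<cdot> x \<oplus> [(Suc k choose 2)] \<cdot> (x \<otimes> x) \<oplus> x \<otimes> x \<otimes> x \<otimes> (r \<oplus> r \<otimes> x \<oplus> c)"
    using x by (simp add: ch add.nat_pow_mult)
  finally show ?case using x r by (intro bexI[of _ "r \<oplus> r \<otimes> x \<oplus> c"]) auto
qed

text \<open>The only place where the bound \<open>p\<^sup>N > 2\<close> enters.\<close>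

lemma one_plus_pow_prime:
  assumes p: "Factorial_Ring.prime (p::nat)" and N: "1 \<le> N" "2 < p ^ N" and b: "b \<in> carrier R"
  shows "\<exists>b'. pcong R p 1 b' b \<and> (\<one> \<oplus> [(p ^ N)] \<cdot> b) [^] p = \<one> \<oplus> [(p ^ Suc N)] \<cdot> b'"
proof -
  define x where "x = [(p ^ N)] \<cdot> b"
  have x: "x \<in> carrier R" using b by (simp add: x_def)
  obtain r where r: "r \<in> carrier R"
    "(\<one> \<oplus> x) [^] p = \<one> \<oplus> [p] \<cdot> x \<oplus> [(p choose 2)] \<cdot> (x \<otimes> x) \<oplus> x \<otimes> x \<otimes> x \<otimes> r"
    using one_plus_pow[OF x, of p] by auto
  \<comment> \<open>Of the exponent N + 2, N + 1 is extracted and one p must remain so that b' is b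
    modulo p. For p = 2 the bound forces N to be at least 2, hence 2N is at least N + 2; for odd p
    the binomial coefficient contributes one p.\<close>
  have "p ^ (N + 2) dvd (p choose 2) * (p ^ N * p ^ N)"
  proof (cases "p = 2")
    case True
    then have "N \<noteq> 1" using N(2) by auto
    then have "N + 2 \<le> N + N" using N(1) by linarith
    then have "p ^ (N + 2) dvd p ^ (N + N)" by (rule le_imp_power_dvd)
    then show ?thesis by (simp add: True power_add)
  next
    case False
    then have "2 < p" using prime_ge_2_nat[OF p] by linarith
    then have "p dvd (p choose 2)" using p by (intro dvd_choose_prime) auto
    then have "p * (p ^ N * p ^ N) dvd (p choose 2) * (p ^ N * p ^ N)" by (intro mult_dvd_mono) auto
    moreover have "p ^ (N + 2) dvd p * (p ^ N * p ^ N)"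
      using N(1) by (simp only: power_add[symmetric] power_Suc[symmetric] le_imp_power_dvd)
    ultimately show ?thesis by (rule dvd_trans[rotated])
  qed
  then obtain u where u: "(p choose 2) * (p ^ N * p ^ N) = p ^ (N + 2) * u" by (auto simp: dvd_def)
  \<comment> \<open>The cubic remainder is harmless for every p: 3N is at least N + 2 as soon as N
    is positive.\<close>
  have "p ^ (N + 2) dvd p ^ N * p ^ N * p ^ N"
    using N(1) unfolding power_add[symmetric] by (intro le_imp_power_dvd) simp
  then obtain w where w: "p ^ N * p ^ N * p ^ N = p ^ (N + 2) * w" by (auto simp: dvd_def)
  have e1: "[p] \<cdot> x = [(p ^ Suc N)] \<cdot> b"
    using b by (simp add: x_def add.nat_pow_pow mult.commute)
  have e2: "[(p choose 2)] \<cdot> (x \<otimes> x) = [(p ^ Suc N)] \<cdot> ([(p * u)] \<cdot> (b \<otimes> b))"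
  proof -
    have "[(p choose 2)] \<cdot> (x \<otimes> x) = [((p choose 2) * (p ^ N * p ^ N))] \<cdot> (b \<otimes> b)"
      using b by (simp add: x_def add_pow_ldistr add_pow_rdistr add.nat_pow_pow mult.commute)
    also have "(p choose 2) * (p ^ N * p ^ N) = p ^ Suc N * (p * u)"
      by (simp add: u power_add power2_eq_square)
    finally show ?thesis using b by (simp add: add.nat_pow_pow mult.commute)
  qed
  have e3: "x \<otimes> x \<otimes> x \<otimes> r = [(p ^ Suc N)] \<cdot> ([(p * w)] \<cdot> (b \<otimes> b \<otimes> b \<otimes> r))"
  proof -
    have "x \<otimes> x \<otimes> x \<otimes> r = [(p ^ N * p ^ N * p ^ N)] \<cdot> (b \<otimes> b \<otimes> b \<otimes> r)"
      using b r(1) by (simp add: x_def add_pow_ldistr add_pow_rdistr add.nat_pow_pow mult.commute mult.left_commute)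
    also have "p ^ N * p ^ N * p ^ N = p ^ Suc N * (p * w)"
      by (simp add: w power_add power2_eq_square)
    finally show ?thesis using b r(1) by (simp add: add.nat_pow_pow mult.commute)
  qed
  define b' where "b' = b \<oplus> [(p * u)] \<cdot> (b \<otimes> b) \<oplus> [(p * w)] \<cdot> (b \<otimes> b \<otimes> b \<otimes> r)"
  have "(\<one> \<oplus> x) [^] p = \<one> \<oplus> [(p ^ Suc N)] \<cdot> b'"
    unfolding r(2) e1 e2 e3 b'_def using b r(1) by (simp add: add.nat_pow_distrib a_ac)
  moreover have "b' = b \<oplus> [(p ^ 1)] \<cdot> ([u] \<cdot> (b \<otimes> b) \<oplus> [w] \<cdot> (b \<otimes> b \<otimes> b \<otimes> r))"
    using b r(1) by (simp add: b'_def add.nat_pow_distrib add.nat_pow_pow mult.commute a_assoc)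
  then have "pcong R p 1 b' b" using b r(1) by (simp only:) (intro pcong_add_pow, auto)
  ultimately show ?thesis by (auto simp: x_def)
qed

text \<open>The set of right-hand sides for which the linearized equation in
  \<open>gcomm_prod_eqI\<close> is solvable. It is closed under addition and contains all multiples
  of p, so membership can be proved piecewise.\<close>

definition comm_span :: "(nat \<Rightarrow> 'a) \<Rightarrow> nat \<Rightarrow> nat \<Rightarrow> 'a set" where
  "comm_span e d p = {c. \<exists>y. (\<forall>i. y i \<in> carrier R) \<and> pcong R p 1 c (acomm_sum e y d)}"

lemma acomm_sum_zero: "(\<And>i. e i \<in> carrier R) \<Longrightarrow> acomm_sum e (\<lambda>i. \<zero>) d = \<zero>"
  by (induction d) (auto simp: minus_eq)

lemma acomm_sum_add:
  assumes "\<And>i. e i \<in> carrier R" "\<And>i. y i \<in> carrier R" "\<And>i. z i \<in> carrier R"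
  shows "acomm_sum e (\<lambda>i. y i \<oplus> z i) d = acomm_sum e y d \<oplus> acomm_sum e z d"
  using assms acomm_sum_closed[of e y] acomm_sum_closed[of e z]
  by (induction d) (auto simp: l_distr r_distr minus_eq a_ac minus_add)

lemma acomm_sum_single:
  assumes "\<And>i. e i \<in> carrier R" "z \<in> carrier R"
  shows "acomm_sum e (\<lambda>i. if i = k then z else \<zero>) d = (if k < d then e k \<otimes> z \<ominus> z \<otimes> e k else \<zero>)"
  using assms by (induction d) (auto simp: minus_eq less_Suc_eq)

lemma comm_span_add:
  assumes e: "\<And>i. e i \<in> carrier R" and "a \<in> comm_span e d p" "b \<in> comm_span e d p"
  shows "a \<oplus> b \<in> comm_span e d p"
proof -
  obtain y z where yz: "\<And>i. y i \<in> carrier R" "\<And>i. z i \<in> carrier R"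
    "pcong R p 1 a (acomm_sum e y d)" "pcong R p 1 b (acomm_sum e z d)"
    using assms by (auto simp: comm_span_def)
  then have "pcong R p 1 (a \<oplus> b) (acomm_sum e (\<lambda>i. y i \<oplus> z i) d)"
    using e by (simp add: acomm_sum_add pcong_add)
  then show ?thesis using yz by (auto simp: comm_span_def intro!: exI[of _ "\<lambda>i. y i \<oplus> z i"])
qed

lemma comm_span_pcong:
  assumes "\<And>i. e i \<in> carrier R" "pcong R p 1 a \<zero>"
  shows "a \<in> comm_span e d p"
  using assms by (auto simp: comm_span_def acomm_sum_zero intro!: exI[of _ "\<lambda>i. \<zero>"])

lemma comm_span_comm:
  assumes "\<And>i. e i \<in> carrier R" "z \<in> carrier R" "k < d"
  shows "e k \<otimes> z \<ominus> z \<otimes> e k \<in> comm_span e d p"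
  using assms by (auto simp: comm_span_def acomm_sum_single intro!: exI[of _ "\<lambda>i. if i = k then z else \<zero>"])

lemma comm_span_closed: "a \<in> comm_span e d p \<Longrightarrow> a \<in> carrier R"
  by (auto simp: comm_span_def pcong_def)

lemma comm_span_finsum:
  assumes "\<And>i. e i \<in> carrier R" "finite A" "\<And>a. a \<in> A \<Longrightarrow> f a \<in> comm_span e d p"
  shows "finsum R f A \<in> comm_span e d p"
  using assms(2,3)
proof (induction A)
  case empty
  then show ?case using assms(1) by (simp add: comm_span_pcong)
next
  case (insert x F)
  then have "f \<in> F \<rightarrow> carrier R" "f x \<in> carrier R" by (auto intro!: comm_span_closed[of _ e d p])
  with insert show ?case by (simp add: comm_span_add assms(1))
qed

lemma finsum_mat_ring:
  assumes "finite A" "f \<in> A \<rightarrow> carrier (mat_ring R m)"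
  shows "finsum (mat_ring R m) f A i j = (\<Oplus>a\<in>A. f a i j)"
proof -
  interpret M: ring "mat_ring R m" by (rule mat_ring_ring)
  show ?thesis using assms
  proof (induction A)
    case (insert x F)
    then have "f a i j \<in> carrier R" if "a \<in> insert x F" for a
      using that by (auto simp: mat_ring_simps(1) Pi_def)
    with insert show ?case by (simp add: mat_ring_simps(5) Pi_def)
  qed (simp add: mat_ring_simps)
qed

end

section \<open>Matrices over a group ring: coefficients and matrix units\<close>

context finite_group_ring begin

lemma mat_group_eqI:
  assumes "U \<in> carrier (MG m)" "W \<in> carrier (MG m)"
    and eq: "\<And>i j g. i < m \<Longrightarrow> j < m \<Longrightarrow> g \<in> carrier G \<Longrightarrow> U i j g = W i j g"
  shows "U = W"
proof (intro ext)
  fix i j g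
  show "U i j g = W i j g"
  proof (cases "i < m \<and> j < m")
    case True
    have "U i j \<in> extensional (carrier G)" "W i j \<in> extensional (carrier G)"
      using assms by (auto simp: mat_ring_simps(1) group_ring_simps(1) PiE_iff)
    then show ?thesis using True eq by (cases "g \<in> carrier G") (auto simp: extensional_def)
  qed (use assms(1,2) in \<open>auto simp: mat_ring_simps(1)\<close>)
qed

lemma add_pow_mat_group:
  fixes k :: nat
  assumes "U \<in> carrier (MG m)" "g \<in> carrier G"
  shows "add_pow (MG m) k U i j g = [k] \<cdot> U i j g"
proof -
  interpret A: ring "RG" by (rule group_ring_ring)
  interpret B: ring "MG m" by (rule A.mat_ring_ring)
  have U: "U i j \<in> carrier RG" using assms by (auto simp: mat_ring_simps)
  have "add_pow (MG m) k U i j = add_pow RG k (U i j)"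
    by (induction k) (auto simp: mat_ring_simps(4,5))
  then show ?thesis using add_pow_group_ring[OF U assms(2)] by simp
qed

lemma mat_group_entry:
  "U \<in> carrier (MG m) \<Longrightarrow> g \<in> carrier G \<Longrightarrow> U i j g \<in> carrier R"
  by (auto simp: mat_ring_simps group_ring_simps PiE_iff)

text \<open>Matrices over R[G] form a free R-module on positions and group elements, so the
  quotients of the coefficient differences by p^N can be collected into one matrix.\<close>

lemma pcong_mat_group:
  assumes U: "U \<in> carrier (MG m)" and W: "W \<in> carrier (MG m)"
  shows "pcong (MG m) p N U W \<longleftrightarrow>
     (\<forall>i<m. \<forall>j<m. \<forall>g\<in>carrier G. pcong R p N (U i j g) (W i j g))" (is "?l \<longleftrightarrow> ?r")
proof
  interpret A: ring "RG" by (rule group_ring_ring)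
  interpret B: ring "MG m" by (rule A.mat_ring_ring)
  assume ?l
  then obtain c where c: "c \<in> carrier (MG m)" "U = W \<oplus>\<^bsub>MG m\<^esub> add_pow (MG m) (p ^ N) c"
    by (auto simp: pcong_def)
  show ?r
  proof (intro allI impI ballI)
    fix i j g assume "i < m" "j < m" and g: "g \<in> carrier G"
    have "U i j g = W i j g \<oplus> [(p ^ N)] \<cdot> c i j g"
      using add_pow_mat_group[OF c(1) g, of "p ^ N" i j] g unfolding c(2)
      by (simp add: mat_ring_simps(5) group_ring_simps(5))
    then show "pcong R p N (U i j g) (W i j g)"
      using mat_group_entry[OF W g] mat_group_entry[OF c(1) g] by simp blast
  qed
next
  interpret A: ring "RG" by (rule group_ring_ring)
  interpret B: ring "MG m" by (rule A.mat_ring_ring)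
  assume ?r
  then have "\<forall>i j g. i < m \<longrightarrow> j < m \<longrightarrow> g \<in> carrier G \<longrightarrow> (\<exists>c. c \<in> carrier R \<and> U i j g = W i j g \<oplus> [(p ^ N)] \<cdot> c)"
    unfolding pcong_def by blast
  then obtain c where c: "\<And>i j g. i < m \<Longrightarrow> j < m \<Longrightarrow> g \<in> carrier G \<Longrightarrow>
      c i j g \<in> carrier R \<and> U i j g = W i j g \<oplus> [(p ^ N)] \<cdot> c i j g" by metis
  define Q where "Q i j = (if i < m \<and> j < m then (\<lambda>g\<in>carrier G. c i j g) else \<zero>\<^bsub>RG\<^esub>)" for i j
  have Q: "Q \<in> carrier (MG m)" using c by (auto simp: Q_def mat_ring_simps group_ring_simps)
  have "U = W \<oplus>\<^bsub>MG m\<^esub> add_pow (MG m) (p ^ N) Q"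
  proof (rule mat_group_eqI[OF U])
    show "W \<oplus>\<^bsub>MG m\<^esub> add_pow (MG m) (p ^ N) Q \<in> carrier (MG m)" using W Q by simp
    fix i j g assume "i < m" "j < m" "g \<in> carrier G"
    then show "U i j g = (W \<oplus>\<^bsub>MG m\<^esub> add_pow (MG m) (p ^ N) Q) i j g"
      using c add_pow_mat_group[OF Q, of g "p ^ N" i j]
      by (simp add: mat_ring_simps(5) group_ring_simps(5) Q_def)
  qed
  then show ?l using W Q by blast
qed

text \<open>The element r x of R[G]; \<open>munit r x i j\<close> is accordingly r x E_ij.\<close>

definition gunit :: "'r \<Rightarrow> 'g \<Rightarrow> 'g \<Rightarrow> 'r" where
  "gunit r x = (\<lambda>g\<in>carrier G. if g = x then r else \<zero>)"

definition munit :: "'r \<Rightarrow> 'g \<Rightarrow> nat \<Rightarrow> nat \<Rightarrow> nat \<Rightarrow> nat \<Rightarrow> 'g \<Rightarrow> 'r" where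
  "munit r x i j a b = (if a = i \<and> b = j then gunit r x else \<zero>\<^bsub>group_ring R G\<^esub>)"

lemma gunit_closed: "r \<in> carrier R \<Longrightarrow> gunit r x \<in> carrier RG"
  by (auto simp: gunit_def group_ring_simps)

lemma gunit_mult:
  assumes "r \<in> carrier R" "s \<in> carrier R" "x \<in> carrier G" "y \<in> carrier G"
  shows "gunit r x \<otimes>\<^bsub>group_ring R G\<^esub> gunit s y = gunit (r \<otimes> s) (x \<otimes>\<^bsub>G\<^esub> y)"
proof -
  have "(\<Oplus>h\<in>carrier G. gunit r x h \<otimes> gunit s y (inv\<^bsub>G\<^esub> h \<otimes>\<^bsub>G\<^esub> g)) = (if g = x \<otimes>\<^bsub>G\<^esub> y then r \<otimes> s else \<zero>)"
    if g: "g \<in> carrier G" for g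
  proof -
    have "(\<Oplus>h\<in>carrier G. gunit r x h \<otimes> gunit s y (inv\<^bsub>G\<^esub> h \<otimes>\<^bsub>G\<^esub> g))
       = (\<Oplus>h\<in>carrier G. if h = x then r \<otimes> gunit s y (inv\<^bsub>G\<^esub> x \<otimes>\<^bsub>G\<^esub> g) else \<zero>)"
      using assms g by (intro finsum_cong') (auto simp: gunit_def)
    also have "\<dots> = r \<otimes> gunit s y (inv\<^bsub>G\<^esub> x \<otimes>\<^bsub>G\<^esub> g)"
      using assms g by (subst finsum_delta) (auto simp: gunit_def)
    also have "\<dots> = (if g = x \<otimes>\<^bsub>G\<^esub> y then r \<otimes> s else \<zero>)"
      using assms g by (auto simp: gunit_def G.inv_solve_left G.inv_solve_left')
    finally show ?thesis .
  qed
  then show ?thesis by (auto simp: group_ring_simps(2) gunit_def[of "r \<otimes> s"] fun_eq_iff)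
qed

lemma munit_closed:
  "r \<in> carrier R \<Longrightarrow> i < m \<Longrightarrow> j < m \<Longrightarrow> munit r x i j \<in> carrier (MG m)"
proof -
  interpret A: ring "RG" by (rule group_ring_ring)
  assume "r \<in> carrier R" "i < m" "j < m"
  then show ?thesis by (auto simp: munit_def mat_ring_simps gunit_closed)
qed

lemma munit_mult:
  assumes rs: "r \<in> carrier R" "s \<in> carrier R" and xy: "x \<in> carrier G" "y \<in> carrier G" and jm: "j < m"
  shows "munit r x i j \<otimes>\<^bsub>MG m\<^esub> munit s y k l
     = (if j = k then munit (r \<otimes> s) (x \<otimes>\<^bsub>G\<^esub> y) i l else \<zero>\<^bsub>MG m\<^esub>)"
proof (intro ext)
  fix a c g
  interpret A: ring "RG" by (rule group_ring_ring)
  have mc: "munit r x i j a b \<in> carrier RG" "munit s y k l a b \<in> carrier RG" for a b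
    using rs by (auto simp: munit_def gunit_closed)
  have "(\<Oplus>\<^bsub>RG\<^esub>b\<in>{..<m}. munit r x i j a b \<otimes>\<^bsub>RG\<^esub> munit s y k l b c)
     = (\<Oplus>\<^bsub>RG\<^esub>b\<in>{..<m}. if b = j then munit r x i j a j \<otimes>\<^bsub>RG\<^esub> munit s y k l j c else \<zero>\<^bsub>RG\<^esub>)"
    using mc by (intro A.finsum_cong') (auto simp: munit_def gunit_closed rs)
  also have "\<dots> = munit r x i j a j \<otimes>\<^bsub>RG\<^esub> munit s y k l j c"
    using mc jm by (subst A.finsum_delta) auto
  also have "\<dots> = (if j = k then munit (r \<otimes> s) (x \<otimes>\<^bsub>G\<^esub> y) i l else \<zero>\<^bsub>MG m\<^esub>) a c"
    using rs xy by (auto simp: munit_def gunit_closed gunit_mult mat_ring_simps)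
  finally show "(munit r x i j \<otimes>\<^bsub>MG m\<^esub> munit s y k l) a c g
     = (if j = k then munit (r \<otimes> s) (x \<otimes>\<^bsub>G\<^esub> y) i l else \<zero>\<^bsub>MG m\<^esub>) a c g"
    by (simp add: mat_ring_simps(2))
qed

section \<open>Conjugacy classes and elementary matrices\<close>

definition conj_class :: "'g \<Rightarrow> 'g set" where
  "conj_class g = (\<lambda>y. y \<otimes>\<^bsub>G\<^esub> g \<otimes>\<^bsub>G\<^esub> inv\<^bsub>G\<^esub> y) ` carrier G"

lemma conj_class_self: "g \<in> carrier G \<Longrightarrow> g \<in> conj_class g"
  by (auto simp: conj_class_def intro!: image_eqI[of _ _ "\<one>\<^bsub>G\<^esub>"])

lemma conj_class_closed: "g \<in> carrier G \<Longrightarrow> x \<in> conj_class g \<Longrightarrow> x \<in> carrier G"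
  by (auto simp: conj_class_def)

lemma conj_class_subset:
  assumes "g \<in> carrier G" "x \<in> conj_class g" shows "conj_class x \<subseteq> conj_class g"
proof
  fix z assume "z \<in> conj_class x"
  then obtain y y' where "y \<in> carrier G" "y' \<in> carrier G" "x = y \<otimes>\<^bsub>G\<^esub> g \<otimes>\<^bsub>G\<^esub> inv\<^bsub>G\<^esub> y" "z = y' \<otimes>\<^bsub>G\<^esub> x \<otimes>\<^bsub>G\<^esub> inv\<^bsub>G\<^esub> y'"
    using assms by (auto simp: conj_class_def)
  then show "z \<in> conj_class g"
    using assms by (auto simp: conj_class_def G.m_assoc G.inv_mult_group intro!: image_eqI[of _ _ "y' \<otimes>\<^bsub>G\<^esub> y"])
qed

lemma conj_class_sym:
  assumes "g \<in> carrier G" "x \<in> conj_class g" shows "g \<in> conj_class x"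
proof -
  obtain y where y: "y \<in> carrier G" "x = y \<otimes>\<^bsub>G\<^esub> g \<otimes>\<^bsub>G\<^esub> inv\<^bsub>G\<^esub> y" using assms by (auto simp: conj_class_def)
  have "inv\<^bsub>G\<^esub> y \<otimes>\<^bsub>G\<^esub> x \<otimes>\<^bsub>G\<^esub> inv\<^bsub>G\<^esub> (inv\<^bsub>G\<^esub> y) = (inv\<^bsub>G\<^esub> y \<otimes>\<^bsub>G\<^esub> y) \<otimes>\<^bsub>G\<^esub> g \<otimes>\<^bsub>G\<^esub> (inv\<^bsub>G\<^esub> y \<otimes>\<^bsub>G\<^esub> y)"
    using y assms by (simp only: G.m_assoc G.inv_inv G.m_closed G.inv_closed)
  then show ?thesis using y assms by (auto simp: conj_class_def intro!: image_eqI[of _ _ "inv\<^bsub>G\<^esub> y"])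
qed

lemma conj_class_eq:
  "g \<in> carrier G \<Longrightarrow> x \<in> conj_class g \<Longrightarrow> conj_class x = conj_class g"
  using conj_class_subset conj_class_sym conj_class_closed by blast

text \<open>The choice depends only on the class as a set, so conjugate elements receive the same
  representative.\<close>

definition class_rep :: "'g \<Rightarrow> 'g" where
  "class_rep x = (SOME y. y \<in> conj_class x)"

lemma class_rep_in: "x \<in> carrier G \<Longrightarrow> class_rep x \<in> conj_class x"
  unfolding class_rep_def using conj_class_self by (rule someI)

lemma class_rep_iff:
  assumes "x \<in> carrier G" "g \<in> carrier G" "class_rep g = g"
  shows "class_rep x = g \<longleftrightarrow> x \<in> conj_class g"
proof
  assume "class_rep x = g"
  then show "x \<in> conj_class g" using class_rep_in[OF assms(1)] conj_class_sym assms by blast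
next
  assume "x \<in> conj_class g"
  then have "conj_class x = conj_class g" using assms conj_class_eq by blast
  then show "class_rep x = g" using assms(3) by (simp add: class_rep_def)
qed

lemma class_rep_idem: "x \<in> carrier G \<Longrightarrow> class_rep (class_rep x) = class_rep x"
  using class_rep_in conj_class_eq by (metis class_rep_def)

text \<open>The matrices \<open>1 + x E\<^bsub>ij\<^esub>\<close> with \<open>x \<in> G\<close> and \<open>i \<noteq> j\<close>: additive commutators with these
  finitely many units already span the kernel of the trace to the conjugacy classes.\<close>

definition elem_idx :: "nat \<Rightarrow> ('g \<times> nat \<times> nat) set" where
  "elem_idx m = {(x, i, j). x \<in> carrier G \<and> i < m \<and> j < m \<and> i \<noteq> j}"

definition elem_mat :: "nat \<Rightarrow> 'g \<times> nat \<times> nat \<Rightarrow> nat \<Rightarrow> nat \<Rightarrow> 'g \<Rightarrow> 'r" where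
  "elem_mat m = (\<lambda>(x, i, j). \<one>\<^bsub>MG m\<^esub> \<oplus>\<^bsub>MG m\<^esub> munit \<one> x i j)"

lemma finite_elem_idx: "finite (elem_idx m)"
  by (rule finite_subset[of _ "carrier G \<times> {..<m} \<times> {..<m}"]) (auto simp: elem_idx_def)

text \<open>For distinct i and j the matrix E = x E_ij has square zero, so 1 - E inverts 1 +
  E.\<close>

lemma elem_mat_Units:
  assumes "z \<in> elem_idx m"
  shows "elem_mat m z \<in> Units (MG m)"
proof -
  interpret A: ring "RG" by (rule group_ring_ring)
  interpret B: ring "MG m" by (rule A.mat_ring_ring)
  obtain x i j where z: "z = (x, i, j)" "x \<in> carrier G" "i < m" "j < m" "i \<noteq> j"
    using assms by (auto simp: elem_idx_def)
  define E where "E = munit \<one> x i j"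
  have Ec: "E \<in> carrier (MG m)" using z by (simp add: E_def munit_closed)
  have EE: "E \<otimes>\<^bsub>MG m\<^esub> E = \<zero>\<^bsub>MG m\<^esub>"
    using z by (simp add: E_def munit_mult)
  have "(\<one>\<^bsub>MG m\<^esub> \<oplus>\<^bsub>MG m\<^esub> E) \<otimes>\<^bsub>MG m\<^esub> (\<one>\<^bsub>MG m\<^esub> \<ominus>\<^bsub>MG m\<^esub> E) = \<one>\<^bsub>MG m\<^esub>"
       "(\<one>\<^bsub>MG m\<^esub> \<ominus>\<^bsub>MG m\<^esub> E) \<otimes>\<^bsub>MG m\<^esub> (\<one>\<^bsub>MG m\<^esub> \<oplus>\<^bsub>MG m\<^esub> E) = \<one>\<^bsub>MG m\<^esub>"
    using Ec EE by (simp_all add: B.l_distr B.r_distr B.minus_eq B.l_minus B.r_minus B.a_assoc B.l_neg B.r_neg)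
  moreover have "elem_mat m z = \<one>\<^bsub>MG m\<^esub> \<oplus>\<^bsub>MG m\<^esub> E"
    by (simp add: z(1) elem_mat_def E_def)
  ultimately show ?thesis using Ec
    by (auto simp: Units_def intro!: bexI[of _ "\<one>\<^bsub>MG m\<^esub> \<ominus>\<^bsub>MG m\<^esub> E"])
qed

text \<open>Modulo additive commutators every matrix can be moved to position (0, 0), with each
  group element replaced by the representative of its class. What arrives there has the class sums
  of the trace as coefficients, and these are divisible by p.\<close>

theorem trace_kernel_comm_span:
  fixes p m :: nat
  assumes m: "2 \<le> m" and idx: "bij_betw idx {..<d} (elem_idx m)"
    and e: "\<And>k. k < d \<Longrightarrow> e k = elem_mat m (idx k)" "\<And>k. e k \<in> carrier (MG m)"
    and b: "b \<in> carrier (MG m)"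
    and tr: "\<And>g. g \<in> carrier G \<Longrightarrow> \<exists>r\<in>carrier R. (\<Oplus>i\<in>{..<m}. \<Oplus>x\<in>conj_class g. b i i x) = [p] \<cdot> r"
  shows "b \<in> ring.comm_span (MG m) e d p"
proof -
  interpret A: ring "RG" by (rule group_ring_ring)
  interpret B: ring "MG m" by (rule A.mat_ring_ring)
  let ?B = "MG m"
  let ?V = "B.comm_span e d p"
  have bc: "b i j x \<in> carrier R" if "x \<in> carrier G" for i j x
    using b that by (auto simp: mat_ring_simps group_ring_simps PiE_iff)
  have comm: "munit \<one> x i j \<otimes>\<^bsub>?B\<^esub> z \<ominus>\<^bsub>?B\<^esub> z \<otimes>\<^bsub>?B\<^esub> munit \<one> x i j \<in> ?V"
    if x: "x \<in> carrier G" and ij: "i < m" "j < m" "i \<noteq> j" and z: "z \<in> carrier ?B" for x i j z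
  proof -
    have "(x, i, j) \<in> idx ` {..<d}" using idx x ij by (auto simp: bij_betw_def elem_idx_def)
    then obtain k where k: "k < d" "idx k = (x, i, j)" by auto
    define E where "E = munit \<one> x i j"
    have Ec: "E \<in> carrier ?B" using x ij by (simp add: E_def munit_closed)
    have "e k = \<one>\<^bsub>?B\<^esub> \<oplus>\<^bsub>?B\<^esub> E" using e(1)[OF k(1)] k by (simp add: elem_mat_def E_def)
    \<comment> \<open>The identity summand of \<open>e k\<close> is central, so the commutator with
      \<open>e k\<close> is the commutator with x E_ij.\<close>
    then have "e k \<otimes>\<^bsub>?B\<^esub> z \<ominus>\<^bsub>?B\<^esub> z \<otimes>\<^bsub>?B\<^esub> e k = E \<otimes>\<^bsub>?B\<^esub> z \<ominus>\<^bsub>?B\<^esub> z \<otimes>\<^bsub>?B\<^esub> E"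
      using Ec z by (simp add: B.l_distr B.r_distr B.minus_eq B.minus_add B.a_ac B.r_neg1 B.r_neg2)
    then show ?thesis using B.comm_span_comm[where e = e and k = k and z = z and d = d and p = p, OF e(2) z k(1)] by (simp add: E_def)
  qed
  \<comment> \<open>The commutator of E_ij with r y E_jj: its second product vanishes because j
    differs from i.\<close>
  have off: "munit r y i j \<in> ?V" if "r \<in> carrier R" "y \<in> carrier G" "i < m" "j < m" "i \<noteq> j" for r y i j
    using comm[of "\<one>\<^bsub>G\<^esub>" i j "munit r y j j"] that
    by (simp add: munit_mult munit_closed B.minus_eq)
  \<comment> \<open>The commutator of x^-1 E_ij with r x y E_ji. It moves a diagonal entry from i to
    j and conjugates it by x at the same time.\<close>
  have diag: "munit r y i i \<ominus>\<^bsub>?B\<^esub> munit r (x \<otimes>\<^bsub>G\<^esub> y \<otimes>\<^bsub>G\<^esub> inv\<^bsub>G\<^esub> x) j j \<in> ?V"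
    if "r \<in> carrier R" "y \<in> carrier G" "x \<in> carrier G" "i < m" "j < m" "i \<noteq> j" for r y x i j
    using comm[of "inv\<^bsub>G\<^esub> x" i j "munit r (x \<otimes>\<^bsub>G\<^esub> y) j i"] that
    by (simp add: munit_mult munit_closed G.m_assoc[symmetric])
  have rep: "munit r y i i \<ominus>\<^bsub>?B\<^esub> munit r (class_rep y) 0 0 \<in> ?V"
    if r: "r \<in> carrier R" and y: "y \<in> carrier G" and i: "i < m" for r y i
  proof -
    obtain x where x: "x \<in> carrier G" "class_rep y = x \<otimes>\<^bsub>G\<^esub> y \<otimes>\<^bsub>G\<^esub> inv\<^bsub>G\<^esub> x"
      using class_rep_in[OF y] by (auto simp: conj_class_def)
    show ?thesis
    proof (cases "i = 0")
      case False
      then show ?thesis using diag[OF r y x(1) i, of 0] m by (simp add: x(2))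
    next
      \<comment> \<open>An entry already at position 0 cannot be conjugated in place; it travels to
        position 1 and back. This uses that m is at least 2.\<close>
      case True
      have 1: "munit r y 0 0 \<ominus>\<^bsub>?B\<^esub> munit r y 1 1 \<in> ?V"
        using diag[OF r y, of "\<one>\<^bsub>G\<^esub>" 0 1] m y by simp
      have 2: "munit r y 1 1 \<ominus>\<^bsub>?B\<^esub> munit r (class_rep y) 0 0 \<in> ?V"
        using diag[OF r y x(1), of 1 0] m by (simp add: x(2))
      have c: "munit r y 0 0 \<in> carrier ?B" "munit r y 1 1 \<in> carrier ?B" "munit r (class_rep y) 0 0 \<in> carrier ?B"
        using r m by (auto intro!: munit_closed)
      have "(munit r y 0 0 \<ominus>\<^bsub>?B\<^esub> munit r y 1 1) \<oplus>\<^bsub>?B\<^esub> (munit r y 1 1 \<ominus>\<^bsub>?B\<^esub> munit r (class_rep y) 0 0)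
          = munit r y 0 0 \<ominus>\<^bsub>?B\<^esub> munit r (class_rep y) 0 0"
        using c by (simp add: B.minus_eq B.a_assoc B.r_neg1)
      with B.comm_span_add[OF e(2) 1 2] True show ?thesis by simp
    qed
  qed
  let ?I = "{..<m} \<times> {..<m} \<times> carrier G"
  \<comment> \<open>S decomposes b into its monomials; T is the normal form of each monomial, zero
    off the diagonal and transported to (0, 0) on it.\<close>
  define S where "S = (\<lambda>(i, j, x). munit (b i j x) x i j)"
  define T where "T = (\<lambda>(i, j, x). if i = j then munit (b i j x) (class_rep x) 0 0 else \<zero>\<^bsub>?B\<^esub>)"
  have finI: "finite ?I" by simp
  have Sc: "S z \<in> carrier ?B" if "z \<in> ?I" for z using that bc by (auto simp: S_def intro!: munit_closed)
  have Tc: "T z \<in> carrier ?B" if "z \<in> ?I" for z using that bc m by (auto simp: T_def intro!: munit_closed)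
  have ST: "S z \<ominus>\<^bsub>?B\<^esub> T z \<in> ?V" if "z \<in> ?I" for z
    using that rep off bc Sc[OF that] by (auto simp: S_def T_def B.minus_eq)
  have sum_apply: "finsum ?B F ?I i j g = (\<Oplus>z\<in>?I. F z i j g)"
    if F: "\<And>z. z \<in> ?I \<Longrightarrow> F z \<in> carrier ?B" and g: "g \<in> carrier G" for F i j g
  proof -
    have "finsum ?B F ?I i j = (\<Oplus>\<^bsub>RG\<^esub>z\<in>?I. F z i j)"
      using F finI by (intro A.finsum_mat_ring) auto
    moreover have "(\<Oplus>\<^bsub>RG\<^esub>z\<in>?I. F z i j) g = (\<Oplus>z\<in>?I. F z i j g)"
      using F finI g by (intro finsum_group_ring) (auto simp: mat_ring_simps)
    ultimately show ?thesis by simp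
  qed
  have bS: "b = finsum ?B S ?I"
  proof (rule mat_group_eqI[OF b])
    show "finsum ?B S ?I \<in> carrier ?B" using Sc by (intro B.finsum_closed) auto
    fix i j g assume ijg: "i < m" "j < m" "g \<in> carrier G"
    have "(\<Oplus>z\<in>?I. S z i j g) = (\<Oplus>z\<in>?I. if z = (i, j, g) then b i j g else \<zero>)"
      using ijg bc by (intro finsum_cong') (auto simp: S_def munit_def gunit_def group_ring_simps split: if_splits)
    also have "\<dots> = b i j g"
      using ijg bc by (subst finsum_delta) auto
    finally show "b i j g = finsum ?B S ?I i j g" using ijg Sc by (simp add: sum_apply)
  qed
  have Tsum: "pcong ?B p 1 (finsum ?B T ?I) \<zero>\<^bsub>?B\<^esub>"
  proof -
    \<comment> \<open>At a chosen representative g the coefficient is the class sum of g; at any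
      other element it is zero.\<close>
    have tot: "\<exists>r\<in>carrier R. finsum ?B T ?I 0 0 g = [p] \<cdot> r" if g: "g \<in> carrier G" for g
    proof -
      have "finsum ?B T ?I 0 0 g = (\<Oplus>z\<in>?I. T z 0 0 g)"
        using g Tc by (simp add: sum_apply)
      also have "\<dots> = finsum R (\<lambda>(i, j, x). if j = i then (if class_rep x = g then b i i x else \<zero>) else \<zero>) ?I"
        using g bc by (intro finsum_cong') (auto simp: T_def munit_def gunit_def group_ring_simps mat_ring_simps)
      also have "\<dots> = (\<Oplus>i\<in>{..<m}. finsum R (\<lambda>(j, x). if j = i then (if class_rep x = g then b i i x else \<zero>) else \<zero>) ({..<m} \<times> carrier G))"
        using bc by (subst finsum_cartesian) (auto intro!: finsum_cong' split: prod.splits)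
      also have "\<dots> = (\<Oplus>i\<in>{..<m}. \<Oplus>x\<in>carrier G. if class_rep x = g then b i i x else \<zero>)"
      proof (rule finsum_cong', rule refl)
        fix i assume i: "i \<in> {..<m}"
        have "finsum R (\<lambda>(j, x). if j = i then (if class_rep x = g then b i i x else \<zero>) else \<zero>) ({..<m} \<times> carrier G)
          = (\<Oplus>j\<in>{..<m}. \<Oplus>x\<in>carrier G. if j = i then (if class_rep x = g then b i i x else \<zero>) else \<zero>)"
          using bc by (subst finsum_cartesian) auto
        also have "\<dots> = (\<Oplus>j\<in>{..<m}. if j = i then (\<Oplus>x\<in>carrier G. if class_rep x = g then b i i x else \<zero>) else \<zero>)"
          using bc by (intro finsum_cong') (auto intro!: finsum_closed simp: finsum_zero)
        also have "\<dots> = (\<Oplus>x\<in>carrier G. if class_rep x = g then b i i x else \<zero>)"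
          using bc i by (subst finsum_delta) (auto intro!: finsum_closed)
        finally show "finsum R (\<lambda>(j, x). if j = i then (if class_rep x = g then b i i x else \<zero>) else \<zero>) ({..<m} \<times> carrier G)
          = (\<Oplus>x\<in>carrier G. if class_rep x = g then b i i x else \<zero>)" .
      qed (use bc in \<open>auto intro!: finsum_closed\<close>)
      finally have eq: "finsum ?B T ?I 0 0 g = (\<Oplus>i\<in>{..<m}. \<Oplus>x\<in>carrier G. if class_rep x = g then b i i x else \<zero>)" .
      show ?thesis
      proof (cases "class_rep g = g")
        case True
        have "(\<Oplus>x\<in>carrier G. if class_rep x = g then b i i x else \<zero>) = (\<Oplus>x\<in>conj_class g. b i i x)" for i
          using class_rep_iff[OF _ g True] conj_class_closed[OF g] bc
          by (intro add.finprod_mono_neutral_cong_right) auto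
        with tr[OF g] eq show ?thesis by simp
      next
        case False
        then have "class_rep x \<noteq> g" if "x \<in> carrier G" for x using class_rep_idem[OF that] by auto
        then have "(\<Oplus>x\<in>carrier G. if class_rep x = g then b i i x else \<zero>) = \<zero>" for i
          by (intro add.finprod_one_eqI) auto
        then show ?thesis unfolding eq by (auto simp: finsum_zero intro!: bexI[of _ \<zero>])
      qed
    qed
    then obtain r where r: "\<And>g. g \<in> carrier G \<Longrightarrow> r g \<in> carrier R \<and> finsum ?B T ?I 0 0 g = [p] \<cdot> r g" by metis
    define Q where "Q a c = (if a = 0 \<and> c = 0 then (\<lambda>g\<in>carrier G. r g) else \<zero>\<^bsub>RG\<^esub>)" for a c :: nat
    have Qc: "Q \<in> carrier ?B" using r m by (auto simp: Q_def mat_ring_simps group_ring_simps)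
    have "finsum ?B T ?I = add_pow ?B p Q"
    proof (rule mat_group_eqI)
      show "finsum ?B T ?I \<in> carrier ?B" using Tc by (intro B.finsum_closed) auto
      show "add_pow ?B p Q \<in> carrier ?B" using Qc by simp
      fix i j g assume ijg: "i < m" "j < m" "g \<in> carrier G"
      show "finsum ?B T ?I i j g = add_pow ?B p Q i j g"
      proof (cases "i = 0 \<and> j = 0")
        case True
        then show ?thesis using add_pow_mat_group[OF Qc ijg(3)] ijg r by (simp add: Q_def)
      next
        case False
        then have "(\<Oplus>z\<in>?I. T z i j g) = \<zero>"
          using ijg by (intro add.finprod_one_eqI) (auto simp: T_def munit_def group_ring_simps mat_ring_simps)
        then show ?thesis using False add_pow_mat_group[OF Qc ijg(3)] ijg Tc
          by (auto simp: sum_apply Q_def group_ring_simps)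
      qed
    qed
    then show ?thesis using B.pcong_add_pow[of "\<zero>\<^bsub>?B\<^esub>" Q p 1] Qc by simp
  qed
  have "b = finsum ?B (\<lambda>z. S z \<ominus>\<^bsub>?B\<^esub> T z) ?I \<oplus>\<^bsub>?B\<^esub> finsum ?B T ?I"
  proof -
    have cl: "finsum ?B S ?I \<in> carrier ?B" "finsum ?B T ?I \<in> carrier ?B"
      using Sc Tc by (auto intro!: B.finsum_closed)
    have "finsum ?B (\<lambda>z. S z \<ominus>\<^bsub>?B\<^esub> T z) ?I = finsum ?B S ?I \<ominus>\<^bsub>?B\<^esub> finsum ?B T ?I"
      using Sc Tc finI by (intro B.finsum_minus) auto
    then show ?thesis using cl bS by (simp add: B.minus_eq B.a_assoc B.l_neg)
  qed
  then show ?thesis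
    using B.comm_span_add[OF e(2) B.comm_span_finsum[OF e(2) finI ST] B.comm_span_pcong[OF e(2) Tsum]] by simp
qed

end

section \<open>\<open>p\<close>-adically complete group rings\<close>

lemma (in cring) pow_ideal_iff:
  "x \<in> pow_ideal R p n \<longleftrightarrow> (\<exists>c\<in>carrier R. x = [(p ^ n)] \<cdot> c)"
proof -
  have "c \<otimes> [(p ^ n)] \<cdot> \<one> = [(p ^ n)] \<cdot> c" if "c \<in> carrier R" for c
    using that by (simp add: add_pow_rdistr)
  then show ?thesis unfolding pow_ideal_def cgenideal_def by (auto simp del: add.nat_pow_Suc) metis
qed

lemma (in cring) pow_ideal_ideal: "ideal (pow_ideal R p n) R"
  unfolding pow_ideal_def by (intro cgenideal_ideal) simp

lemma (in cring) pow_coset_eq_iff: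
  assumes "x \<in> carrier R" "y \<in> carrier R"
  shows "pow_ideal R p n +> x = pow_ideal R p n +> y \<longleftrightarrow> pcong R p n x y"
proof -
  interpret I: ideal "pow_ideal R p n" R by (rule pow_ideal_ideal)
  have "pow_ideal R p n +> x = pow_ideal R p n +> y \<longleftrightarrow> x \<ominus> y \<in> pow_ideal R p n"
    using assms quotient_eq_iff_same_a_r_cos[OF pow_ideal_ideal] by auto
  also have "\<dots> \<longleftrightarrow> pcong R p n x y"
  proof
    assume "x \<ominus> y \<in> pow_ideal R p n"
    then obtain c where c: "c \<in> carrier R" "x \<ominus> y = [(p ^ n)] \<cdot> c" by (auto simp: pow_ideal_iff)
    then have "x = y \<oplus> [(p ^ n)] \<cdot> c"
      using assms by (simp flip: c(2)) (simp add: minus_eq a_lcomm r_neg)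
    then show "pcong R p n x y" using assms c by auto
  next
    assume "pcong R p n x y"
    then obtain c where c: "c \<in> carrier R" "x = y \<oplus> [(p ^ n)] \<cdot> c" by (auto simp: pcong_def)
    then have "x \<ominus> y = [(p ^ n)] \<cdot> c" using assms(2) by (simp add: minus_eq a_ac r_neg1 r_neg2)
    then show "x \<ominus> y \<in> pow_ideal R p n" using c by (auto simp: pow_ideal_iff)
  qed
  finally show ?thesis .
qed

text \<open>Injectivity of the map to the inverse limit gives separatedness. Surjectivity gives
  completeness, since a sequence whose consecutive terms agree modulo p^N defines a point of the
  limit.\<close>

lemma (in cring) padic_ringI:
  assumes "padically_complete R p"
  shows "padic_ring R p"
proof
  have bij: "bij_betw (\<lambda>x n. pow_ideal R p n +> x) (carrier R) (carrier (padic_limit R p))"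
    using assms by (simp add: padically_complete_def ring_iso_def)
  fix a b assume ab: "a \<in> carrier R" "b \<in> carrier R" "\<And>N. pcong R p N a b"
  then have "(\<lambda>n. pow_ideal R p n +> a) = (\<lambda>n. pow_ideal R p n +> b)"
    by (intro ext) (simp add: pow_coset_eq_iff)
  then show "a = b" using bij ab by (auto simp: bij_betw_def inj_on_def)
next
  have bij: "bij_betw (\<lambda>x n. pow_ideal R p n +> x) (carrier R) (carrier (padic_limit R p))"
    using assms by (simp add: padically_complete_def ring_iso_def)
  fix x :: "nat \<Rightarrow> 'a" assume x: "\<And>N. x N \<in> carrier R" "\<And>N. pcong R p N (x (Suc N)) (x N)"
  have "(\<lambda>n. pow_ideal R p n +> x n) \<in> carrier (padic_limit R p)"
  proof -
    have "pow_ideal R p n +> x n \<in> carrier (R Quot pow_ideal R p n)" for n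
      using x(1) by (auto simp: FactRing_def A_RCOSETS_def')
    \<comment> \<open>The transition map adds p^n R to a coset of p^(n+1) R, which yields the coset
      of p^n R of the same representative because the second ideal is contained in the
      first.\<close>
    moreover have "pow_ideal R p n <+>\<^bsub>R\<^esub> (pow_ideal R p (Suc n) +> x (Suc n)) = pow_ideal R p n +> x n" for n
    proof -
      interpret I: ideal "pow_ideal R p n" R by (rule pow_ideal_ideal)
      interpret J: ideal "pow_ideal R p (Suc n)" R by (rule pow_ideal_ideal)
      have JI: "pow_ideal R p (Suc n) \<subseteq> pow_ideal R p n"
      proof
        fix z assume "z \<in> pow_ideal R p (Suc n)"
        then obtain c where c: "c \<in> carrier R" "z = [(p ^ Suc n)] \<cdot> c"
          unfolding pow_ideal_iff by blast
        then have "z = [(p ^ n)] \<cdot> ([p] \<cdot> c)" by (simp add: add.nat_pow_pow)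
        with c show "z \<in> pow_ideal R p n" unfolding pow_ideal_iff by blast
      qed
      have "pow_ideal R p n <+>\<^bsub>R\<^esub> (pow_ideal R p (Suc n) +> x (Suc n)) = pow_ideal R p n +> x (Suc n)"
      proof (intro subset_antisym subsetI)
        fix z assume "z \<in> pow_ideal R p n <+>\<^bsub>R\<^esub> (pow_ideal R p (Suc n) +> x (Suc n))"
        then obtain i j where ij: "i \<in> pow_ideal R p n" "j \<in> pow_ideal R p (Suc n)" "z = i \<oplus> (j \<oplus> x (Suc n))"
          by (auto simp: set_add_def' a_r_coset_def')
        then have "z = (i \<oplus> j) \<oplus> x (Suc n)" using x(1) I.a_Hcarr J.a_Hcarr by (simp add: a_assoc)
        moreover have "i \<oplus> j \<in> pow_ideal R p n" using ij JI by auto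
        ultimately show "z \<in> pow_ideal R p n +> x (Suc n)" by (auto simp: a_r_coset_def')
      next
        fix z assume "z \<in> pow_ideal R p n +> x (Suc n)"
        then obtain i where i: "i \<in> pow_ideal R p n" "z = i \<oplus> x (Suc n)" by (auto simp: a_r_coset_def')
        then have "z = i \<oplus> (\<zero> \<oplus> x (Suc n))" using x(1) by simp
        then show "z \<in> pow_ideal R p n <+>\<^bsub>R\<^esub> (pow_ideal R p (Suc n) +> x (Suc n))"
          using i(1) J.zero_closed unfolding set_add_def' a_r_coset_def' by blast
      qed
      then show ?thesis using x by (simp add: pow_coset_eq_iff)
    qed
    ultimately show ?thesis by (simp add: padic_limit_def)
  qed
  then obtain l where l: "l \<in> carrier R" "(\<lambda>n. pow_ideal R p n +> x n) = (\<lambda>n. pow_ideal R p n +> l)"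
    using bij by (auto simp: bij_betw_def)
  then have "pcong R p N l (x N)" for N
    using pow_coset_eq_iff[of l "x N" p N] x(1) by (simp add: fun_eq_iff)
  then show "\<exists>l\<in>carrier R. \<forall>N. pcong R p N l (x N)" using l(1) by blast
qed

text \<open>\<open>torsion_free\<close> carries what is needed of characteristic zero: positive
  integers, in particular powers of p, can be cancelled in R.\<close>

locale padic_group_ring = cring R + padic_ring R p + finite_group_ring R G
  for R :: "('r, 'm) ring_scheme" (structure) and p :: nat and G :: "('g, 'k) monoid_scheme" (structure) +
  assumes prime_p: "Factorial_Ring.prime p"
    and torsion_free: "\<And>k r. 0 < k \<Longrightarrow> r \<in> carrier R \<Longrightarrow> [(k::nat)] \<cdot> r = \<zero> \<Longrightarrow> r = \<zero>"
begin

lemma p_pos: "0 < p" using prime_p prime_gt_0_nat by blast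

text \<open>Congruences are coefficientwise and there are finitely many coefficients, so limits are
  formed coefficient by coefficient.\<close>

lemma mat_padic: "padic_ring (MG m) p"
proof -
  interpret A: ring "RG" by (rule group_ring_ring)
  interpret B: ring "MG m" by (rule A.mat_ring_ring)
  show ?thesis
  proof
    fix U W assume UW: "U \<in> carrier (MG m)" "W \<in> carrier (MG m)" "\<And>N. pcong (MG m) p N U W"
    show "U = W"
    proof (rule mat_group_eqI[OF UW(1,2)])
      fix i j g assume "i < m" "j < m" "g \<in> carrier G"
      then show "U i j g = W i j g"
        using UW mat_group_entry by (intro separated) (auto simp: pcong_mat_group)
    qed
  next
    fix x :: "nat \<Rightarrow> nat \<Rightarrow> nat \<Rightarrow> 'g \<Rightarrow> 'r"
    assume x: "\<And>N. x N \<in> carrier (MG m)" "\<And>N. pcong (MG m) p N (x (Suc N)) (x N)"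
    have "\<forall>i j g. i < m \<longrightarrow> j < m \<longrightarrow> g \<in> carrier G \<longrightarrow> (\<exists>l. l \<in> carrier R \<and> (\<forall>N. pcong R p N l (x N i j g)))"
    proof (intro allI impI)
      fix i j g assume "i < m" "j < m" "g \<in> carrier G"
      then have "\<exists>l\<in>carrier R. \<forall>N. pcong R p N l (x N i j g)"
        using x mat_group_entry[OF x(1)] by (intro complete) (auto simp: pcong_mat_group)
      then show "\<exists>l. l \<in> carrier R \<and> (\<forall>N. pcong R p N l (x N i j g))" by blast
    qed
    then obtain l where l: "\<And>i j g. i < m \<Longrightarrow> j < m \<Longrightarrow> g \<in> carrier G \<Longrightarrow>
        l i j g \<in> carrier R \<and> (\<forall>N. pcong R p N (l i j g) (x N i j g))" by metis
    define Q where "Q i j = (if i < m \<and> j < m then (\<lambda>g\<in>carrier G. l i j g) else \<zero>\<^bsub>RG\<^esub>)" for i j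
    have Q: "Q \<in> carrier (MG m)" using l by (auto simp: Q_def mat_ring_simps group_ring_simps)
    have "pcong (MG m) p N Q (x N)" for N
      using l by (subst pcong_mat_group[OF Q x(1)]) (auto simp: Q_def)
    then show "\<exists>l\<in>carrier (MG m). \<forall>N. pcong (MG m) p N l (x N)" using Q by blast
  qed
qed

text \<open>Quantifying over all \<open>C\<close> and all transversals avoids fixing choices that would have to be
  matched between \<open>R\<close> and \<open>L\<close>.\<close>

definition det_one :: "nat \<Rightarrow> (nat \<Rightarrow> nat \<Rightarrow> 'g \<Rightarrow> 'r) set" where
  "det_one m = {v \<in> Units (MG m). \<forall>C t d. group_ring_restriction R G C t d \<longrightarrow>
     group_ring_restriction.res_det R G C t d m v = \<one>\<^bsub>group_ring R (G\<lparr>carrier := C\<rparr>)\<^esub>}"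

lemma det_one_subgroup: "subgroup (det_one m) (units_of (MG m))"
proof -
  interpret A: ring "RG" by (rule group_ring_ring)
  interpret B: ring "MG m" by (rule A.mat_ring_ring)
  interpret U: group "units_of (MG m)" by (rule B.units_group)
  show ?thesis
  proof (rule U.subgroupI)
    show "det_one m \<subseteq> carrier (units_of (MG m))" by (auto simp: det_one_def units_of_carrier)
    have "\<one>\<^bsub>MG m\<^esub> \<in> det_one m"
      by (auto simp: det_one_def group_ring_restriction.res_det_one)
    then show "det_one m \<noteq> {}" by blast
  next
    fix v assume v: "v \<in> det_one m"
    then have vU: "v \<in> Units (MG m)" by (simp add: det_one_def)
    have "group_ring_restriction.res_det R G C t d m (inv\<^bsub>MG m\<^esub> v) = \<one>\<^bsub>group_ring R (G\<lparr>carrier := C\<rparr>)\<^esub>"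
      if r: "group_ring_restriction R G C t d" for C t d
    proof -
      interpret C: group_ring_restriction R G C t d by (rule r)
      have "C.res_det m (v \<otimes>\<^bsub>MG m\<^esub> inv\<^bsub>MG m\<^esub> v) = C.res_det m v \<otimes>\<^bsub>C.RC\<^esub> C.res_det m (inv\<^bsub>MG m\<^esub> v)"
        using vU by (intro C.res_det_mult) auto
      moreover have "C.res_det m v = \<one>\<^bsub>C.RC\<^esub>" using v r by (simp add: det_one_def)
      ultimately show ?thesis using vU C.res_det_closed[of "inv\<^bsub>MG m\<^esub> v" m] by (simp add: C.res_det_one)
    qed
    then show "inv\<^bsub>units_of (MG m)\<^esub> v \<in> det_one m"
      using vU by (simp add: det_one_def B.units_of_inv)
  next
    fix v w assume vw: "v \<in> det_one m" "w \<in> det_one m"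
    have "group_ring_restriction.res_det R G C t d m (v \<otimes>\<^bsub>MG m\<^esub> w) = \<one>\<^bsub>group_ring R (G\<lparr>carrier := C\<rparr>)\<^esub>"
      if r: "group_ring_restriction R G C t d" for C t d
    proof -
      interpret C: group_ring_restriction R G C t d by (rule r)
      have "C.res_det m v = \<one>\<^bsub>C.RC\<^esub>" "C.res_det m w = \<one>\<^bsub>C.RC\<^esub>" using vw r by (simp_all add: det_one_def)
      then show ?thesis using C.res_det_mult[of v m w] vw by (simp add: det_one_def B.Units_closed)
    qed
    then show "v \<otimes>\<^bsub>units_of (MG m)\<^esub> w \<in> det_one m"
      using vw by (simp add: det_one_def units_of_mult)
  qed
qed

text \<open>The determinant takes values in the commutative ring R[C], where the factors of a
  commutator can be rearranged and cancelled.\<close>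

lemma gcomm_det_one:
  assumes "v \<in> Units (MG m)" "w \<in> Units (MG m)"
  shows "ring.gcomm (MG m) v w \<in> det_one m"
proof -
  interpret A: ring "RG" by (rule group_ring_ring)
  interpret B: ring "MG m" by (rule A.mat_ring_ring)
  have cl: "v \<in> carrier (MG m)" "w \<in> carrier (MG m)"
    "inv\<^bsub>MG m\<^esub> v \<in> carrier (MG m)" "inv\<^bsub>MG m\<^esub> w \<in> carrier (MG m)"
    using assms by auto
  have "group_ring_restriction.res_det R G C t d m (B.gcomm v w) = \<one>\<^bsub>group_ring R (G\<lparr>carrier := C\<rparr>)\<^esub>"
    if r: "group_ring_restriction R G C t d" for C t d
  proof -
    interpret C: group_ring_restriction R G C t d by (rule r)
    have dc: "C.res_det m v \<in> carrier C.RC" "C.res_det m w \<in> carrier C.RC"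
      "C.res_det m (inv\<^bsub>MG m\<^esub> v) \<in> carrier C.RC" "C.res_det m (inv\<^bsub>MG m\<^esub> w) \<in> carrier C.RC"
      using cl C.res_det_closed by auto
    have "C.res_det m (B.gcomm v w) = C.res_det m v \<otimes>\<^bsub>C.RC\<^esub> C.res_det m w \<otimes>\<^bsub>C.RC\<^esub>
        C.res_det m (inv\<^bsub>MG m\<^esub> v) \<otimes>\<^bsub>C.RC\<^esub> C.res_det m (inv\<^bsub>MG m\<^esub> w)"
      using cl by (simp add: B.gcomm_def C.res_det_mult)
    also have "\<dots> = (C.res_det m v \<otimes>\<^bsub>C.RC\<^esub> C.res_det m (inv\<^bsub>MG m\<^esub> v)) \<otimes>\<^bsub>C.RC\<^esub>
        (C.res_det m w \<otimes>\<^bsub>C.RC\<^esub> C.res_det m (inv\<^bsub>MG m\<^esub> w))"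
      using dc by (simp add: C.RC.m_ac)
    also have "\<dots> = \<one>\<^bsub>C.RC\<^esub>"
      using cl assms by (simp add: C.res_det_mult[symmetric] C.res_det_one)
    finally show ?thesis .
  qed
  then show ?thesis using assms by (simp add: det_one_def)
qed

text \<open>Take p-th powers M times. Each power raises the precision by one, preserves the
  coefficient modulo p and stays in the subgroup \<open>det_one m\<close>.\<close>

lemma det_one_powers:
  assumes c: "c \<in> carrier (MG m)" and N: "1 \<le> N" "2 < p ^ N"
    and v: "\<one>\<^bsub>MG m\<^esub> \<oplus>\<^bsub>MG m\<^esub> add_pow (MG m) (p ^ N) c \<in> det_one m"
  shows "\<exists>c'. pcong (MG m) p 1 c' c \<and>
    \<one>\<^bsub>MG m\<^esub> \<oplus>\<^bsub>MG m\<^esub> add_pow (MG m) (p ^ (N + M)) c' \<in> det_one m"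
proof (induction M)
  case 0
  interpret A: ring "RG" by (rule group_ring_ring)
  interpret B: ring "MG m" by (rule A.mat_ring_ring)
  show ?case using c v by (intro exI[of _ c]) auto
next
  case (Suc M)
  interpret A: ring "RG" by (rule group_ring_ring)
  interpret B: ring "MG m" by (rule A.mat_ring_ring)
  interpret H: subgroup "det_one m" "units_of (MG m)" by (rule det_one_subgroup)
  obtain c' where c': "pcong (MG m) p 1 c' c"
    "\<one>\<^bsub>MG m\<^esub> \<oplus>\<^bsub>MG m\<^esub> add_pow (MG m) (p ^ (N + M)) c' \<in> det_one m" using Suc by auto
  have "p ^ N \<le> p ^ (N + M)" using p_pos by (intro power_increasing) auto
  then have NM: "2 < p ^ (N + M)" using N(2) by linarith
  have c'c: "c' \<in> carrier (MG m)" using c'(1) by (rule B.pcong_closed)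
  obtain b' where b': "pcong (MG m) p 1 b' c'"
    "(\<one>\<^bsub>MG m\<^esub> \<oplus>\<^bsub>MG m\<^esub> add_pow (MG m) (p ^ (N + M)) c') [^]\<^bsub>MG m\<^esub> p =
       \<one>\<^bsub>MG m\<^esub> \<oplus>\<^bsub>MG m\<^esub> add_pow (MG m) (p ^ Suc (N + M)) b'"
    using B.one_plus_pow_prime[OF prime_p _ NM c'c] N(1) by auto
  have "x [^]\<^bsub>MG m\<^esub> (k::nat) \<in> det_one m" if "x \<in> det_one m" for x k
  proof (induction k)
    case 0
    then show ?case using H.one_closed by (simp add: units_of_one)
  next
    case (Suc k)
    then show ?case using H.m_closed[OF Suc that] by (simp add: units_of_mult)
  qed
  from this[OF c'(2), of p] show ?case
    unfolding b'(2) using B.pcong_trans[OF b'(1) c'(1)] by auto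
qed

section \<open>From determinants to the divisibility of class sums\<close>

lemma add_pow_coprime_dvd:
  assumes s: "s \<in> carrier R" and r: "r \<in> carrier R" and eq: "[(h::nat)] \<cdot> s = [p] \<cdot> r" and h: "\<not> p dvd h"
  shows "\<exists>r'\<in>carrier R. s = [p] \<cdot> r'"
proof -
  have "coprime h p" using prime_imp_coprime[OF prime_p h] by (simp add: coprime_commute)
  \<comment> \<open>Multiplying h s = p r by a gives p (a r) = p (k s) + s, so s = p (a r - k
    s).\<close>
  then obtain a k where "h * a = p * k + 1"
    using coprime_bezout_strong[of h p] prime_p by (auto simp: prime_nat_iff)
  then have "[(h * a)] \<cdot> s = [(p * k)] \<cdot> s \<oplus> s" using s by (simp add: add.nat_pow_mult[symmetric])
  moreover have "[(h * a)] \<cdot> s = [p] \<cdot> ([a] \<cdot> r)"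
    using s r arg_cong[OF eq, of "\<lambda>z. [a] \<cdot> z"] by (simp add: add.nat_pow_pow mult.commute)
  ultimately have e: "[p] \<cdot> ([a] \<cdot> r) = [p] \<cdot> ([k] \<cdot> s) \<oplus> s"
    using s by (simp add: add.nat_pow_pow mult.commute)
  have "s = [p] \<cdot> ([a] \<cdot> r) \<ominus> [p] \<cdot> ([k] \<cdot> s)"
    unfolding e using s by (simp add: minus_eq a_ac r_neg r_neg1 r_neg2)
  also have "\<dots> = [p] \<cdot> ([a] \<cdot> r \<ominus> [k] \<cdot> s)"
    using s r by (simp add: minus_eq add.nat_pow_distrib add.nat_pow_inv)
  finally show ?thesis using s r by blast
qed

text \<open>The fibre over x = z g z^-1 is the coset z C_G(g).\<close>

lemma conj_fibre_card:
  assumes g: "g \<in> carrier G" and x: "x \<in> conj_class g"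
  shows "card {y \<in> carrier G. y \<otimes>\<^bsub>G\<^esub> g \<otimes>\<^bsub>G\<^esub> inv\<^bsub>G\<^esub> y = x} = card {y \<in> carrier G. y \<otimes>\<^bsub>G\<^esub> g \<otimes>\<^bsub>G\<^esub> inv\<^bsub>G\<^esub> y = g}"
proof -
  obtain z where z: "z \<in> carrier G" "x = z \<otimes>\<^bsub>G\<^esub> g \<otimes>\<^bsub>G\<^esub> inv\<^bsub>G\<^esub> z" using x by (auto simp: conj_class_def)
  have conj: "(z \<otimes>\<^bsub>G\<^esub> y) \<otimes>\<^bsub>G\<^esub> g \<otimes>\<^bsub>G\<^esub> inv\<^bsub>G\<^esub> (z \<otimes>\<^bsub>G\<^esub> y) = z \<otimes>\<^bsub>G\<^esub> (y \<otimes>\<^bsub>G\<^esub> g \<otimes>\<^bsub>G\<^esub> inv\<^bsub>G\<^esub> y) \<otimes>\<^bsub>G\<^esub> inv\<^bsub>G\<^esub> z"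
    if "y \<in> carrier G" for y using that z g by (simp add: G.m_assoc G.inv_mult_group)
  have cancel: "z \<otimes>\<^bsub>G\<^esub> w \<otimes>\<^bsub>G\<^esub> inv\<^bsub>G\<^esub> z = z \<otimes>\<^bsub>G\<^esub> w' \<otimes>\<^bsub>G\<^esub> inv\<^bsub>G\<^esub> z \<longleftrightarrow> w = w'" if "w \<in> carrier G" "w' \<in> carrier G" for w w'
    using that z by simp
  have "{y \<in> carrier G. y \<otimes>\<^bsub>G\<^esub> g \<otimes>\<^bsub>G\<^esub> inv\<^bsub>G\<^esub> y = x} = (\<lambda>y. z \<otimes>\<^bsub>G\<^esub> y) ` {y \<in> carrier G. y \<otimes>\<^bsub>G\<^esub> g \<otimes>\<^bsub>G\<^esub> inv\<^bsub>G\<^esub> y = g}"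
  proof (intro subset_antisym subsetI)
    fix y assume y: "y \<in> {y \<in> carrier G. y \<otimes>\<^bsub>G\<^esub> g \<otimes>\<^bsub>G\<^esub> inv\<^bsub>G\<^esub> y = x}"
    define w where "w = inv\<^bsub>G\<^esub> z \<otimes>\<^bsub>G\<^esub> y"
    have w: "w \<in> carrier G" "y = z \<otimes>\<^bsub>G\<^esub> w" using y z by (simp_all add: w_def G.m_assoc[symmetric])
    have "w \<otimes>\<^bsub>G\<^esub> g \<otimes>\<^bsub>G\<^esub> inv\<^bsub>G\<^esub> w = g"
      using y z(2) conj[OF w(1)] cancel[of "w \<otimes>\<^bsub>G\<^esub> g \<otimes>\<^bsub>G\<^esub> inv\<^bsub>G\<^esub> w" g] w g by simp
    then show "y \<in> (\<lambda>y. z \<otimes>\<^bsub>G\<^esub> y) ` {y \<in> carrier G. y \<otimes>\<^bsub>G\<^esub> g \<otimes>\<^bsub>G\<^esub> inv\<^bsub>G\<^esub> y = g}" using w by blast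
  qed (use conj z in auto)
  moreover have "inj_on (\<lambda>y. z \<otimes>\<^bsub>G\<^esub> y) {y \<in> carrier G. y \<otimes>\<^bsub>G\<^esub> g \<otimes>\<^bsub>G\<^esub> inv\<^bsub>G\<^esub> y = g}"
    using z by (auto simp: inj_on_def)
  ultimately show ?thesis by (simp add: card_image)
qed

text \<open>The cyclic subgroup generated by g is commutative and contains g.\<close>

lemma restriction_exists:
  assumes g: "g \<in> carrier G"
  obtains C t d where "group_ring_restriction R G C t d" "g \<in> C"
proof -
  let ?C = "generate G {g}"
  have sub: "subgroup ?C G" using g by (intro G.generate_is_subgroup) auto
  obtain t d where t: "G.is_transversal ?C t d" using G.transversal_exists[OF sub fin] .
  have "x \<otimes>\<^bsub>G\<^esub> y = y \<otimes>\<^bsub>G\<^esub> x" if xy: "x \<in> ?C" "y \<in> ?C" for x y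
  proof -
    obtain a b :: int where "x = g [^]\<^bsub>G\<^esub> a" "y = g [^]\<^bsub>G\<^esub> b"
      using xy unfolding G.generate_pow[OF g] by blast
    then show ?thesis using g by (simp add: G.int_pow_mult[symmetric] add.commute)
  qed
  then have "group_ring_restriction R G ?C t d"
    using sub t by (intro group_ring_restriction.intro group_ring_restriction_axioms.intro cring_axioms finite_group_ring_axioms)
  then show ?thesis using that[of ?C t d] by (simp add: generate.incl)
qed

text \<open>Passing to \<open>p\<^sup>M\<close>-th powers for large \<open>M\<close> beats the \<open>p\<close>-part of the order of the
  centralizer of \<open>g\<close>, by which the trace and the class sum differ.\<close>

theorem det_one_class_sum_dvd:
  assumes c: "c \<in> carrier (MG m)" and N: "1 \<le> N" "2 < p ^ N"
    and v: "\<one>\<^bsub>MG m\<^esub> \<oplus>\<^bsub>MG m\<^esub> add_pow (MG m) (p ^ N) c \<in> det_one m"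
    and g: "g \<in> carrier G"
  shows "\<exists>r\<in>carrier R. (\<Oplus>i\<in>{..<m}. \<Oplus>x\<in>conj_class g. c i i x) = [p] \<cdot> r"
proof -
  \<comment> \<open>The order of the centralizer of g, by which the sum over all y in G exceeds the
    class sum.\<close>
  define h where "h = card {y \<in> carrier G. y \<otimes>\<^bsub>G\<^esub> g \<otimes>\<^bsub>G\<^esub> inv\<^bsub>G\<^esub> y = g}"
  have "\<one>\<^bsub>G\<^esub> \<in> {y \<in> carrier G. y \<otimes>\<^bsub>G\<^esub> g \<otimes>\<^bsub>G\<^esub> inv\<^bsub>G\<^esub> y = g}" using g by simp
  then have "h \<noteq> 0" unfolding h_def by (subst card_0_eq) auto
  moreover have "\<not> is_unit p" using prime_p by auto
  ultimately obtain h' where h': "h = p ^ multiplicity p h * h'" "\<not> p dvd h'"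
    by (rule multiplicity_decompose')
  define a where "a = multiplicity p h"
  note h' = h'[folded a_def]
  \<comment> \<open>With p^a the exact power of p in h, a further steps suffice: the trace becomes
    divisible by p^(N+a), and p^N survives after cancelling p^a.\<close>
  obtain c' where c': "pcong (MG m) p 1 c' c"
    "\<one>\<^bsub>MG m\<^esub> \<oplus>\<^bsub>MG m\<^esub> add_pow (MG m) (p ^ (N + a)) c' \<in> det_one m"
    using det_one_powers[OF c N v, of a] by blast
  have c'c: "c' \<in> carrier (MG m)" using c'(1) by (simp add: pcong_def)
  obtain C t d where C: "group_ring_restriction R G C t d" "g \<in> C" using restriction_exists[OF g] .
  interpret C: group_ring_restriction R G C t d by (rule C(1))
  define s where "s b = (\<Oplus>i\<in>{..<m}. \<Oplus>x\<in>conj_class g. b i i x)" for b :: "nat \<Rightarrow> nat \<Rightarrow> 'g \<Rightarrow> 'r"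
  have fincc: "finite (conj_class g)" by (simp add: conj_class_def)
  have sc: "s b \<in> carrier R" if "b \<in> carrier (MG m)" for b
    unfolding s_def using conj_class_closed[OF g] mat_group_entry[OF that] by (auto intro!: finsum_closed)
  have "\<exists>r\<in>carrier R. (\<Oplus>i\<in>{..<m}. \<Oplus>y\<in>carrier G. c' i i (y \<otimes>\<^bsub>G\<^esub> g \<otimes>\<^bsub>G\<^esub> inv\<^bsub>G\<^esub> y)) = [(p ^ (N + a))] \<cdot> r"
  proof (rule C.res_trace_dvd[OF _ p_pos c'c _ C(2)])
    show "C.res_det m (\<one>\<^bsub>MG m\<^esub> \<oplus>\<^bsub>MG m\<^esub> add_pow (MG m) (p ^ (N + a)) c') = \<one>\<^bsub>C.RC\<^esub>"
      using c'(2) C(1) by (simp add: det_one_def)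
  qed (rule torsion_free)
  then obtain r where r: "r \<in> carrier R"
    "(\<Oplus>i\<in>{..<m}. \<Oplus>y\<in>carrier G. c' i i (y \<otimes>\<^bsub>G\<^esub> g \<otimes>\<^bsub>G\<^esub> inv\<^bsub>G\<^esub> y)) = [(p ^ (N + a))] \<cdot> r" by blast
  have "(\<Oplus>i\<in>{..<m}. \<Oplus>y\<in>carrier G. c' i i (y \<otimes>\<^bsub>G\<^esub> g \<otimes>\<^bsub>G\<^esub> inv\<^bsub>G\<^esub> y)) = (\<Oplus>i\<in>{..<m}. [h] \<cdot> (\<Oplus>x\<in>conj_class g. c' i i x))"
  proof (rule finsum_cong', rule refl)
    fix i
    show "(\<Oplus>y\<in>carrier G. c' i i (y \<otimes>\<^bsub>G\<^esub> g \<otimes>\<^bsub>G\<^esub> inv\<^bsub>G\<^esub> y)) = [h] \<cdot> (\<Oplus>x\<in>conj_class g. c' i i x)"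
      using conj_fibre_card[OF g] g mat_group_entry[OF c'c]
      unfolding h_def conj_class_def by (intro finsum_fibres[of _ _ "\<lambda>x. c' i i x"]) auto
  qed (use conj_class_closed[OF g] mat_group_entry[OF c'c] in \<open>auto intro!: finsum_closed\<close>)
  also have "\<dots> = [h] \<cdot> s c'"
    unfolding s_def using conj_class_closed[OF g] mat_group_entry[OF c'c]
    by (intro finsum_add_pow) (auto intro!: finsum_closed)
  finally have hs: "[h] \<cdot> s c' = [(p ^ (N + a))] \<cdot> r" using r(2) by simp
  have "[(p ^ a)] \<cdot> ([h'] \<cdot> s c' \<ominus> [(p ^ N)] \<cdot> r) = [h] \<cdot> s c' \<ominus> [(p ^ (N + a))] \<cdot> r"
    using sc[OF c'c] r(1)
    by (simp add: h'(1) minus_eq add.nat_pow_distrib add.nat_pow_inv add.nat_pow_pow power_add mult.commute)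
  also have "\<dots> = \<zero>" using hs r(1) by (simp add: minus_eq r_neg)
  finally have z: "[(p ^ a)] \<cdot> ([h'] \<cdot> s c' \<ominus> [(p ^ N)] \<cdot> r) = \<zero>" .
  \<comment> \<open>After p^a is cancelled, the remaining factor h' is prime to p and can be removed
    modulo p.\<close>
  have "[h'] \<cdot> s c' \<ominus> [(p ^ N)] \<cdot> r = \<zero>"
    by (rule torsion_free[OF _ _ z]) (use sc[OF c'c] r(1) p_pos in auto)
  then have "[h'] \<cdot> s c' = [(p ^ N)] \<cdot> r" using sc[OF c'c] r(1) by simp
  also have "\<dots> = [p] \<cdot> ([(p ^ (N - 1))] \<cdot> r)"
    using N(1) r(1) by (simp add: add.nat_pow_pow power_Suc2[symmetric] del: power_Suc)
  finally obtain r' where r': "r' \<in> carrier R" "s c' = [p] \<cdot> r'"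
    using add_pow_coprime_dvd[OF sc[OF c'c] _ _ h'(2), of "[(p ^ (N - 1))] \<cdot> r"] r(1) by auto
  \<comment> \<open>Divisibility by p was obtained for c' but depends only on c' modulo p, so it
    passes to c.\<close>
  have "pcong R p 1 (s c') (s c)"
  proof -
    have "pcong R p 1 (c' i i x) (c i i x)" if "i < m" "x \<in> conj_class g" for i x
      using c'(1) that conj_class_closed[OF g that(2)] unfolding pcong_mat_group[OF c'c c] by blast
    then show ?thesis unfolding s_def by (intro pcong_finsum fincc finite_lessThan) simp
  qed
  then have "pcong R p 1 (s c) (s c')" by (rule pcong_sym)
  then obtain q where "q \<in> carrier R" "s c = s c' \<oplus> [p] \<cdot> q" by (auto simp: pcong_def)
  then have "s c = [p] \<cdot> (r' \<oplus> q)" using r' by (simp add: add.nat_pow_distrib)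
  then show ?thesis using r' \<open>q \<in> carrier R\<close> by (auto simp: s_def)
qed

text \<open>The link between the two halves: the determinant condition provides the class-sum
  divisibility at every precision N at least n, the spanning theorem turns it into a solution of the
  linearized equation, and successive approximation concludes.\<close>

theorem det_one_derived:
  assumes m: "2 \<le> m" and n: "1 \<le> n" "2 < p ^ n"
    and u: "u \<in> det_one m" "pcong (MG m) p n u \<one>\<^bsub>MG m\<^esub>"
  shows "u \<in> derived (units_of (MG m)) (carrier (units_of (MG m)))"
proof -
  interpret A: ring "RG" by (rule group_ring_ring)
  interpret B: padic_ring "MG m" p by (rule mat_padic)
  obtain idx where idx: "bij_betw idx {..<card (elem_idx m)} (elem_idx m)"
    using ex_bij_betw_nat_finite[OF finite_elem_idx] by (auto simp: atLeast0LessThan)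
  let ?d = "card (elem_idx m)"
  \<comment> \<open>The value 1 beyond the enumeration is a default: the approximation asks for a
    unit at every index.\<close>
  define e where "e k = (if k < ?d then elem_mat m (idx k) else \<one>\<^bsub>MG m\<^esub>)" for k
  have e: "e k \<in> Units (MG m)" for k
    using elem_mat_Units[of "idx k" m] idx by (auto simp: e_def bij_betw_def)
  obtain v where v: "\<And>i. v i \<in> Units (MG m)" "u = B.gcomm_prod e v ?d"
  proof (rule B.gcomm_prod_eqI[OF det_one_subgroup _ u n(1) e])
    fix N c assume N: "n \<le> N" and c: "c \<in> carrier (MG m)"
      and v: "\<one>\<^bsub>MG m\<^esub> \<oplus>\<^bsub>MG m\<^esub> add_pow (MG m) (p ^ N) c \<in> det_one m"
    have "p ^ n \<le> p ^ N" using p_pos N by (intro power_increasing) auto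
    then have "2 < p ^ N" "1 \<le> N" using n N by linarith+
    then have "c \<in> B.comm_span e ?d p"
      using det_one_class_sum_dvd[OF c _ _ v]
      by (intro trace_kernel_comm_span[OF m idx _ B.Units_closed[OF e] c]) (auto simp: e_def)
    then show "\<exists>y. (\<forall>i. y i \<in> carrier (MG m)) \<and> pcong (MG m) p 1 c (B.acomm_sum e y ?d)"
      by (simp add: B.comm_span_def)
  qed (use gcomm_det_one in auto)
  show ?thesis unfolding v(2) by (rule B.gcomm_prod_derived[OF e v(1)])
qed

end

section \<open>Functoriality of \<open>K\<^sub>1\<close>\<close>

abbreviation DGL :: "('a, 'm) ring_scheme \<Rightarrow> (nat \<Rightarrow> nat \<Rightarrow> 'a) set" where
  "DGL A \<equiv> derived (GL A) (carrier (GL A))"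

lemma (in ring) DGL_normal: "DGL R \<lhd> GL R"
  by (intro group.derived_self_is_normal GL_group)

lemma (in ring) DGL_subgroup: "subgroup (DGL R) (GL R)"
  using DGL_normal by (rule normal_imp_subgroup)

lemma (in ring) K1_group: "group (K1 R)"
  unfolding K1_def by (rule normal.factorgroup_is_group[OF DGL_normal])

lemma K1_carrier: "carrier (K1 A) = (\<lambda>M. DGL A #>\<^bsub>GL A\<^esub> M) ` carrier (GL A)"
  by (simp add: K1_def carrier_FactGroup)

lemma (in ring) K1_coset_eq_one_iff:
  assumes "M \<in> carrier (GL R)"
  shows "DGL R #>\<^bsub>GL R\<^esub> M = \<one>\<^bsub>K1 R\<^esub> \<longleftrightarrow> M \<in> DGL R"
  unfolding K1_def one_FactGroup
  using group.coset_join1[OF GL_group _ assms DGL_subgroup] group.coset_join2[OF GL_group assms DGL_subgroup] by blast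

context ring_hom_ring begin

lemma mat_map_DGL: "M \<in> DGL R \<Longrightarrow> mat_map h M \<in> DGL S"
proof -
  interpret g: group_hom "GL R" "GL S" "mat_map h" by (rule mat_map_GL)
  have "mat_map h ` DGL R = derived (GL S) (mat_map h ` carrier (GL R))"
    by (intro g.derived_img[symmetric]) simp
  also have "\<dots> \<subseteq> DGL S"
    by (intro group.mono_derived S.GL_group) (auto intro: g.hom_closed)
  finally show "M \<in> DGL R \<Longrightarrow> mat_map h M \<in> DGL S" by blast
qed

text \<open>\<open>K1_map\<close> extracts the only element of a set of cosets. The set is a
  singleton because the map on GL sends the commutator subgroup into the commutator
  subgroup.\<close>

lemma K1_map_coset:
  assumes M: "M \<in> carrier (GL R)"
  shows "K1_map S h (DGL R #>\<^bsub>GL R\<^esub> M) = DGL S #>\<^bsub>GL S\<^esub> mat_map h M"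
proof -
  interpret g: group_hom "GL R" "GL S" "mat_map h" by (rule mat_map_GL)
  interpret DS: subgroup "DGL S" "GL S" by (rule S.DGL_subgroup)
  interpret DR: subgroup "DGL R" "GL R" by (rule R.DGL_subgroup)
  have "DGL S #>\<^bsub>GL S\<^esub> mat_map h N = DGL S #>\<^bsub>GL S\<^esub> mat_map h M" if N: "N \<in> DGL R #>\<^bsub>GL R\<^esub> M" for N
  proof -
    obtain d where d: "d \<in> DGL R" "N = d \<otimes>\<^bsub>GL R\<^esub> M" using N by (auto simp: r_coset_def)
    have "mat_map h N = mat_map h d \<otimes>\<^bsub>GL S\<^esub> mat_map h M" using d M DR.mem_carrier by (simp add: g.hom_mult)
    then have "mat_map h N \<in> DGL S #>\<^bsub>GL S\<^esub> mat_map h M"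
      using mat_map_DGL[OF d(1)] by (auto simp: r_coset_def)
    then show ?thesis using M by (intro g.H.repr_independence[symmetric] S.DGL_subgroup g.hom_closed)
  qed
  moreover have "M \<in> DGL R #>\<^bsub>GL R\<^esub> M" by (rule group.rcos_self[OF R.GL_group M R.DGL_subgroup])
  ultimately have "(\<lambda>N. DGL S #>\<^bsub>GL S\<^esub> mat_map h N) ` (DGL R #>\<^bsub>GL R\<^esub> M) = {DGL S #>\<^bsub>GL S\<^esub> mat_map h M}" by blast
  then show ?thesis by (simp add: K1_map_def mat_map_def[symmetric])
qed

lemma K1_map_group_hom: "group_hom (K1 R) (K1 S) (K1_map S h)"
proof -
  interpret g: group_hom "GL R" "GL S" "mat_map h" by (rule mat_map_GL)
  interpret NR: normal "DGL R" "GL R" by (rule R.DGL_normal)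
  interpret NS: normal "DGL S" "GL S" by (rule S.DGL_normal)
  have "K1_map S h \<in> hom (K1 R) (K1 S)"
  proof (rule homI)
    fix x assume "x \<in> carrier (K1 R)"
    then show "K1_map S h x \<in> carrier (K1 S)" by (auto simp: K1_carrier K1_map_coset intro!: imageI)
  next
    fix x y assume "x \<in> carrier (K1 R)" "y \<in> carrier (K1 R)"
    then obtain M N where MN: "M \<in> carrier (GL R)" "N \<in> carrier (GL R)"
      "x = DGL R #>\<^bsub>GL R\<^esub> M" "y = DGL R #>\<^bsub>GL R\<^esub> N" by (auto simp: K1_carrier)
    then have "x \<otimes>\<^bsub>K1 R\<^esub> y = DGL R #>\<^bsub>GL R\<^esub> (M \<otimes>\<^bsub>GL R\<^esub> N)"
      by (simp add: K1_def NR.rcos_sum)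
    then have "K1_map S h (x \<otimes>\<^bsub>K1 R\<^esub> y) = DGL S #>\<^bsub>GL S\<^esub> (mat_map h M \<otimes>\<^bsub>GL S\<^esub> mat_map h N)"
      using MN by (simp add: K1_map_coset g.hom_mult)
    also have "\<dots> = K1_map S h x \<otimes>\<^bsub>K1 S\<^esub> K1_map S h y"
      using MN by (simp add: K1_map_coset) (simp add: K1_def NS.rcos_sum)
    finally show "K1_map S h (x \<otimes>\<^bsub>K1 R\<^esub> y) = K1_map S h x \<otimes>\<^bsub>K1 S\<^esub> K1_map S h y" .
  qed
  then show ?thesis by (intro group_hom.intro group_hom_axioms.intro R.K1_group S.K1_group)
qed

end

lemma group_ring_map_ring_hom:
  fixes G :: "('g, 'k) monoid_scheme"
  assumes "ring_hom_ring R S h" "group G" "finite (carrier G)"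
  shows "ring_hom_ring (group_ring R G) (group_ring S G) (group_ring_map G h)"
proof -
  interpret h: ring_hom_ring R S h by fact
  show ?thesis
    by (intro ring_hom_ringI2 group_ring_map_hom assms finite_group_ring.group_ring_ring
         finite_group_ring.intro finite_group_ring_axioms.intro h.R.ring_axioms h.S.ring_axioms)
qed

lemma (in ring_hom_ring) corner_mat_map: "corner S m (mat_map h M) = mat_map h (corner R m M)"
  by (auto simp: corner_def mat_map_def fun_eq_iff)

text \<open>The entries of the restricted matrix are coefficients of M at positions determined by C
  and t alone, so applying h before or after restriction is the same, and determinants commute with
  homomorphisms.\<close>

lemma res_det_hom:
  fixes G :: "('g, 'k) monoid_scheme"
  assumes R: "group_ring_restriction R G C t d" and S: "group_ring_restriction S G C t d"
    and h: "ring_hom_ring R S h" and M: "M \<in> carrier (mat_ring (group_ring R G) m)"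
  shows "group_ring_map (G\<lparr>carrier := C\<rparr>) h (group_ring_restriction.res_det R G C t d m M)
       = group_ring_restriction.res_det S G C t d m (mat_map (group_ring_map G h) M)"
proof -
  interpret R: group_ring_restriction R G C t d by (rule R)
  interpret S: group_ring_restriction S G C t d by (rule S)
  interpret hC: ring_hom_ring R.RC S.RC "group_ring_map R.GC h"
    by (intro group_ring_map_ring_hom h R.C.group_axioms) simp
  interpret hC: ring_hom_cring R.RC S.RC "group_ring_map R.GC h"
    by (intro ring_hom_cring.intro ring_hom_cring_axioms.intro R.RC.cring_axioms S.RC.cring_axioms hC.homh)
  have M': "mat_map (group_ring_map G h) M \<in> carrier (mat_ring (group_ring S G) m)"
  proof -
    interpret hG: ring_hom_ring R.RG S.RG "group_ring_map G h"
      by (intro group_ring_map_ring_hom h R.G.group_axioms R.fin)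
    show ?thesis using M hG.hom_closed hG.hom_zero by (auto simp: mat_ring_simps mat_map_def)
  qed
  have "group_ring_map R.GC h (R.res M a b) = S.res (mat_map (group_ring_map G h) M) a b" for a b
    by (auto simp: group_ring_map_def R.res_def S.res_def mat_map_def fun_eq_iff)
  then show ?thesis
    unfolding R.res_det_def S.res_det_def using R.res_closed[OF M] by (subst hC.hom_cdet) simp_all
qed

text \<open>Asking for all large m, rather than for one block, makes the property stable under
  products of matrices living in different blocks.\<close>

definition stably_det_one :: "('r, 'm) ring_scheme \<Rightarrow> ('g, 'k) monoid_scheme \<Rightarrow> (nat \<Rightarrow> nat \<Rightarrow> 'g \<Rightarrow> 'r) \<Rightarrow> bool" where
  "stably_det_one R G M \<longleftrightarrow> (\<exists>m0. \<forall>m\<ge>m0. in_block (group_ring R G) m M \<and>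
     (\<forall>C t d. group_ring_restriction R G C t d \<longrightarrow>
        group_ring_restriction.res_det R G C t d m (corner (group_ring R G) m M) = \<one>\<^bsub>group_ring R (G\<lparr>carrier := C\<rparr>)\<^esub>))"

text \<open>Used over L, to turn triviality in K_1(L[G]) into statements about determinants.
  Commutators have determinant 1 over the commutative group ring of C as soon as the block contains
  both entries and their inverses; induction over generation extends this to the whole commutator
  subgroup.\<close>

lemma DGL_stably_det_one:
  fixes R :: "('r, 'm) ring_scheme" and G :: "('g, 'k) monoid_scheme"
  assumes "cring R" "group G" "finite (carrier G)" and M: "M \<in> DGL (group_ring R G)"
  shows "stably_det_one R G M"
proof -
  interpret R: cring R by fact
  interpret finite_group_ring R G
    by (intro finite_group_ring.intro finite_group_ring_axioms.intro assms R.ring_axioms)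
  interpret A: ring "group_ring R G" by (rule group_ring_ring)
  interpret GL: group "GL (group_ring R G)" by (rule A.GL_group)
  let ?A = "group_ring R G"
  let ?D = "\<lambda>C t d m M. group_ring_restriction.res_det R G C t d m (corner (group_ring R G) m M)"
  have Dmult: "?D C t d m (X1 \<otimes>\<^bsub>GL ?A\<^esub> Y1) = ?D C t d m X1 \<otimes>\<^bsub>group_ring R (G\<lparr>carrier := C\<rparr>)\<^esub> ?D C t d m Y1"
    if "group_ring_restriction R G C t d" "in_block ?A m X1" "in_block ?A m Y1" for C t d m and X1 Y1 :: "nat \<Rightarrow> nat \<Rightarrow> 'g \<Rightarrow> 'r"
    using that group_ring_restriction.res_det_mult[OF that(1) A.corner_closed A.corner_closed]
    by (simp add: A.GL_simps A.corner_mult)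
  have Done: "?D C t d m \<one>\<^bsub>GL ?A\<^esub> = \<one>\<^bsub>group_ring R (G\<lparr>carrier := C\<rparr>)\<^esub>"
    if "group_ring_restriction R G C t d" for C t d m
    using that by (simp add: A.GL_simps corner_one group_ring_restriction.res_det_one)
  have Dc: "?D C t d m X1 \<in> carrier (group_ring R (G\<lparr>carrier := C\<rparr>))"
    if "group_ring_restriction R G C t d" "in_block ?A m X1" for C t d m and X1 :: "nat \<Rightarrow> nat \<Rightarrow> 'g \<Rightarrow> 'r"
    using that by (intro group_ring_restriction.res_det_closed A.corner_closed)
  have GLs: "X1 \<in> carrier (stable_mat ?A)" if "X1 \<in> carrier (GL ?A)" for X1
    using that by (auto simp: A.GL_simps Units_def)
  have comm: "stably_det_one R G h" if hd: "h \<in> derived_set (GL ?A) (carrier (GL ?A))" for h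
  proof -
    obtain a b where ab: "a \<in> carrier (GL ?A)" "b \<in> carrier (GL ?A)"
      "h = a \<otimes>\<^bsub>GL ?A\<^esub> b \<otimes>\<^bsub>GL ?A\<^esub> inv\<^bsub>GL ?A\<^esub> a \<otimes>\<^bsub>GL ?A\<^esub> inv\<^bsub>GL ?A\<^esub> b"
      using hd by auto
    have "{a, b, inv\<^bsub>GL ?A\<^esub> a, inv\<^bsub>GL ?A\<^esub> b} \<subseteq> carrier (stable_mat ?A)"
      using ab GLs by auto
    then obtain m0 where m0: "\<And>m X1. m0 \<le> m \<Longrightarrow> X1 \<in> {a, b, inv\<^bsub>GL ?A\<^esub> a, inv\<^bsub>GL ?A\<^esub> b} \<Longrightarrow> in_block ?A m X1"
      using common_block[of "{a, b, inv\<^bsub>GL ?A\<^esub> a, inv\<^bsub>GL ?A\<^esub> b}" ?A] by blast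
    show ?thesis unfolding stably_det_one_def
    proof (intro exI[of _ m0] allI impI conjI)
      fix m assume m: "m0 \<le> m"
      note bl = m0[OF m, of a, simplified] m0[OF m, of b, simplified]
        m0[OF m, of "inv\<^bsub>GL ?A\<^esub> a", simplified] m0[OF m, of "inv\<^bsub>GL ?A\<^esub> b", simplified]
      have bm: "in_block ?A m (X1 \<otimes>\<^bsub>GL ?A\<^esub> Y1)" if "in_block ?A m X1" "in_block ?A m Y1" for X1 Y1 :: "nat \<Rightarrow> nat \<Rightarrow> 'g \<Rightarrow> 'r"
        using A.in_block_mult[OF that] by (simp add: A.GL_simps)
      show "in_block ?A m h" unfolding ab(3) by (intro bm bl)
      fix C t d assume r: "group_ring_restriction R G C t d"
      interpret C: group_ring_restriction R G C t d by (rule r)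
      note dc = bl[THEN Dc[OF r]]
      have "?D C t d m h = ?D C t d m a \<otimes>\<^bsub>C.RC\<^esub> ?D C t d m b \<otimes>\<^bsub>C.RC\<^esub> ?D C t d m (inv\<^bsub>GL ?A\<^esub> a) \<otimes>\<^bsub>C.RC\<^esub> ?D C t d m (inv\<^bsub>GL ?A\<^esub> b)"
        unfolding ab(3) by (simp only: Dmult[OF r] bm bl)
      \<comment> \<open>Commutativity brings the determinants of each matrix and of its inverse
        together.\<close>
      also have "\<dots> = (?D C t d m a \<otimes>\<^bsub>C.RC\<^esub> ?D C t d m (inv\<^bsub>GL ?A\<^esub> a)) \<otimes>\<^bsub>C.RC\<^esub> (?D C t d m b \<otimes>\<^bsub>C.RC\<^esub> ?D C t d m (inv\<^bsub>GL ?A\<^esub> b))"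
        using dc by (simp add: C.RC.m_ac)
      also have "\<dots> = \<one>\<^bsub>C.RC\<^esub>"
        using ab by (simp only: Dmult[OF r, symmetric] bl GL.r_inv Done[OF r]) simp
      finally show "?D C t d m h = \<one>\<^bsub>C.RC\<^esub>" .
    qed
  qed
  have sdo_inv: "stably_det_one R G (inv\<^bsub>GL ?A\<^esub> h)" if h: "h \<in> carrier (GL ?A)" "stably_det_one R G h" for h
  proof -
    have "{inv\<^bsub>GL ?A\<^esub> h} \<subseteq> carrier (stable_mat ?A)" using GLs h(1) by simp
    then obtain m1 where "\<And>m V. m1 \<le> m \<Longrightarrow> V \<in> {inv\<^bsub>GL ?A\<^esub> h} \<Longrightarrow> in_block ?A m V"
      using common_block[of "{inv\<^bsub>GL ?A\<^esub> h}" ?A] by blast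
    then have m1: "\<And>m. m1 \<le> m \<Longrightarrow> in_block ?A m (inv\<^bsub>GL ?A\<^esub> h)" by simp
    obtain m0 where m0: "\<And>m. m0 \<le> m \<Longrightarrow> in_block ?A m h"
      "\<And>m C t d. m0 \<le> m \<Longrightarrow> group_ring_restriction R G C t d \<Longrightarrow> ?D C t d m h = \<one>\<^bsub>group_ring R (G\<lparr>carrier := C\<rparr>)\<^esub>"
      using h(2) unfolding stably_det_one_def by blast
    show ?thesis unfolding stably_det_one_def
    proof (intro exI[of _ "max m0 m1"] allI impI conjI)
      fix m assume m: "max m0 m1 \<le> m"
      show bi: "in_block ?A m (inv\<^bsub>GL ?A\<^esub> h)" using m m1 by simp
      have bh: "in_block ?A m h" using m m0 by simp
      fix C t d assume r: "group_ring_restriction R G C t d"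
      interpret C: group_ring_restriction R G C t d by (rule r)
      have "?D C t d m h \<otimes>\<^bsub>C.RC\<^esub> ?D C t d m (inv\<^bsub>GL ?A\<^esub> h) = \<one>\<^bsub>C.RC\<^esub>"
        using h(1) by (simp only: Dmult[OF r bh bi, symmetric] GL.r_inv Done[OF r])
      moreover have "?D C t d m h = \<one>\<^bsub>C.RC\<^esub>" using m0(2)[OF _ r] m by simp
      ultimately show "?D C t d m (inv\<^bsub>GL ?A\<^esub> h) = \<one>\<^bsub>C.RC\<^esub>"
        using Dc[OF r bi] by simp
    qed
  qed
  have dsub: "derived_set (GL ?A) (carrier (GL ?A)) \<subseteq> carrier (GL ?A)" by (rule GL.derived_set_in_carrier) simp
  show ?thesis using M unfolding derived_def
  proof (induction rule: generate.induct)
    case one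
    show ?case unfolding stably_det_one_def
      using A.in_block_one Done by (auto simp: A.GL_simps)
  next
    case (incl h)
    then show ?case by (rule comm)
  next
    case (inv h)
    then have "h \<in> carrier (GL ?A)" using dsub by blast
    then show ?case by (rule sdo_inv[OF _ comm[OF inv]])
  next
    case (eng x y)
    obtain m0 where m0: "\<And>m. m0 \<le> m \<Longrightarrow> in_block ?A m x"
      "\<And>m C t d. m0 \<le> m \<Longrightarrow> group_ring_restriction R G C t d \<Longrightarrow> ?D C t d m x = \<one>\<^bsub>group_ring R (G\<lparr>carrier := C\<rparr>)\<^esub>"
      using eng(3) unfolding stably_det_one_def by blast
    obtain m1 where m1: "\<And>m. m1 \<le> m \<Longrightarrow> in_block ?A m y"
      "\<And>m C t d. m1 \<le> m \<Longrightarrow> group_ring_restriction R G C t d \<Longrightarrow> ?D C t d m y = \<one>\<^bsub>group_ring R (G\<lparr>carrier := C\<rparr>)\<^esub>"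
      using eng(4) unfolding stably_det_one_def by blast
    show ?case unfolding stably_det_one_def
    proof (intro exI[of _ "max m0 m1"] allI impI conjI)
      fix m assume m: "max m0 m1 \<le> m"
      have b: "in_block ?A m x" "in_block ?A m y" using m m0 m1 by simp_all
      then show "in_block ?A m (x \<otimes>\<^bsub>GL ?A\<^esub> y)" by (simp add: A.GL_simps A.in_block_mult)
      fix C t d assume r: "group_ring_restriction R G C t d"
      interpret C: group_ring_restriction R G C t d by (rule r)
      have "?D C t d m x = \<one>\<^bsub>C.RC\<^esub>" "?D C t d m y = \<one>\<^bsub>C.RC\<^esub>" using m0(2)[OF _ r] m1(2)[OF _ r] m by simp_all
      then show "?D C t d m (x \<otimes>\<^bsub>GL ?A\<^esub> y) = \<one>\<^bsub>C.RC\<^esub>" by (simp add: Dmult[OF r b])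
    qed
  qed
qed

section \<open>Reduction modulo \<open>p\<^sup>n\<close>\<close>

lemma (in monoid) Units_of_products:
  assumes "x \<in> carrier G" "y \<in> carrier G" "x \<otimes> y \<in> Units G" "y \<otimes> x \<in> Units G"
  shows "x \<in> Units G"
proof -
  define a where "a = y \<otimes> inv (x \<otimes> y)"
  define b where "b = inv (y \<otimes> x) \<otimes> y"
  have cl: "a \<in> carrier G" "b \<in> carrier G" using assms by (auto simp: a_def b_def)
  have xa: "x \<otimes> a = \<one>" unfolding a_def using assms by (simp add: m_assoc[symmetric])
  have bx: "b \<otimes> x = \<one>" unfolding b_def using assms by (simp add: m_assoc)
  have "b = a" using inv_unique[OF bx xa assms(1) cl(2) cl(1)] .
  then show ?thesis using xa bx assms(1) cl by (auto simp: Units_def)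
qed

context padic_group_ring begin

abbreviation residue_map :: "nat \<Rightarrow> ('g \<Rightarrow> 'r) \<Rightarrow> 'g \<Rightarrow> 'r set" where
  "residue_map n \<equiv> group_ring_map G (\<lambda>x. pow_ideal R p n +> x)"

lemma residue_hom: "ring_hom_ring R (residue_ring_pow R p n) (\<lambda>x. pow_ideal R p n +> x)"
  unfolding residue_ring_pow_def using ideal.rcos_ring_hom_ring[OF pow_ideal_ideal] .

lemma residue_map_hom:
  "ring_hom_ring RG (group_ring (residue_ring_pow R p n) G) (residue_map n)"
  by (intro group_ring_map_ring_hom residue_hom G.group_axioms fin)

lemma residue_eq_pcong:
  assumes U: "U \<in> carrier (MG m)" and W: "W \<in> carrier (MG m)"
    and eq: "mat_map (residue_map n) (stab RG m U) = mat_map (residue_map n) (stab RG m W)"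
  shows "pcong (MG m) p n U W"
  unfolding pcong_mat_group[OF U W]
proof (intro allI impI ballI)
  fix i j g assume ijg: "i < m" "j < m" "g \<in> carrier G"
  have "mat_map (residue_map n) (stab RG m U) i j g = mat_map (residue_map n) (stab RG m W) i j g"
    by (simp only: eq)
  then have "pow_ideal R p n +> U i j g = pow_ideal R p n +> W i j g"
    using ijg by (simp add: mat_map_def stab_def group_ring_map_def)
  then show "pcong R p n (U i j g) (W i j g)"
    using mat_group_entry[OF U] mat_group_entry[OF W] ijg by (simp add: pow_coset_eq_iff)
qed

text \<open>Lift V and its inverse entry by entry within a common block. The products of the two
  lifts are 1 modulo p^n, hence units by completeness, and so are the lifts.\<close>

lemma residue_GL_surj:
  assumes n: "1 \<le> n"
  shows "mat_map (residue_map n) ` carrier (GL RG) = carrier (GL (group_ring (residue_ring_pow R p n) G))"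
proof (intro subset_antisym subsetI)
  interpret A: ring "RG" by (rule group_ring_ring)
  interpret \<pi>: ring_hom_ring RG "group_ring (residue_ring_pow R p n) G" "residue_map n" by (rule residue_map_hom)
  interpret g: group_hom "GL RG" "GL (group_ring (residue_ring_pow R p n) G)" "mat_map (residue_map n)" by (rule \<pi>.mat_map_GL)
  let ?Q = "group_ring (residue_ring_pow R p n) G"
  show "V \<in> carrier (GL ?Q)" if "V \<in> mat_map (residue_map n) ` carrier (GL RG)" for V
    using that g.hom_closed by auto
  fix V assume V: "V \<in> carrier (GL ?Q)"
  define W where "W = inv\<^bsub>GL ?Q\<^esub> V"
  have W: "W \<in> carrier (GL ?Q)" using V by (simp add: W_def)
  have VW: "V \<otimes>\<^bsub>stable_mat ?Q\<^esub> W = \<one>\<^bsub>stable_mat ?Q\<^esub>" "W \<otimes>\<^bsub>stable_mat ?Q\<^esub> V = \<one>\<^bsub>stable_mat ?Q\<^esub>"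
    using V g.H.r_inv[OF V] g.H.l_inv[OF V] by (simp_all add: W_def \<pi>.S.GL_simps)
  have "{V, W} \<subseteq> carrier (stable_mat ?Q)" using V W by (auto simp: \<pi>.S.GL_simps Units_def)
  then obtain m where m: "in_block ?Q m V" "in_block ?Q m W"
    using common_block[of "{V, W}" ?Q] by (metis finite.intros insertI1 insertI2 order_refl)
  interpret B: padic_ring "MG m" p by (rule mat_padic)
  \<comment> \<open>Coefficients are lifted only inside the block; outside it \<open>stab\<close>
    supplies the identity, which reduces to the identity.\<close>
  have lift: "\<exists>X1\<in>carrier (MG m). mat_map (residue_map n) (stab RG m X1) = Z" if Z: "in_block ?Q m Z" for Z
  proof -
    have Zc: "Z i j \<in> carrier G \<rightarrow>\<^sub>E carrier (residue_ring_pow R p n)" for i j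
      using Z by (auto simp: in_block_def group_ring_def)
    have "\<forall>i j g. g \<in> carrier G \<longrightarrow> (\<exists>r. r \<in> carrier R \<and> pow_ideal R p n +> r = Z i j g)"
    proof (intro allI impI)
      fix i j g assume "g \<in> carrier G"
      then have "Z i j g \<in> carrier (residue_ring_pow R p n)" using Zc[of i j] by auto
      then show "\<exists>r. r \<in> carrier R \<and> pow_ideal R p n +> r = Z i j g"
        by (auto simp: residue_ring_pow_def FactRing_def A_RCOSETS_def')
    qed
    then obtain r where r: "\<And>i j g. g \<in> carrier G \<Longrightarrow> r i j g \<in> carrier R \<and> pow_ideal R p n +> r i j g = Z i j g" by metis
    define X1 where "X1 i j = (if i < m \<and> j < m then (\<lambda>g\<in>carrier G. r i j g) else \<zero>\<^bsub>RG\<^esub>)" for i j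
    have Xc: "X1 \<in> carrier (MG m)" using r by (auto simp: X1_def mat_ring_simps group_ring_simps)
    have "mat_map (residue_map n) (stab RG m X1) i j = Z i j" for i j
    proof (cases "i < m \<and> j < m")
      case True
      then have "mat_map (residue_map n) (stab RG m X1) i j = (\<lambda>g\<in>carrier G. Z i j g)"
        using r by (auto simp: mat_map_def stab_def X1_def group_ring_map_def fun_eq_iff)
      also have "\<dots> = Z i j" using Zc[of i j] by (simp add: PiE_iff extensional_restrict)
      finally show ?thesis .
    next
      case False
      then have "Z i j = (if i = j then \<one>\<^bsub>?Q\<^esub> else \<zero>\<^bsub>?Q\<^esub>)" using Z unfolding in_block_def by (metis not_less)
      then show ?thesis using False by (auto simp: mat_map_def stab_def)
    qed
    then show ?thesis using Xc by blast
  qed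
  obtain X1 where X1: "X1 \<in> carrier (MG m)" "mat_map (residue_map n) (stab RG m X1) = V" using lift[OF m(1)] by blast
  obtain Y1 where Y1: "Y1 \<in> carrier (MG m)" "mat_map (residue_map n) (stab RG m Y1) = W" using lift[OF m(2)] by blast
  have prod: "P \<otimes>\<^bsub>MG m\<^esub> P' \<in> Units (MG m)"
    if P: "P \<in> carrier (MG m)" "P' \<in> carrier (MG m)"
      and one: "mat_map (residue_map n) (stab RG m P) \<otimes>\<^bsub>stable_mat ?Q\<^esub> mat_map (residue_map n) (stab RG m P') = \<one>\<^bsub>stable_mat ?Q\<^esub>"
    for P P'
  proof -
    have "mat_map (residue_map n) (stab RG m (P \<otimes>\<^bsub>MG m\<^esub> P')) = mat_map (residue_map n) (stab RG m \<one>\<^bsub>MG m\<^esub>)"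
      using P one by (simp add: A.stab_mult \<pi>.mat_map_mult in_block_stable[OF A.in_block_stab] stab_one \<pi>.mat_map_one)
    then have "pcong (MG m) p n (P \<otimes>\<^bsub>MG m\<^esub> P') \<one>\<^bsub>MG m\<^esub>"
      using P by (intro residue_eq_pcong) auto
    then show ?thesis by (rule B.pcong_one_Units[OF B.pcong_mono[OF _ n]])
  qed
  have "X1 \<in> Units (MG m)"
    using X1 Y1 VW by (intro B.Units_of_products[of X1 Y1] prod) auto
  then have "stab RG m X1 \<in> carrier (GL RG)" by (rule A.stab_Units)
  then show "V \<in> mat_map (residue_map n) ` carrier (GL RG)" using X1(2) by blast
qed

text \<open>Injectivity at the level of matrices. Triviality modulo p^n provides the congruence to
  1, triviality over L provides the determinants, and both survive division by a common element of
  the commutator subgroup.\<close>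

theorem K1_reduction_kernel:
  fixes L :: "('l, 'h) ring_scheme"
  assumes n: "1 \<le> n" "2 < p ^ n" and L: "cring L" and \<epsilon>: "\<epsilon> \<in> ring_hom R L" "inj_on \<epsilon> (carrier R)"
    and M: "M \<in> carrier (GL RG)"
    and red: "mat_map (residue_map n) M \<in> DGL (group_ring (residue_ring_pow R p n) G)"
    and det: "mat_map (group_ring_map G \<epsilon>) M \<in> DGL (group_ring L G)"
  shows "M \<in> DGL RG"
proof -
  interpret A: ring "RG" by (rule group_ring_ring)
  interpret L: cring L by (rule L)
  interpret \<epsilon>: ring_hom_ring R L \<epsilon> by (intro ring_hom_ringI2 ring_axioms L.ring_axioms \<epsilon>)
  interpret E: ring_hom_ring RG "group_ring L G" "group_ring_map G \<epsilon>"
    by (intro group_ring_map_ring_hom \<epsilon>.ring_hom_ring_axioms G.group_axioms fin)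
  interpret \<pi>: ring_hom_ring RG "group_ring (residue_ring_pow R p n) G" "residue_map n" by (rule residue_map_hom)
  interpret gE: group_hom "GL RG" "GL (group_ring L G)" "mat_map (group_ring_map G \<epsilon>)" by (rule E.mat_map_GL)
  interpret g\<pi>: group_hom "GL RG" "GL (group_ring (residue_ring_pow R p n) G)" "mat_map (residue_map n)" by (rule \<pi>.mat_map_GL)
  interpret DR: subgroup "DGL RG" "GL RG" by (rule A.DGL_subgroup)
  interpret DL: subgroup "DGL (group_ring L G)" "GL (group_ring L G)" by (rule E.S.DGL_subgroup)
  \<comment> \<open>Surjectivity on GL carries commutators onto commutators, so the reduction of M
    can be matched exactly by some \<delta> in the commutator subgroup; M \<delta>^-1 then reduces
    to the identity itself, not just to a trivial class.\<close>
  have "DGL (group_ring (residue_ring_pow R p n) G) = mat_map (residue_map n) ` DGL RG"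
    using g\<pi>.derived_img[of "carrier (GL RG)"] unfolding residue_GL_surj[OF n(1)] by simp
  then obtain \<delta> where \<delta>: "\<delta> \<in> DGL RG" "mat_map (residue_map n) \<delta> = mat_map (residue_map n) M" using red by auto
  have \<delta>c: "\<delta> \<in> carrier (GL RG)" using \<delta>(1) by (rule DR.mem_carrier)
  define u where "u = M \<otimes>\<^bsub>GL RG\<^esub> inv\<^bsub>GL RG\<^esub> \<delta>"
  have u: "u \<in> carrier (GL RG)" using M \<delta>c by (simp add: u_def)
  have u\<pi>: "mat_map (residue_map n) u = \<one>\<^bsub>GL (group_ring (residue_ring_pow R p n) G)\<^esub>"
    using M \<delta>c \<delta>(2) by (simp add: u_def g\<pi>.hom_mult g\<pi>.hom_inv)
  have "mat_map (group_ring_map G \<epsilon>) u \<in> DGL (group_ring L G)"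
    using M \<delta>c det E.mat_map_DGL[OF \<delta>(1)] by (simp add: u_def gE.hom_mult gE.hom_inv)
  then have "stably_det_one L G (mat_map (group_ring_map G \<epsilon>) u)"
    by (intro DGL_stably_det_one L G.group_axioms fin)
  then obtain m0 where m0: "\<And>m C t d. m0 \<le> m \<Longrightarrow> group_ring_restriction L G C t d \<Longrightarrow>
      group_ring_restriction.res_det L G C t d m (corner (group_ring L G) m (mat_map (group_ring_map G \<epsilon>) u)) =
        \<one>\<^bsub>group_ring L (G\<lparr>carrier := C\<rparr>)\<^esub>"
    unfolding stably_det_one_def by blast
  have "{u, inv\<^bsub>GL RG\<^esub> u} \<subseteq> carrier (stable_mat RG)"
    using u gE.G.inv_closed[OF u] by (auto simp: A.GL_simps Units_def)
  then obtain m1 where m1: "\<And>m X1. m1 \<le> m \<Longrightarrow> X1 \<in> {u, inv\<^bsub>GL RG\<^esub> u} \<Longrightarrow> in_block RG m X1"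
    using common_block[of "{u, inv\<^bsub>GL RG\<^esub> u}" RG] by blast
  \<comment> \<open>Three demands: two rows for the spanning by elementary matrices,
    \<open>m0\<close> for the determinants over L, and \<open>m1\<close> for a block containing u
    and its inverse.\<close>
  define m where "m = max 2 (max m0 m1)"
  have bl: "in_block RG m u" "in_block RG m (inv\<^bsub>GL RG\<^esub> u)" by (rule m1; simp add: m_def)+
  interpret B: padic_ring "MG m" p by (rule mat_padic)
  define U where "U = corner RG m u"
  have Uc: "U \<in> carrier (MG m)" unfolding U_def using bl(1) by (rule A.corner_closed)
  have uU: "stab RG m U = u" unfolding U_def using bl(1) by (rule stab_corner)
  have UU: "U \<in> Units (MG m)"
  proof -
    have "u \<otimes>\<^bsub>stable_mat RG\<^esub> inv\<^bsub>GL RG\<^esub> u = \<one>\<^bsub>stable_mat RG\<^esub>" "inv\<^bsub>GL RG\<^esub> u \<otimes>\<^bsub>stable_mat RG\<^esub> u = \<one>\<^bsub>stable_mat RG\<^esub>"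
      using gE.G.r_inv[OF u] gE.G.l_inv[OF u] by (simp_all add: A.GL_simps)
    then have "U \<otimes>\<^bsub>MG m\<^esub> corner RG m (inv\<^bsub>GL RG\<^esub> u) = \<one>\<^bsub>MG m\<^esub>"
      "corner RG m (inv\<^bsub>GL RG\<^esub> u) \<otimes>\<^bsub>MG m\<^esub> U = \<one>\<^bsub>MG m\<^esub>"
      unfolding U_def using bl by (simp_all add: A.corner_mult[symmetric] corner_one)
    then show ?thesis using Uc A.corner_closed[OF bl(2)] by (auto simp: Units_def)
  qed
  have "U \<in> det_one m"
  proof -
    have "group_ring_restriction.res_det R G C t d m U = \<one>\<^bsub>group_ring R (G\<lparr>carrier := C\<rparr>)\<^esub>"
      if r: "group_ring_restriction R G C t d" for C t d
    proof -
      interpret C: group_ring_restriction R G C t d by (rule r)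
      have rL: "group_ring_restriction L G C t d"
        by (intro group_ring_restriction.intro group_ring_restriction_axioms.intro finite_group_ring.intro
            finite_group_ring_axioms.intro L L.ring_axioms G.group_axioms fin C.C_subgroup C.transversal)
           (rule C.C_comm)
      interpret CL: group_ring_restriction L G C t d by (rule rL)
      interpret hC: ring_hom_ring C.RC CL.RC "group_ring_map C.GC \<epsilon>"
        by (intro group_ring_map_ring_hom \<epsilon>.ring_hom_ring_axioms C.C.group_axioms) simp
      have "group_ring_map C.GC \<epsilon> (C.res_det m U) = CL.res_det m (mat_map (group_ring_map G \<epsilon>) U)"
        by (intro res_det_hom r rL \<epsilon>.ring_hom_ring_axioms Uc)
      also have "\<dots> = \<one>\<^bsub>CL.RC\<^esub>"
        unfolding U_def E.corner_mat_map[symmetric] by (intro m0 rL) (simp add: m_def)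
      also have "\<dots> = group_ring_map C.GC \<epsilon> \<one>\<^bsub>C.RC\<^esub>" by simp
      finally have eq: "group_ring_map C.GC \<epsilon> (C.res_det m U) = group_ring_map C.GC \<epsilon> \<one>\<^bsub>C.RC\<^esub>" .
      \<comment> \<open>Injectivity of \<epsilon> on coefficients gives injectivity of R[C] -> L[C],
        which brings the determinant identity back from L to R.\<close>
      have "f = f'" if f: "f \<in> carrier C.RC" "f' \<in> carrier C.RC" "group_ring_map C.GC \<epsilon> f = group_ring_map C.GC \<epsilon> f'" for f f'
      proof (rule extensionalityI[of _ C])
        show "f \<in> extensional C" "f' \<in> extensional C" using f by (auto intro: C.RC_extensional)
        fix c assume c: "c \<in> C"
        have "\<epsilon> (f c) = \<epsilon> (f' c)" using fun_cong[OF f(3), of c] c by (simp add: group_ring_map_def)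
        moreover have "f c \<in> carrier R" "f' c \<in> carrier R" using f(1,2) c by (auto simp: C.SC.group_ring_simps PiE_iff)
        ultimately show "f c = f' c" using \<epsilon>(2) by (simp add: inj_on_def)
      qed
      from this[OF C.res_det_closed[OF Uc] _ eq] show ?thesis by simp
    qed
    then show ?thesis using UU by (simp add: det_one_def)
  qed
  moreover have "pcong (MG m) p n U \<one>\<^bsub>MG m\<^esub>"
    using u\<pi> by (intro residue_eq_pcong Uc B.one_closed) (simp add: uU stab_one \<pi>.mat_map_one \<pi>.S.GL_simps)
  ultimately have UD: "U \<in> derived (units_of (MG m)) (carrier (units_of (MG m)))"
    using n by (intro det_one_derived) (simp_all add: m_def)
  interpret s: group_hom "units_of (MG m)" "GL RG" "stab RG m"
    by (intro group_hom.intro group_hom_axioms.intro B.units_group A.GL_group A.stab_hom)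
  have "stab RG m U \<in> derived (GL RG) (stab RG m ` carrier (units_of (MG m)))"
    using UD s.derived_img[of "carrier (units_of (MG m))"] by auto
  also have "\<dots> \<subseteq> DGL RG"
    using s.hom_closed by (intro group.mono_derived[OF A.GL_group]) auto
  finally have "u \<in> DGL RG" by (simp add: uU)
  then have "u \<otimes>\<^bsub>GL RG\<^esub> \<delta> \<in> DGL RG" using \<delta>(1) by (rule DR.m_closed)
  moreover have "u \<otimes>\<^bsub>GL RG\<^esub> \<delta> = M" using M \<delta>c by (simp add: u_def gE.G.m_assoc)
  ultimately show ?thesis by simp
qed

end

theorem theorem1p5:
  fixes R :: "('r, 'm) ring_scheme"
    and N :: "('f, 'k) ring_scheme"
    and L :: "('l, 'h) ring_scheme"
    and G :: "('g, 'q) monoid_scheme"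
    and \<iota> :: "'r \<Rightarrow> 'f" and \<kappa> :: "'f \<Rightarrow> 'l"
    and p n :: nat
  assumes "Factorial_Ring.prime p"
    and "noetherian_domain R"
    and "krull_dim R < \<infinity>"
    and "padically_complete R p"
    and "is_fraction_field R N \<iota>"
    and "\<forall>m::nat. m > 0 \<longrightarrow> add_pow N m \<one>\<^bsub>N\<^esub> \<noteq> \<zero>\<^bsub>N\<^esub>"
    and "\<kappa> \<in> ring_hom N L" and "algebraic_closure L (\<kappa> ` carrier N)"
    and "group G" and "finite (carrier G)"
    and "n > 0" and "p ^ n > 2"
  shows "K1_reduction R G p n \<in>
           iso ((K1 (group_ring R G))\<lparr>carrier := SK1 R G L (\<kappa> \<circ> \<iota>)\<rparr>)
               ((K1 (group_ring (residue_ring_pow R p n) G))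
                  \<lparr>carrier := SK1_mod R G L (\<kappa> \<circ> \<iota>) p n\<rparr>)"
proof -
  interpret R: domain R using assms(2) by (simp add: noetherian_domain_def)
  have N: "field N" "\<iota> \<in> ring_hom R N" "inj_on \<iota> (carrier R)"
    using assms(5) by (simp_all add: is_fraction_field_def)
  interpret N: field N by (rule N)
  interpret L: algebraic_closure L "\<kappa> ` carrier N" by (rule assms(8))
  interpret \<iota>: ring_hom_ring R N \<iota> by (intro ring_hom_ringI2 R.ring_axioms N.ring_axioms N)
  interpret \<kappa>: ring_hom_ring N L \<kappa> by (intro ring_hom_ringI2 N.ring_axioms L.ring_axioms assms)
  \<comment> \<open>R embeds into the field N of characteristic zero, where a positive multiple of 1
    is not a zero divisor.\<close>
  have tf: "r = \<zero>\<^bsub>R\<^esub>" if k: "0 < k" and r: "r \<in> carrier R" and z: "add_pow R k r = \<zero>\<^bsub>R\<^esub>" for k :: nat and r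
  proof -
    have hp: "\<iota> (add_pow R k r) = add_pow N k (\<iota> r)" for k :: nat
      using r by (induction k) auto
    have "add_pow N k \<one>\<^bsub>N\<^esub> \<otimes>\<^bsub>N\<^esub> \<iota> r = \<iota> (add_pow R k r)"
      using r by (simp add: hp N.add_pow_ldistr)
    also have "\<dots> = \<zero>\<^bsub>N\<^esub>" by (simp add: z)
    finally have "add_pow N k \<one>\<^bsub>N\<^esub> = \<zero>\<^bsub>N\<^esub> \<or> \<iota> r = \<zero>\<^bsub>N\<^esub>"
      by (rule N.integral) (use r in auto)
    then have "\<iota> r = \<zero>\<^bsub>N\<^esub>" using assms(6) k by blast
    then have "\<iota> r = \<iota> \<zero>\<^bsub>R\<^esub>" by simp
    then show ?thesis using N(3) r by (simp add: inj_on_def)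
  qed
  interpret padic_group_ring R p G
  proof (intro padic_group_ring.intro padic_group_ring_axioms.intro)
    show "finite_group_ring R G"
      by (intro finite_group_ring.intro finite_group_ring_axioms.intro R.ring_axioms assms(9,10))
  qed (rule R.cring_axioms R.padic_ringI[OF assms(4)] assms(1) tf; assumption)+
  have "inj_on \<kappa> (carrier N)"
  proof -
    have "\<one>\<^bsub>L\<^esub> \<noteq> \<zero>\<^bsub>L\<^esub>" by simp
    then show ?thesis using non_trivial_field_hom_is_inj[OF assms(7) N.field_axioms L.field_axioms] by simp
  qed
  then have inj: "inj_on (\<kappa> \<circ> \<iota>) (carrier R)"
    using N(3) \<iota>.hom_closed by (intro comp_inj_on) (auto intro: inj_on_subset)
  have hom: "\<kappa> \<circ> \<iota> \<in> ring_hom R L" using ring_hom_trans[OF N(2) assms(7)] .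
  interpret \<epsilon>: ring_hom_ring R L "\<kappa> \<circ> \<iota>" by (intro ring_hom_ringI2 R.ring_axioms L.ring_axioms hom)
  interpret E: ring_hom_ring "group_ring R G" "group_ring L G" "group_ring_map G (\<kappa> \<circ> \<iota>)"
    by (rule group_ring_map_ring_hom[OF \<epsilon>.ring_hom_ring_axioms assms(9,10)])
  interpret \<pi>: ring_hom_ring "group_ring R G" "group_ring (residue_ring_pow R p n) G" "residue_map n"
    by (rule residue_map_hom)
  interpret D: group_hom "K1 (group_ring R G)" "K1 (group_ring L G)" "Det G L (\<kappa> \<circ> \<iota>)"
    unfolding Det_def by (rule E.K1_map_group_hom)
  interpret K: group_hom "K1 (group_ring R G)" "K1 (group_ring (residue_ring_pow R p n) G)" "K1_reduction R G p n"
    unfolding K1_reduction_def by (rule \<pi>.K1_map_group_hom)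
  define SK where "SK = SK1 R G L (\<kappa> \<circ> \<iota>)"
  interpret SK: subgroup SK "K1 (group_ring R G)"
    unfolding SK_def SK1_def by (rule D.subgroup_kernel)
  \<comment> \<open>Both conditions on the class x are conditions on a representing matrix M: its
    image over L and its reduction lie in the respective commutator subgroups.\<close>
  have ker: "x = \<one>\<^bsub>K1 (group_ring R G)\<^esub>"
    if x: "x \<in> SK" and red: "K1_reduction R G p n x = \<one>\<^bsub>K1 (group_ring (residue_ring_pow R p n) G)\<^esub>" for x
  proof -
    obtain M where M: "M \<in> carrier (GL (group_ring R G))" "x = DGL (group_ring R G) #>\<^bsub>GL (group_ring R G)\<^esub> M"
      using SK.mem_carrier[OF x] by (auto simp: K1_carrier)
    have GLc: "mat_map (residue_map n) M \<in> carrier (GL (group_ring (residue_ring_pow R p n) G))"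
      "mat_map (group_ring_map G (\<kappa> \<circ> \<iota>)) M \<in> carrier (GL (group_ring L G))"
      using M(1) group_hom.hom_closed[OF \<pi>.mat_map_GL] group_hom.hom_closed[OF E.mat_map_GL] by auto
    have "mat_map (residue_map n) M \<in> DGL (group_ring (residue_ring_pow R p n) G)"
      using red GLc(1) unfolding K1_reduction_def M(2) \<pi>.K1_map_coset[OF M(1)]
      by (simp add: \<pi>.S.K1_coset_eq_one_iff)
    moreover have "Det G L (\<kappa> \<circ> \<iota>) x = \<one>\<^bsub>K1 (group_ring L G)\<^esub>"
      using x unfolding SK_def SK1_def kernel_def by blast
    then have "mat_map (group_ring_map G (\<kappa> \<circ> \<iota>)) M \<in> DGL (group_ring L G)"
      using GLc(2) unfolding Det_def M(2) E.K1_map_coset[OF M(1)]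
      by (simp add: E.S.K1_coset_eq_one_iff)
    ultimately have "M \<in> DGL (group_ring R G)"
      using assms(11,12) by (intro K1_reduction_kernel[OF _ _ L.cring_axioms hom inj M(1)]) auto
    then show ?thesis using M by (simp add: E.R.K1_coset_eq_one_iff)
  qed
  have "inj_on (K1_reduction R G p n) SK"
  proof (rule inj_onI)
    fix x y assume xy: "x \<in> SK" "y \<in> SK" "K1_reduction R G p n x = K1_reduction R G p n y"
    have c: "x \<in> carrier (K1 (group_ring R G))" "y \<in> carrier (K1 (group_ring R G))" using xy by auto
    have "x \<otimes>\<^bsub>K1 (group_ring R G)\<^esub> inv\<^bsub>K1 (group_ring R G)\<^esub> y = \<one>\<^bsub>K1 (group_ring R G)\<^esub>"
    proof (rule ker)
      show "x \<otimes>\<^bsub>K1 (group_ring R G)\<^esub> inv\<^bsub>K1 (group_ring R G)\<^esub> y \<in> SK" using xy by simp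
    qed (use c xy(3) in \<open>simp add: K.hom_mult K.hom_inv\<close>)
    then show "x = y" using c by (simp add: D.G.inv_solve_right')
  qed
  \<comment> \<open>The target carrier is by definition the image, so the homomorphism is onto it
    and injectivity suffices for an isomorphism.\<close>
  moreover have "K1_reduction R G p n \<in> hom ((K1 (group_ring R G))\<lparr>carrier := SK\<rparr>)
      ((K1 (group_ring (residue_ring_pow R p n) G))\<lparr>carrier := K1_reduction R G p n ` SK\<rparr>)"
    by (rule homI) (auto intro: K.hom_mult)
  ultimately show ?thesis
    unfolding SK1_mod_def SK_def[symmetric] iso_def by (simp add: bij_betw_def)
qed

end
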